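(* Let $I\subseteq\Delta$, let $\mathcal R$ be the set of regular weights in $\mathfrak h^*$, and let $\lambda\in\Lambda_I^+\cap\mathcal R$. Let $\Psi:=\Phi\setminus\Phi_I$, $\Psi^+:=\Psi\cap\Phi^+$ and $\Psi_\lambda^+:=\{\beta\in\Psi^+:\langle\lambda+\rho,\beta^\vee\rangle\in\mathbb Z^{>0}\}$. Then $\Psi_\lambda^+=\emptyset$ if and only if $\lambda=w_I\cdot\nu$ for some antidominant weight $\nu\in\mathfrak h^*$.
   Context: Let $\mathfrak g$ be a finite-dimensional complex semisimple Lie algebra with Cartan subalgebra $\mathfrak h$, root system $\Phi$, a fixed set of positive roots $\Phi^+$ with simple roots $\Delta$, and Weyl group $W$. Let $\langle\cdot,\cdot\rangle$ be the bilinear form on $\mathfrak h^*$ induced by the Killing form, $\alpha^\vee=2\alpha/\langle\alpha,\alpha\rangle$, $\rho=\frac12\sum_{\alpha\in\Phi^+}\alpha$, and let $w\cdot\nu=w(\nu+\rho)-\rho$ be the dot action of $W$ on $\mathfrak h^*$. A weight $\nu\in\mathfrak h^*$ is regular if $\langle\nu+\rho,\alpha^\vee\rangle\neq0$ for all $\alpha\in\Phi$, and antidominant if $\langle\nu+\rho,\alpha^\vee\rangle\notin\mathbb Z^{>0}$ for all $\alpha\in\Phi^+$. For $I\subseteq\Delta$: $\Phi_I=\Phi\cap\mathbb ZI$, $\Phi_I^+=\Phi_I\cap\Phi^+$; $W_I$ is the subgroup of $W$ generated by $s_\alpha$, $\alpha\in I$, with longest element $w_I$; $\Lambda_I^+=\{\nu\in\mathfrak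 h^*:\langle\nu,\alpha^\vee\rangle\in\mathbb Z^{\ge0}\ \forall\alpha\in\Phi_I^+\}$. *)

theory Defs
  imports
    Complex_Main
    "HOL-Library.Function_Algebras"
    "HOL-Algebra.Bij"
    "HOL-Algebra.Generated_Groups"
begin

section \<open>Complex Lie algebras\<close>

class complex_lie_algebra = ab_group_add +
  fixes scaleC :: "complex \<Rightarrow> 'a \<Rightarrow> 'a" (infixr "*\<^sub>C" 75)
    and lie :: "'a \<Rightarrow> 'a \<Rightarrow> 'a"
  assumes scaleC_add_right: "a *\<^sub>C (x + y) = a *\<^sub>C x + a *\<^sub>C y"
    and scaleC_add_left: "(a + b) *\<^sub>C x = a *\<^sub>C x + b *\<^sub>C x"
    and scaleC_scaleC: "a *\<^sub>C b *\<^sub>C x = (a * b) *\<^sub>C x"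
    and scaleC_one: "1 *\<^sub>C x = x"
    and lie_add_left: "lie (x + y) z = lie x z + lie y z"
    and lie_add_right: "lie x (y + z) = lie x y + lie x z"
    and lie_scaleC_left: "lie (a *\<^sub>C x) y = a *\<^sub>C lie x y"
    and lie_scaleC_right: "lie x (a *\<^sub>C y) = a *\<^sub>C lie x y"
    and lie_self: "lie x x = 0"
    and jacobi: "lie x (lie y z) + lie y (lie z x) + lie z (lie x y) = 0"

interpretation lie_vs: vector_space "scaleC :: complex \<Rightarrow> 'g::complex_lie_algebra \<Rightarrow> 'g"
  by unfold_locales (auto simp: scaleC_add_right scaleC_add_left scaleC_scaleC scaleC_one)

definition finite_dimensional :: "'g::complex_lie_algebra set \<Rightarrow> bool" where
  "finite_dimensional V \<longleftrightarrow> (\<exists>B. finite B \<and> lie_vs.span B = V)"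

definition lie_subalgebra :: "'g::complex_lie_algebra set \<Rightarrow> bool" where
  "lie_subalgebra L \<longleftrightarrow> lie_vs.subspace L \<and> (\<forall>x\<in>L. \<forall>y\<in>L. lie x y \<in> L)"

definition lie_ideal :: "'g::complex_lie_algebra set \<Rightarrow> 'g set \<Rightarrow> bool" where
  "lie_ideal J L \<longleftrightarrow> lie_vs.subspace J \<and> J \<subseteq> L \<and> (\<forall>x\<in>L. \<forall>y\<in>J. lie x y \<in> J)"

definition commutator_space :: "'g::complex_lie_algebra set \<Rightarrow> 'g set \<Rightarrow> 'g set" where
  "commutator_space A B = lie_vs.span {lie x y | x y. x \<in> A \<and> y \<in> B}"

primrec derived_series :: "'g::complex_lie_algebra set \<Rightarrow> nat \<Rightarrow> 'g set" where
  "derived_series L 0 = L"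
| "derived_series L (Suc n) = commutator_space (derived_series L n) (derived_series L n)"

primrec lower_central_series :: "'g::complex_lie_algebra set \<Rightarrow> nat \<Rightarrow> 'g set" where
  "lower_central_series L 0 = L"
| "lower_central_series L (Suc n) = commutator_space L (lower_central_series L n)"

definition solvable_lie :: "'g::complex_lie_algebra set \<Rightarrow> bool" where
  "solvable_lie L \<longleftrightarrow> (\<exists>n. derived_series L n = {0})"

definition nilpotent_lie :: "'g::complex_lie_algebra set \<Rightarrow> bool" where
  "nilpotent_lie L \<longleftrightarrow> (\<exists>n. lower_central_series L n = {0})"

text \<open>Semisimple means that the radical is zero. The zero algebra is included.\<close>

definition semisimple_lie :: "'g::complex_lie_algebra set \<Rightarrow> bool" where
  "semisimple_lie L \<longleftrightarrow> (\<forall>J. lie_ideal J L \<and> solvable_lie J \<longrightarrow> J = {0})"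

text \<open>From here on the Lie algebra is the whole type, and \<open>H\<close> is a subalgebra of it.
  A Cartan subalgebra is a nilpotent subalgebra that equals its own normalizer.\<close>

definition normalizer :: "'g::complex_lie_algebra set \<Rightarrow> 'g set" where
  "normalizer H = {x. \<forall>h\<in>H. lie x h \<in> H}"

definition cartan_subalgebra :: "'g::complex_lie_algebra set \<Rightarrow> bool" where
  "cartan_subalgebra H \<longleftrightarrow> lie_subalgebra H \<and> nilpotent_lie H \<and> normalizer H = H"

text \<open>In finite dimension the trace does not depend on the basis that is chosen.\<close>

definition endo_trace :: "('g::complex_lie_algebra \<Rightarrow> 'g) \<Rightarrow> complex" where
  "endo_trace f =
    (let B = (SOME B. lie_vs.independent B \<and> lie_vs.span B = UNIV)
     in \<Sum>b\<in>B. lie_vs.representation B (f b) b)"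

definition killing :: "'g::complex_lie_algebra \<Rightarrow> 'g \<Rightarrow> complex" where
  "killing x y = endo_trace (\<lambda>z. lie x (lie y z))"


section \<open>The dual of the Cartan subalgebra and the roots\<close>

text \<open>Elements of the dual of \<open>H\<close> are represented by functions on the whole Lie algebra
  that are linear on \<open>H\<close> and zero outside \<open>H\<close>, so that addition, zero and scalar
  multiplication are pointwise.\<close>

definition dual :: "'g::complex_lie_algebra set \<Rightarrow> ('g \<Rightarrow> complex) set" where
  "dual H = {\<nu>. (\<forall>x\<in>H. \<forall>y\<in>H. \<nu> (x + y) = \<nu> x + \<nu> y) \<and>
                 (\<forall>a. \<forall>x\<in>H. \<nu> (a *\<^sub>C x) = a * \<nu> x) \<and>
                 (\<forall>x. x \<notin> H \<longrightarrow> \<nu> x = 0)}"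

definition scaleF :: "complex \<Rightarrow> ('g \<Rightarrow> complex) \<Rightarrow> 'g \<Rightarrow> complex" (infixr "*\<^sub>F" 75) where
  "c *\<^sub>F \<nu> = (\<lambda>x. c * \<nu> x)"

interpretation dual_vs: vector_space "scaleF :: complex \<Rightarrow> ('g \<Rightarrow> complex) \<Rightarrow> 'g \<Rightarrow> complex"
  by unfold_locales (auto simp: scaleF_def fun_eq_iff algebra_simps)

text \<open>The form on the dual is transported from the Killing form on \<open>H\<close> along the
  identification of \<open>t \<in> H\<close> with \<open>killing t\<close>.\<close>

definition killing_vector :: "'g::complex_lie_algebra set \<Rightarrow> ('g \<Rightarrow> complex) \<Rightarrow> 'g" where
  "killing_vector H \<nu> = (THE t. t \<in> H \<and> (\<forall>x\<in>H. killing t x = \<nu> x))"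

definition dual_form ::
  "'g::complex_lie_algebra set \<Rightarrow> ('g \<Rightarrow> complex) \<Rightarrow> ('g \<Rightarrow> complex) \<Rightarrow> complex" where
  "dual_form H \<mu> \<nu> = killing (killing_vector H \<mu>) (killing_vector H \<nu>)"

definition coroot :: "'g::complex_lie_algebra set \<Rightarrow> ('g \<Rightarrow> complex) \<Rightarrow> 'g \<Rightarrow> complex" where
  "coroot H \<alpha> = (2 / dual_form H \<alpha> \<alpha>) *\<^sub>F \<alpha>"

definition root_space :: "'g::complex_lie_algebra set \<Rightarrow> ('g \<Rightarrow> complex) \<Rightarrow> 'g set" where
  "root_space H \<alpha> = {x. \<forall>h\<in>H. lie h x = \<alpha> h *\<^sub>C x}"

definition roots :: "'g::complex_lie_algebra set \<Rightarrow> ('g \<Rightarrow> complex) set" where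
  "roots H = {\<alpha> \<in> dual H. \<alpha> \<noteq> 0 \<and> root_space H \<alpha> \<noteq> {0}}"

definition nat_combination :: "('g \<Rightarrow> complex) set \<Rightarrow> ('g \<Rightarrow> complex) \<Rightarrow> bool" where
  "nat_combination S \<nu> \<longleftrightarrow> (\<exists>c :: _ \<Rightarrow> nat. \<nu> = (\<Sum>\<delta>\<in>S. of_nat (c \<delta>) *\<^sub>F \<delta>))"

definition int_combination :: "('g \<Rightarrow> complex) set \<Rightarrow> ('g \<Rightarrow> complex) \<Rightarrow> bool" where
  "int_combination S \<nu> \<longleftrightarrow> (\<exists>c :: _ \<Rightarrow> int. \<nu> = (\<Sum>\<delta>\<in>S. of_int (c \<delta>) *\<^sub>F \<delta>))"

definition simple_system :: "'g::complex_lie_algebra set \<Rightarrow> ('g \<Rightarrow> complex) set \<Rightarrow> bool" where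
  "simple_system H \<Delta> \<longleftrightarrow>
    \<Delta> \<subseteq> roots H \<and> finite \<Delta> \<and> dual_vs.independent \<Delta> \<and> dual_vs.span \<Delta> = dual H \<and>
    (\<forall>\<alpha>\<in>roots H. nat_combination \<Delta> \<alpha> \<or> nat_combination \<Delta> (- \<alpha>))"

definition positive_roots ::
  "'g::complex_lie_algebra set \<Rightarrow> ('g \<Rightarrow> complex) set \<Rightarrow> ('g \<Rightarrow> complex) set" where
  "positive_roots H \<Delta> = {\<alpha> \<in> roots H. nat_combination \<Delta> \<alpha>}"

definition rho :: "'g::complex_lie_algebra set \<Rightarrow> ('g \<Rightarrow> complex) set \<Rightarrow> 'g \<Rightarrow> complex" where
  "rho H \<Delta> = (1 / 2) *\<^sub>F (\<Sum>\<alpha>\<in>positive_roots H \<Delta>. \<alpha>)"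

definition parabolic_roots ::
  "'g::complex_lie_algebra set \<Rightarrow> ('g \<Rightarrow> complex) set \<Rightarrow> ('g \<Rightarrow> complex) set" where
  "parabolic_roots H I = {\<alpha> \<in> roots H. int_combination I \<alpha>}"

definition parabolic_positive_roots ::
  "'g::complex_lie_algebra set \<Rightarrow> ('g \<Rightarrow> complex) set \<Rightarrow> ('g \<Rightarrow> complex) set \<Rightarrow>
    ('g \<Rightarrow> complex) set" where
  "parabolic_positive_roots H \<Delta> I = parabolic_roots H I \<inter> positive_roots H \<Delta>"


section \<open>Reflections and the dot action\<close>

text \<open>In \<open>BijGroup S\<close> the elements are the bijections of \<open>S\<close> extended by \<open>undefined\<close>,
  hence the restriction to the dual.\<close>

definition reflection ::
  "'g::complex_lie_algebra set \<Rightarrow> ('g \<Rightarrow> complex) \<Rightarrow> ('g \<Rightarrow> complex) \<Rightarrow> 'g \<Rightarrow> complex" where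
  "reflection H \<alpha> = (\<lambda>\<nu>\<in>dual H. \<nu> - dual_form H \<nu> (coroot H \<alpha>) *\<^sub>F \<alpha>)"

text \<open>The Weyl group \<open>W\<close> is the case \<open>S = roots H\<close>; its parabolic subgroup \<open>W\<^sub>I\<close> is the
  case \<open>S = I\<close> for a set \<open>I\<close> of simple roots.\<close>

definition reflection_group ::
  "'g::complex_lie_algebra set \<Rightarrow> ('g \<Rightarrow> complex) set \<Rightarrow>
    (('g \<Rightarrow> complex) \<Rightarrow> 'g \<Rightarrow> complex) set" where
  "reflection_group H S = generate (BijGroup (dual H)) (reflection H ` S)"

text \<open>Length with respect to the generators \<open>s\<^sub>\<alpha>\<close>, \<open>\<alpha> \<in> I\<close>.\<close>

definition reflection_length ::
  "'g::complex_lie_algebra set \<Rightarrow> ('g \<Rightarrow> complex) set \<Rightarrow>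
    (('g \<Rightarrow> complex) \<Rightarrow> 'g \<Rightarrow> complex) \<Rightarrow> nat" where
  "reflection_length H I w =
    (LEAST n. \<exists>as. set as \<subseteq> I \<and> length as = n \<and>
      w = foldr (mult (BijGroup (dual H))) (map (reflection H) as) (one (BijGroup (dual H))))"

definition longest_element ::
  "'g::complex_lie_algebra set \<Rightarrow> ('g \<Rightarrow> complex) set \<Rightarrow>
    ('g \<Rightarrow> complex) \<Rightarrow> 'g \<Rightarrow> complex" where
  "longest_element H I =
    (THE w. w \<in> reflection_group H I \<and>
      (\<forall>v\<in>reflection_group H I. reflection_length H I v \<le> reflection_length H I w))"

definition dot_action ::
  "'g::complex_lie_algebra set \<Rightarrow> ('g \<Rightarrow> complex) set \<Rightarrow>
    (('g \<Rightarrow> complex) \<Rightarrow> 'g \<Rightarrow> complex) \<Rightarrow> ('g \<Rightarrow> complex) \<Rightarrow> 'g \<Rightarrow> complex" where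
  "dot_action H \<Delta> w \<nu> = w (\<nu> + rho H \<Delta>) - rho H \<Delta>"


section \<open>Weights\<close>

definition regular_weights ::
  "'g::complex_lie_algebra set \<Rightarrow> ('g \<Rightarrow> complex) set \<Rightarrow> ('g \<Rightarrow> complex) set" where
  "regular_weights H \<Delta> =
    {\<nu> \<in> dual H. \<forall>\<alpha>\<in>roots H. dual_form H (\<nu> + rho H \<Delta>) (coroot H \<alpha>) \<noteq> 0}"

definition antidominant_weights ::
  "'g::complex_lie_algebra set \<Rightarrow> ('g \<Rightarrow> complex) set \<Rightarrow> ('g \<Rightarrow> complex) set" where
  "antidominant_weights H \<Delta> =
    {\<nu> \<in> dual H. \<forall>\<alpha>\<in>positive_roots H \<Delta>.
       dual_form H (\<nu> + rho H \<Delta>) (coroot H \<alpha>) \<notin> \<nat> - {0}}"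

definition dominant_integral_weights ::
  "'g::complex_lie_algebra set \<Rightarrow> ('g \<Rightarrow> complex) set \<Rightarrow> ('g \<Rightarrow> complex) set \<Rightarrow>
    ('g \<Rightarrow> complex) set" where
  "dominant_integral_weights H \<Delta> I =
    {\<nu> \<in> dual H. \<forall>\<alpha>\<in>parabolic_positive_roots H \<Delta> I. dual_form H \<nu> (coroot H \<alpha>) \<in> \<nat>}"

definition Psi ::
  "'g::complex_lie_algebra set \<Rightarrow> ('g \<Rightarrow> complex) set \<Rightarrow> ('g \<Rightarrow> complex) set" where
  "Psi H I = roots H - parabolic_roots H I"

definition Psi_pos ::
  "'g::complex_lie_algebra set \<Rightarrow> ('g \<Rightarrow> complex) set \<Rightarrow> ('g \<Rightarrow> complex) set \<Rightarrow>
    ('g \<Rightarrow> complex) set" where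
  "Psi_pos H \<Delta> I = Psi H I \<inter> positive_roots H \<Delta>"

definition Psi_pos_at ::
  "'g::complex_lie_algebra set \<Rightarrow> ('g \<Rightarrow> complex) set \<Rightarrow> ('g \<Rightarrow> complex) set \<Rightarrow>
    ('g \<Rightarrow> complex) \<Rightarrow> ('g \<Rightarrow> complex) set" where
  "Psi_pos_at H \<Delta> I \<mu> =
    {\<beta> \<in> Psi_pos H \<Delta> I. dual_form H (\<mu> + rho H \<Delta>) (coroot H \<beta>) \<in> \<nat> - {0}}"

end

theory Submission
  imports Defs "HOL-Computational_Algebra.Fundamental_Theorem_Algebra"
begin

text \<open>Let \<open>w = w\<^sub>I\<close> be the longest element of \<open>W\<^sub>I\<close>. It maps \<open>\<Phi>\<^sub>I\<^sup>+\<close> to the negatives of \<open>\<Phi>\<^sub>I\<^sup>+\<close>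
  (\<open>parabolic_positive_act\<close>) and permutes \<open>\<Psi>\<^sup>+\<close> (\<open>Psi_pos_act\<close>). If \<open>\<mu> = w \<cdot> \<nu>\<close>, invariance of the
  form gives \<open>\<langle>\<nu> + \<rho>, \<beta>\<^sup>\<or>\<rangle> = \<langle>\<mu> + \<rho>, (w \<beta>)\<^sup>\<or>\<rangle>\<close> for every root \<open>\<beta>\<close>. For \<open>\<beta>\<close> in \<open>\<Psi>\<^sup>+\<close> these
  numbers are, in another order, the pairings of \<open>\<mu> + \<rho>\<close> with the coroots of \<open>\<Psi>\<^sup>+\<close>. For \<open>\<beta>\<close> in
  \<open>\<Phi>\<^sub>I\<^sup>+\<close>, where \<open>w \<beta> = - \<gamma>\<close> with \<open>\<gamma>\<close> in \<open>\<Phi>\<^sub>I\<^sup>+\<close>, the number is \<open>- \<langle>\<mu>, \<gamma>\<^sup>\<or>\<rangle> - \<langle>\<rho>, \<gamma>\<^sup>\<or>\<rangle>\<close>,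
  which is never a positive integer, since \<open>\<mu>\<close> is dominant on \<open>\<Phi>\<^sub>I\<close> and \<open>\<langle>\<rho>, \<gamma>\<^sup>\<or>\<rangle> \<ge> 0\<close>
  (\<open>pairing_rho_Pos\<close>). So \<open>\<nu>\<close> is antidominant exactly if no pairing of \<open>\<mu> + \<rho>\<close> with a coroot of
  \<open>\<Psi>\<^sup>+\<close> is a positive integer.

  The rest is the structure theory behind this, starting from the definition of semisimplicity by
  solvable ideals and of a Cartan subalgebra \<open>H\<close> as nilpotent and self-normalizing. The Lie algebra
  is the direct sum of the generalized weight spaces of \<open>H\<close> (\<open>weight_decomposition\<close>), and traces are
  sums over weights. At a bracket of vectors of weights \<open>\<alpha>\<close> and \<open>- \<alpha>\<close> all weights are real multiples of
  \<open>\<alpha>\<close> (\<open>weight_ratio_real\<close>). With Engel's theorem this shows that the Killing form is nondegenerate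
  (\<open>killing_nondegenerate\<close>); it follows that the form on the dual of \<open>H\<close> is well defined, that \<open>H\<close>
  acts diagonally (\<open>weight_space_eigen\<close>) and that roots are not isotropic. Representations of sl2 then
  show that weights have integral pairings with coroots and that reflections permute the roots
  (\<open>reflection_root\<close>); by integrality the squared lengths of roots are positive
  (\<open>root_form_positive\<close>).

  On the combinatorial side, a reflection in a simple root \<open>\<alpha>\<close> permutes the positive roots that are not
  multiples of \<open>\<alpha>\<close>. This gives the exchange property of words in simple reflections (\<open>exchange\<close>), and
  with it the existence and uniqueness of the longest element and its effect on \<open>I\<close>
  (\<open>longest_element_word\<close>).\<close>

section \<open>Endomorphisms and generalized eigenspaces\<close>

abbreviation endo :: "('g::complex_lie_algebra \<Rightarrow> 'g) \<Rightarrow> bool" where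
  "endo \<equiv> Vector_Spaces.linear scaleC scaleC"

lemma endoI:
  assumes "\<And>x y. f (x + y) = f x + f y" and "\<And>c x. f (c *\<^sub>C x) = c *\<^sub>C f x"
  shows "endo f"
  by (rule Vector_Spaces.linear_iff[THEN iffD2])
    (use assms lie_vs.vector_space_axioms in auto)

lemma
  assumes "endo f"
  shows endo_add: "f (x + y) = f x + f y"
    and endo_scale: "f (c *\<^sub>C x) = c *\<^sub>C f x"
    and endo_diff: "f (x - y) = f x - f y"
    and endo_zero: "f 0 = 0"
    and endo_sum: "f (sum g A) = (\<Sum>i\<in>A. f (g i))"
proof -
  interpret f: Vector_Spaces.linear scaleC scaleC f by fact
  show "f (x + y) = f x + f y" "f (c *\<^sub>C x) = c *\<^sub>C f x" "f (x - y) = f x - f y" "f 0 = 0"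
    "f (sum g A) = (\<Sum>i\<in>A. f (g i))"
    by (simp_all add: f.add f.scale f.diff f.sum)
qed

lemmas endo_simps = endo_add endo_scale endo_diff endo_zero endo_sum

lemma endo_lie: "endo (lie x)"
  by (rule endoI) (simp_all add: lie_add_right lie_scaleC_right)

lemma endo_lie_left: "endo (\<lambda>x. lie x y)"
  by (rule endoI) (simp_all add: lie_add_left lie_scaleC_left)

lemmas lie_simps = endo_simps[OF endo_lie] endo_simps[OF endo_lie_left]

lemma lie_skew: "lie x y = - lie y x"
proof -
  have "lie x y + lie y x = lie (x + y) (x + y)"
    unfolding lie_add_left lie_add_right by (simp add: lie_self)
  then show ?thesis by (simp add: lie_self eq_neg_iff_add_eq_0)
qed

lemma lie_uminus_right: "lie x (- y) = - lie x y"
  using lie_simps(3)[of x 0 y] by (simp add: lie_simps)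

lemma lie_uminus_left: "lie (- x) y = - lie x y"
  by (metis lie_skew lie_uminus_right)

text \<open>The Jacobi identity in the form used throughout: \<open>lie d\<close> is a derivation.\<close>

lemma lie_leibniz: "lie d (lie x y) = lie (lie d x) y + lie x (lie d y)"
proof -
  have "lie d (lie x y) = - lie x (lie y d) - lie y (lie d x)"
    using jacobi[of d x y] by (simp add: eq_neg_iff_add_eq_0 algebra_simps)
  also have "\<dots> = lie (lie d x) y + lie x (lie d y)"
    by (simp add: lie_skew[of y d] lie_skew[of "lie d x" y] lie_uminus_right)
  finally show ?thesis .
qed

lemma lie_lie_left: "lie (lie x y) z = lie x (lie y z) - lie y (lie x z)"
  by (simp add: lie_leibniz[of x y z])

lemma endo_compose: "endo f \<Longrightarrow> endo g \<Longrightarrow> endo (\<lambda>x. f (g x))"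
  by (rule endoI) (simp_all add: endo_simps)

lemma endo_pow: "endo f \<Longrightarrow> endo (f ^^ n)"
  by (induction n) (auto intro!: endoI simp: endo_simps)

lemma endo_plus: "endo f \<Longrightarrow> endo g \<Longrightarrow> endo (\<lambda>x. f x + g x)"
  by (rule endoI) (simp_all add: endo_simps algebra_simps lie_vs.scale_right_distrib)

lemma endo_scaled: "endo f \<Longrightarrow> endo (\<lambda>x. c *\<^sub>C f x)"
  by (rule endoI) (simp_all add: endo_simps lie_vs.scale_right_distrib mult.commute)

lemma endo_minus: "endo f \<Longrightarrow> endo g \<Longrightarrow> endo (\<lambda>x. f x - g x)"
  by (rule endoI) (simp_all add: endo_simps algebra_simps lie_vs.scale_right_diff_distrib)

lemma endo_id: "endo (\<lambda>x. x)"
  by (rule endoI) simp_all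

lemma endo_span_subset:
  assumes "endo f" "lie_vs.subspace U" "\<And>x. x \<in> S \<Longrightarrow> f x \<in> U" "x \<in> lie_vs.span S"
  shows "f x \<in> U"
proof -
  have "lie_vs.subspace {x. f x \<in> U}"
    using assms(1,2) by (auto simp: lie_vs.subspace_def endo_simps)
  then have "lie_vs.span S \<subseteq> {x. f x \<in> U}"
    using assms(3) by (intro lie_vs.span_minimal) auto
  then show ?thesis using assms(4) by auto
qed

lemma endo_eq_on_span:
  assumes "endo f" "endo g" "\<And>x. x \<in> S \<Longrightarrow> f x = g x" "x \<in> lie_vs.span S"
  shows "f x = g x"
  using endo_span_subset[OF endo_minus[OF assms(1,2)], of "{0}" S x] assms(3,4)
  by simp

lemma lie_mem_span:
  assumes "\<And>a b. a \<in> A \<Longrightarrow> b \<in> B \<Longrightarrow> lie a b \<in> U" "lie_vs.subspace U"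
    "x \<in> lie_vs.span A" "y \<in> lie_vs.span B"
  shows "lie x y \<in> U"
proof -
  have "lie a y \<in> U" if "a \<in> A" for a
    by (rule endo_span_subset[OF endo_lie assms(2) assms(1)[OF that] assms(4)])
  then show ?thesis
    by (rule endo_span_subset[OF endo_lie_left assms(2) _ assms(3)])
qed

definition shift :: "('g::complex_lie_algebra \<Rightarrow> 'g) \<Rightarrow> complex \<Rightarrow> 'g \<Rightarrow> 'g" where
  "shift f a = (\<lambda>x. f x - a *\<^sub>C x)"

definition gen_eigenspace :: "('g::complex_lie_algebra \<Rightarrow> 'g) \<Rightarrow> complex \<Rightarrow> 'g set" where
  "gen_eigenspace f a = {x. \<exists>n. (shift f a ^^ n) x = 0}"

lemma endo_shift: "endo f \<Longrightarrow> endo (shift f a)"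
  unfolding shift_def by (intro endo_minus endo_scaled endo_id)

lemma shift_0 [simp]: "shift f 0 = f"
  by (simp add: shift_def)

lemma pow_vanishes_mono:
  assumes "endo f" "(f ^^ n) x = 0" "n \<le> m"
  shows "(f ^^ m) x = 0"
proof -
  have "(f ^^ (m - n + n)) x = 0"
    unfolding funpow_add by (simp add: assms endo_simps[OF endo_pow[OF assms(1)]])
  then show ?thesis using assms(3) by simp
qed

lemma subspace_pow_vanishes:
  assumes "endo f" shows "lie_vs.subspace {x. \<exists>n. (f ^^ n) x = 0}"
proof (rule lie_vs.subspaceI)
  show "0 \<in> {x. \<exists>n. (f ^^ n) x = 0}" by (auto intro: exI[of _ 0])
next
  fix x y assume "x \<in> {x. \<exists>n. (f ^^ n) x = 0}" "y \<in> {x. \<exists>n. (f ^^ n) x = 0}"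
  then obtain n m where "(f ^^ n) x = 0" "(f ^^ m) y = 0" by auto
  then have "(f ^^ (max n m)) x = 0" "(f ^^ (max n m)) y = 0"
    using pow_vanishes_mono[OF assms] by (metis max.cobounded1, metis max.cobounded2)
  then have "(f ^^ (max n m)) (x + y) = 0"
    by (simp add: endo_simps[OF endo_pow[OF assms]])
  then show "x + y \<in> {x. \<exists>n. (f ^^ n) x = 0}" by blast
next
  fix c x assume "x \<in> {x. \<exists>n. (f ^^ n) x = 0}"
  then show "c *\<^sub>C x \<in> {x. \<exists>n. (f ^^ n) x = 0}"
    by (auto simp: endo_simps[OF endo_pow[OF assms]])
qed

lemma subspace_gen_eigenspace: "endo f \<Longrightarrow> lie_vs.subspace (gen_eigenspace f a)"
  unfolding gen_eigenspace_def by (intro subspace_pow_vanishes endo_shift)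

lemma gen_eigenspace_commuting:
  assumes "endo f" "endo g" "\<And>x. f (g x) = g (f x)" "x \<in> gen_eigenspace f a"
  shows "g x \<in> gen_eigenspace f a"
proof -
  have s: "shift f a (g y) = g (shift f a y)" for y
    by (simp add: shift_def assms(3) endo_simps[OF assms(2)])
  have "(shift f a ^^ n) (g y) = g ((shift f a ^^ n) y)" for n y
    by (induction n) (auto simp: s)
  then show ?thesis
    using assms(4) by (auto simp: gen_eigenspace_def endo_simps[OF assms(2)]) (metis assms(2) endo_zero)
qed

lemma gen_eigenspace_induct [consumes 2, case_names zero step]:
  assumes "x \<in> gen_eigenspace f a" "endo f"
    and "P 0" and "\<And>x. x \<in> gen_eigenspace f a \<Longrightarrow> P (shift f a x) \<Longrightarrow> P x"
  shows "P x"
proof -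
  obtain n where "(shift f a ^^ n) x = 0" using assms(1) by (auto simp: gen_eigenspace_def)
  then show ?thesis
  proof (induction n arbitrary: x)
    case 0 then show ?case using assms(3) by simp
  next
    case (Suc n)
    have "x \<in> gen_eigenspace f a" using Suc.prems unfolding gen_eigenspace_def by blast
    moreover have "P (shift f a x)" using Suc by (simp add: funpow_swap1)
    ultimately show ?case by (rule assms(4))
  qed
qed

text \<open>On a vector with \<open>f x = a x\<close> the operator \<open>f - b\<close> is the nonzero scalar \<open>a - b\<close>; the general case
  reduces to this by applying \<open>f - a\<close>.\<close>

lemma gen_eigenspace_disjoint:
  assumes "endo f" "a \<noteq> b" "x \<in> gen_eigenspace f a" "x \<in> gen_eigenspace f b"
  shows "x = 0"
  using assms(3,1,4)
proof (induction rule: gen_eigenspace_induct)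
  case zero then show ?case by simp
next
  case (step x)
  have "shift f a x \<in> gen_eigenspace f b"
    by (rule gen_eigenspace_commuting[OF assms(1) endo_shift[OF assms(1)] _ step.prems])
      (simp add: shift_def endo_simps[OF assms(1)])
  then have "shift f a x = 0" using step.IH by simp
  then have fx: "f x = a *\<^sub>C x" by (simp add: shift_def)
  have "(shift f b ^^ n) x = (a - b) ^ n *\<^sub>C x" for n
    by (induction n)
      (simp_all add: shift_def endo_simps[OF assms(1)] fx lie_vs.scale_left_diff_distrib algebra_simps)
  then show ?case
    using step.prems assms(2) by (auto simp: gen_eigenspace_def)
qed

text \<open>On the generalized eigenspace for \<open>b\<close>, the operator \<open>f - a\<close> is the nonzero scalar
  \<open>b - a\<close> plus a nilpotent operator, hence onto.\<close>

lemma gen_eigenspace_solve: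
  assumes "endo f" "a \<noteq> b" "lie_vs.subspace U" "\<And>x. x \<in> U \<Longrightarrow> f x \<in> U"
    and "y \<in> gen_eigenspace f b" "y \<in> U"
  shows "\<exists>z \<in> gen_eigenspace f b \<inter> U. shift f a z = y"
  using assms(5,1,6)
proof (induction rule: gen_eigenspace_induct)
  case zero
  then show ?case
    by (intro bexI[of _ 0])
      (auto simp: endo_simps[OF endo_shift[OF assms(1)]] lie_vs.subspace_0 assms(3)
        subspace_gen_eigenspace[OF assms(1)])
next
  case (step y)
  have "shift f b y \<in> U"
    using step.prems assms(3,4) by (simp add: shift_def lie_vs.subspace_diff lie_vs.subspace_scale)
  then obtain z where z: "z \<in> gen_eigenspace f b" "z \<in> U" "shift f a z = shift f b y"
    using step.IH by auto
  let ?z = "(1 / (b - a)) *\<^sub>C (y - z)"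
  have "shift f a y - shift f b y = (b - a) *\<^sub>C y"
    by (simp add: shift_def lie_vs.scale_left_diff_distrib)
  then have "shift f a ?z = y"
    using assms(2) by (simp add: endo_simps[OF endo_shift[OF assms(1)]] z(3))
  moreover have "?z \<in> gen_eigenspace f b \<inter> U"
    using z step assms(3) subspace_gen_eigenspace[OF assms(1)]
    by (auto simp: lie_vs.subspace_diff lie_vs.subspace_scale)
  ultimately show ?case by blast
qed

text \<open>For a derivation, eigenvalues add under the bracket: \<open>D - (a + b)\<close> acts on
  \<open>lie x y\<close> by the product rule with \<open>D - a\<close> on \<open>x\<close> and \<open>D - b\<close> on \<open>y\<close>.\<close>

lemma gen_eigenspace_lie:
  assumes "endo D" and der: "\<And>x y. D (lie x y) = lie (D x) y + lie x (D y)"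
    and "x \<in> gen_eigenspace D a" "y \<in> gen_eigenspace D b"
  shows "lie x y \<in> gen_eigenspace D (a + b)"
proof -
  note lin = endo_simps[OF endo_pow[OF endo_shift[OF assms(1)]]]
  have prod: "shift D (a + b) (lie x y) = lie (shift D a x) y + lie x (shift D b y)" for x y
    by (simp add: shift_def der lie_simps algebra_simps lie_vs.scale_left_distrib)
  have "(shift D (a + b) ^^ k) (lie x y) = 0"
    if "(shift D a ^^ m) x = 0" "(shift D b ^^ n) y = 0" "m + n = k" for k m n x y
    using that
  proof (induction k arbitrary: m n x y)
    case 0 then show ?case by (simp add: lie_simps)
  next
    case (Suc k)
    have 1: "(shift D (a + b) ^^ k) (lie (shift D a x) y) = 0"
    proof (cases m)
      case 0
      then have "x = 0" using Suc by simp
      then show ?thesis by (simp add: lie_simps endo_simps[OF endo_shift[OF assms(1)]] lin)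
    next
      case (Suc m') then show ?thesis
        using Suc.prems by (intro Suc.IH[of m' _ n]) (auto simp: funpow_swap1)
    qed
    have 2: "(shift D (a + b) ^^ k) (lie x (shift D b y)) = 0"
    proof (cases n)
      case 0
      then have "y = 0" using Suc by simp
      then show ?thesis by (simp add: lie_simps endo_simps[OF endo_shift[OF assms(1)]] lin)
    next
      case (Suc n') then show ?thesis
        using Suc.prems by (intro Suc.IH[of m _ n']) (auto simp: funpow_swap1)
    qed
    show ?case using 1 2 by (simp add: funpow_Suc_right prod lin del: funpow.simps)
  qed
  then show ?thesis using assms(3,4) unfolding gen_eigenspace_def by blast
qed

locale fd_lie =
  fixes basis0 :: "'g::complex_lie_algebra set"
  assumes basis0: "finite basis0" "lie_vs.independent basis0" "lie_vs.span basis0 = UNIV"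

sublocale fd_lie \<subseteq> fd: finite_dimensional_vector_space scaleC basis0
  by unfold_locales (fact basis0)+

context fd_lie
begin

text \<open>The vectors \<open>x, f x, f\<^sup>2 x, \<dots>\<close> outnumber the dimension; the coefficients of a linear relation
  between them form the polynomial.\<close>

lemma exists_annihilating_polynomial:
  fixes f :: "'g \<Rightarrow> 'g"
  assumes "endo f"
  shows "\<exists>p. p \<noteq> 0 \<and> (\<Sum>i\<le>degree p. coeff p i *\<^sub>C (f ^^ i) x) = 0"
proof -
  let ?d = "card basis0"
  let ?v = "\<lambda>i. (f ^^ i) x"
  have rel: "\<exists>c. (\<exists>i\<le>?d. c i \<noteq> 0) \<and> (\<Sum>i\<le>?d. c i *\<^sub>C ?v i) = 0"
  proof (cases "inj_on ?v {..?d}")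
    case True
    then have "card (?v ` {..?d}) = Suc ?d" by (simp add: card_image)
    moreover have "card (?v ` {..?d}) \<le> ?d" if "lie_vs.independent (?v ` {..?d})"
      using lie_vs.independent_span_bound[OF basis0(1) that] basis0(3) by simp
    ultimately have "lie_vs.dependent (?v ` {..?d})" by auto
    then obtain u where u: "\<exists>w\<in>?v ` {..?d}. u w \<noteq> 0" "(\<Sum>w\<in>?v ` {..?d}. u w *\<^sub>C w) = 0"
      by (subst (asm) lie_vs.dependent_finite) auto
    show ?thesis
      using u by (intro exI[of _ "\<lambda>i. u (?v i)"]) (auto simp: sum.reindex[OF True])
  next
    case False
    then obtain i j where ij: "i \<le> ?d" "j \<le> ?d" "i \<noteq> j" "?v i = ?v j" by (auto simp: inj_on_def)
    let ?c = "\<lambda>k. if k = i then 1 else if k = j then -1 else (0::complex)"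
    have "(\<Sum>k\<le>?d. ?c k *\<^sub>C ?v k) = (\<Sum>k\<in>{i, j}. ?c k *\<^sub>C ?v k)"
      using ij by (intro sum.mono_neutral_right) auto
    also have "\<dots> = 0" using ij by simp
    finally show ?thesis using ij by (intro exI[of _ ?c]) auto
  qed
  then obtain c k where c: "k \<le> ?d" "c k \<noteq> 0" "(\<Sum>i\<le>?d. c i *\<^sub>C ?v i) = 0" by blast
  define p where "p = Abs_poly (\<lambda>i. if i \<le> ?d then c i else 0)"
  have cp: "coeff p = (\<lambda>i. if i \<le> ?d then c i else 0)"
    unfolding p_def by (rule coeff_Abs_poly[of ?d]) auto
  have "p \<noteq> 0" using c by (auto simp: cp dest!: arg_cong[of _ _ "\<lambda>p. coeff p k"])
  moreover have "degree p \<le> ?d" by (rule degree_le) (auto simp: cp)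
  then have "(\<Sum>i\<le>degree p. coeff p i *\<^sub>C ?v i) = (\<Sum>i\<le>?d. coeff p i *\<^sub>C ?v i)"
    by (intro sum.mono_neutral_left) (auto simp: coeff_eq_0)
  moreover have "\<dots> = 0" using c(3) by (simp add: cp)
  ultimately show ?thesis by auto
qed

text \<open>Split off one root of the annihilating polynomial at a time: if \<open>f x - a x\<close> is a sum of
  generalized eigenvectors, then subtracting preimages of its components for eigenvalues other
  than \<open>a\<close> turns \<open>x\<close> into a generalized eigenvector for \<open>a\<close>.\<close>

lemma primary_decomposition:
  fixes f :: "'g \<Rightarrow> 'g"
  assumes f: "endo f" and U: "lie_vs.subspace U" "\<And>x. x \<in> U \<Longrightarrow> f x \<in> U" and "x \<in> U"
  shows "x \<in> lie_vs.span (\<Union>a. U \<inter> gen_eigenspace f a)" (is "_ \<in> lie_vs.span ?G")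
proof -
  have main: "x \<in> lie_vs.span ?G"
    if "p \<noteq> 0" "(\<Sum>i\<le>degree p. coeff p i *\<^sub>C (f ^^ i) x) = 0" "x \<in> U" "degree p = n" for p x n
    using that
  proof (induction n arbitrary: p x)
    case 0
    then have "coeff p 0 \<noteq> 0" by (metis leading_coeff_0_iff)
    then have "x = 0" using 0 by simp
    then show ?case by (simp add: lie_vs.span_zero)
  next
    case (Suc n)
    have "\<not> constant (poly p)" using Suc.prems by (simp add: constant_degree)
    then obtain a where "poly p a = 0" using fundamental_theorem_of_algebra by blast
    then obtain q where q: "p = [:- a, 1:] * q" by (auto simp: poly_eq_0_iff_dvd)
    have q0: "q \<noteq> 0" using Suc.prems q by auto
    have "degree p = degree [:- a, 1:] + degree q"
      unfolding q using q0 by (intro degree_mult_eq) auto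
    then have dq: "degree q = n" using Suc.prems(4) by simp
    let ?y = "shift f a x"
    have pow: "(f ^^ i) ?y = (f ^^ Suc i) x - a *\<^sub>C (f ^^ i) x" for i
      by (simp add: shift_def endo_simps[OF endo_pow[OF f]] funpow_swap1)
    have pc: "coeff p (Suc i) = coeff q i - a * coeff q (Suc i)" "coeff p 0 = - a * coeff q 0" for i
      by (simp_all add: q coeff_mult_0)
    have "0 = (\<Sum>i\<le>Suc n. coeff p i *\<^sub>C (f ^^ i) x)" using Suc.prems by simp
    also have "\<dots> = coeff p 0 *\<^sub>C x + (\<Sum>i\<le>n. coeff p (Suc i) *\<^sub>C (f ^^ Suc i) x)"
      by (simp only: sum.atMost_Suc_shift) simp
    also have "\<dots> = (\<Sum>i\<le>n. coeff q i *\<^sub>C (f ^^ Suc i) x)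
        - a *\<^sub>C (coeff q 0 *\<^sub>C x + (\<Sum>i\<le>n. coeff q (Suc i) *\<^sub>C (f ^^ Suc i) x))"
      by (simp add: pc lie_vs.scale_left_diff_distrib sum_subtractf lie_vs.scale_sum_right
          lie_vs.scale_right_distrib del: funpow.simps)
    also have "coeff q 0 *\<^sub>C x + (\<Sum>i\<le>n. coeff q (Suc i) *\<^sub>C (f ^^ Suc i) x)
        = (\<Sum>i\<le>Suc n. coeff q i *\<^sub>C (f ^^ i) x)"
      by (simp only: sum.atMost_Suc_shift) simp
    also have "\<dots> = (\<Sum>i\<le>n. coeff q i *\<^sub>C (f ^^ i) x)"
      by (simp add: coeff_eq_0 dq)
    also have "(\<Sum>i\<le>n. coeff q i *\<^sub>C (f ^^ Suc i) x) - a *\<^sub>C \<dots> = (\<Sum>i\<le>n. coeff q i *\<^sub>C (f ^^ i) ?y)"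
      by (simp add: pow lie_vs.scale_right_diff_distrib sum_subtractf lie_vs.scale_sum_right
          mult.commute del: funpow.simps)
    finally have "(\<Sum>i\<le>degree q. coeff q i *\<^sub>C (f ^^ i) ?y) = 0" using dq by simp
    moreover have "?y \<in> U"
      using Suc.prems U by (simp add: shift_def lie_vs.subspace_diff lie_vs.subspace_scale)
    ultimately have "?y \<in> lie_vs.span ?G" using Suc.IH q0 dq by blast
    moreover have "\<exists>u \<in> lie_vs.span ?G. y - shift f a u \<in> U \<inter> gen_eigenspace f a"
      if "y \<in> lie_vs.span ?G" for y
      using that
    proof (induction rule: lie_vs.span_induct_alt)
      case base
      show ?case
        by (rule bexI[of _ 0])
          (auto simp: endo_simps[OF endo_shift[OF f]] lie_vs.span_zero lie_vs.subspace_0 U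
            subspace_gen_eigenspace[OF f])
    next
      case (step c v y)
      obtain u where u: "u \<in> lie_vs.span ?G" "y - shift f a u \<in> U \<inter> gen_eigenspace f a"
        using step by blast
      obtain b where b: "v \<in> U" "v \<in> gen_eigenspace f b" using step by blast
      have "\<exists>w \<in> lie_vs.span ?G. v - shift f a w \<in> U \<inter> gen_eigenspace f a"
      proof (cases "b = a")
        case True
        then show ?thesis using b
          by (intro bexI[of _ 0]) (auto simp: endo_simps[OF endo_shift[OF f]] lie_vs.span_zero)
      next
        case False
        obtain z where "z \<in> gen_eigenspace f b \<inter> U" "shift f a z = v"
          using gen_eigenspace_solve[OF f False[symmetric] U b(2,1)] by blast
        then show ?thesis
          by (intro bexI[of _ z])
            (auto intro: lie_vs.span_base simp: lie_vs.subspace_0 U subspace_gen_eigenspace[OF f])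
      qed
      then obtain w where w: "w \<in> lie_vs.span ?G" "v - shift f a w \<in> U \<inter> gen_eigenspace f a" by blast
      have eq: "c *\<^sub>C v + y - shift f a (c *\<^sub>C w + u)
          = c *\<^sub>C (v - shift f a w) + (y - shift f a u)"
        by (simp add: endo_simps[OF endo_shift[OF f]] lie_vs.scale_right_diff_distrib)
      have "c *\<^sub>C v + y - shift f a (c *\<^sub>C w + u) \<in> U \<inter> gen_eigenspace f a"
        unfolding eq using u w U(1) subspace_gen_eigenspace[OF f]
        by (blast intro: lie_vs.subspace_add lie_vs.subspace_scale)
      moreover have "c *\<^sub>C w + u \<in> lie_vs.span ?G"
        using u(1) w(1) by (intro lie_vs.span_add lie_vs.span_scale)
      ultimately show ?case by blast
    qed
    ultimately obtain u where u: "u \<in> lie_vs.span ?G" "?y - shift f a u \<in> gen_eigenspace f a" by blast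
    have "?G \<subseteq> U" by blast
    then have "u \<in> U" using u(1) U(1) lie_vs.span_minimal by blast
    have "shift f a (x - u) \<in> gen_eigenspace f a"
      using u(2) by (simp add: endo_simps[OF endo_shift[OF f]])
    then obtain m where "(shift f a ^^ m) (shift f a (x - u)) = 0" by (auto simp: gen_eigenspace_def)
    then have "(shift f a ^^ Suc m) (x - u) = 0" by (simp add: funpow_swap1)
    then have "x - u \<in> gen_eigenspace f a" unfolding gen_eigenspace_def by blast
    moreover have "x - u \<in> U" using Suc.prems \<open>u \<in> U\<close> U(1) by (simp add: lie_vs.subspace_diff)
    ultimately have "x - u \<in> lie_vs.span ?G" by (intro lie_vs.span_base) blast
    then have "x - u + u \<in> lie_vs.span ?G" using u(1) by (intro lie_vs.span_add)
    then show ?case by simp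
  qed
  show ?thesis
    using exists_annihilating_polynomial[OF f, of x] main assms(4) by blast
qed

end

section \<open>Trace and Killing form\<close>

context fd_lie
begin

lemma
  fixes B :: "'g set"
  assumes "lie_vs.independent B" "lie_vs.span B = UNIV"
  shows rep_add: "lie_vs.representation B (x + y) b
      = lie_vs.representation B x b + lie_vs.representation B y b"
    and rep_diff: "lie_vs.representation B (x - y) b
      = lie_vs.representation B x b - lie_vs.representation B y b"
    and rep_scale: "lie_vs.representation B (c *\<^sub>C x) b = c * lie_vs.representation B x b"
    and rep_sum: "lie_vs.representation B (sum g A) b
      = (\<Sum>i\<in>A. lie_vs.representation B (g i) b)"
    and sum_rep: "(\<Sum>b\<in>B. lie_vs.representation B x b *\<^sub>C b) = x"
  using assms fd.finiteI_independent[OF assms(1)]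
  by (simp_all add: lie_vs.representation_add lie_vs.representation_diff
      lie_vs.representation_scale lie_vs.representation_sum lie_vs.sum_representation_eq)

text \<open>Expanding \<open>g b\<close> in the basis \<open>C\<close> and \<open>f c\<close> in the basis \<open>B\<close> turns both sides into the
  same double sum. With \<open>g = id\<close> this is independence of the basis, with \<open>C = B\<close> it is
  the symmetry of the trace.\<close>

lemma trace_swap:
  fixes f g :: "'g \<Rightarrow> 'g"
  assumes B: "lie_vs.independent B" "lie_vs.span B = UNIV"
    and C: "lie_vs.independent C" "lie_vs.span C = UNIV"
    and f: "endo f" and g: "endo g"
  shows "(\<Sum>b\<in>B. lie_vs.representation B (f (g b)) b)
    = (\<Sum>c\<in>C. lie_vs.representation C (g (f c)) c)"
proof -
  let ?B = "lie_vs.representation B" and ?C = "lie_vs.representation C"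
  have "?B (f (g b)) b = (\<Sum>c\<in>C. ?C (g b) c * ?B (f c) b)" for b
  proof -
    have "?B (f (g b)) b = ?B (f (\<Sum>c\<in>C. ?C (g b) c *\<^sub>C c)) b" by (simp add: sum_rep[OF C])
    then show ?thesis by (simp add: endo_simps[OF f] rep_sum[OF B] rep_scale[OF B])
  qed
  moreover have "?C (g (f c)) c = (\<Sum>b\<in>B. ?C (g b) c * ?B (f c) b)" for c
  proof -
    have "?C (g (f c)) c = ?C (g (\<Sum>b\<in>B. ?B (f c) b *\<^sub>C b)) c" by (simp add: sum_rep[OF B])
    then show ?thesis by (simp add: endo_simps[OF g] rep_sum[OF C] rep_scale[OF C] mult.commute)
  qed
  ultimately show ?thesis by (simp add: sum.swap[of _ B C])
qed

lemma endo_trace_basis: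
  fixes f :: "'g \<Rightarrow> 'g"
  assumes "lie_vs.independent B" "lie_vs.span B = UNIV" "endo f"
  shows "endo_trace f = (\<Sum>b\<in>B. lie_vs.representation B (f b) b)"
proof -
  let ?A = "SOME B. lie_vs.independent B \<and> lie_vs.span B = (UNIV :: 'g set)"
  have "lie_vs.independent ?A \<and> lie_vs.span ?A = UNIV"
    by (rule someI[of _ basis0]) (use basis0 in auto)
  then show ?thesis
    using trace_swap[of ?A B f "\<lambda>x. x"] assms by (simp add: endo_trace_def Let_def endo_id)
qed

lemmas endo_trace_basis0 = endo_trace_basis[OF basis0(2,3)]

lemma endo_trace_commute:
  fixes f g :: "'g \<Rightarrow> 'g"
  assumes "endo f" "endo g"
  shows "endo_trace (\<lambda>x. f (g x)) = endo_trace (\<lambda>x. g (f x))"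
  using trace_swap[OF basis0(2,3) basis0(2,3) assms] assms
  by (simp add: endo_trace_basis0 endo_compose)

lemma endo_trace_add:
  fixes f g :: "'g \<Rightarrow> 'g"
  shows "endo f \<Longrightarrow> endo g \<Longrightarrow> endo_trace (\<lambda>x. f x + g x) = endo_trace f + endo_trace g"
  by (simp add: endo_trace_basis0 endo_plus rep_add[OF basis0(2,3)] sum.distrib)

lemma endo_trace_diff:
  fixes f g :: "'g \<Rightarrow> 'g"
  shows "endo f \<Longrightarrow> endo g \<Longrightarrow> endo_trace (\<lambda>x. f x - g x) = endo_trace f - endo_trace g"
  by (simp add: endo_trace_basis0 endo_minus rep_diff[OF basis0(2,3)] sum_subtractf)

lemma endo_trace_scale:
  fixes f :: "'g \<Rightarrow> 'g"
  shows "endo f \<Longrightarrow> endo_trace (\<lambda>x. c *\<^sub>C f x) = c * endo_trace f"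
  by (simp add: endo_trace_basis0 endo_scaled rep_scale[OF basis0(2,3)] sum_distrib_left)

lemma endo_trace_zero: "endo_trace (\<lambda>x::'g. 0) = 0"
  using endo_trace_scale[OF endo_id, of 0] by simp

text \<open>A basis adapted to the flag of the kernels of the powers of \<open>f\<close> makes \<open>f\<close> strictly
  triangular.\<close>

lemma endo_trace_nilpotent:
  fixes f :: "'g \<Rightarrow> 'g"
  assumes f: "endo f" and nil: "\<And>x. \<exists>n. (f ^^ n) x = 0"
  shows "endo_trace f = 0"
proof -
  define K where "K n = {x. (f ^^ n) x = 0}" for n
  have K_mono: "K i \<subseteq> K n" if "i \<le> n" for i n
    using pow_vanishes_mono[OF f] that by (auto simp: K_def)
  have "\<exists>B. B \<subseteq> K n \<and> lie_vs.independent B \<and> (\<forall>i\<le>n. K i \<subseteq> lie_vs.span (B \<inter> K i))" for n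
  proof (induction n)
    case 0
    have "K 0 = {0}" by (auto simp: K_def)
    then show ?case
      by (intro exI[of _ "{}"]) (auto simp: lie_vs.independent_empty)
  next
    case (Suc n)
    then obtain B where B: "B \<subseteq> K n" "lie_vs.independent B"
      "\<And>i. i \<le> n \<Longrightarrow> K i \<subseteq> lie_vs.span (B \<inter> K i)" by blast
    have "B \<subseteq> K (Suc n)" using B(1) K_mono[of n "Suc n"] by auto
    then obtain B' where B': "B \<subseteq> B'" "B' \<subseteq> K (Suc n)" "lie_vs.independent B'"
      "K (Suc n) \<subseteq> lie_vs.span B'"
      using lie_vs.maximal_independent_subset_extend[OF _ B(2)] by metis
    have "K i \<subseteq> lie_vs.span (B' \<inter> K i)" if "i \<le> Suc n" for i
    proof (cases "i = Suc n")
      case True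
      then have "B' \<inter> K i = B'" using B' by auto
      then show ?thesis using B' True by simp
    next
      case False
      then have "K i \<subseteq> lie_vs.span (B \<inter> K i)" using B(3) that by simp
      also have "\<dots> \<subseteq> lie_vs.span (B' \<inter> K i)" using B'(1) by (intro lie_vs.span_mono) auto
      finally show ?thesis .
    qed
    then show ?case using B' by blast
  qed
  moreover have "\<exists>n. K n = UNIV"
  proof -
    obtain m where m: "\<And>b. b \<in> basis0 \<Longrightarrow> (f ^^ m b) b = 0" using nil by metis
    have "b \<in> K (Max (m ` basis0))" if "b \<in> basis0" for b
      using pow_vanishes_mono[OF f m[OF that]] that basis0(1) by (simp add: K_def)
    moreover have "lie_vs.subspace (K n)" for n
      by (auto simp: lie_vs.subspace_def K_def endo_simps[OF endo_pow[OF f]])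
    ultimately have "lie_vs.span basis0 \<subseteq> K (Max (m ` basis0))"
      by (intro lie_vs.span_minimal) auto
    then show ?thesis using basis0(3) by auto
  qed
  ultimately obtain B n where B: "lie_vs.independent B" "K n = UNIV"
    "\<And>i. i \<le> n \<Longrightarrow> K i \<subseteq> lie_vs.span (B \<inter> K i)" by metis
  have span: "lie_vs.span B = UNIV"
    using B(3)[of n] lie_vs.span_mono[of "B \<inter> K n" B] B(2) by auto
  have "lie_vs.representation B (f b) b = 0" if "b \<in> B" for b
  proof -
    have "b \<noteq> 0" using B(1) that lie_vs.dependent_zero by blast
    define i where "i = (LEAST i. b \<in> K i)"
    have i: "b \<in> K i" unfolding i_def by (rule LeastI[of _ n]) (simp add: B)
    have "i \<le> n" unfolding i_def by (rule Least_le) (simp add: B)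
    have "i \<noteq> 0" using i \<open>b \<noteq> 0\<close> by (cases i) (auto simp: K_def)
    then obtain j where j: "i = Suc j" by (cases i) auto
    have "b \<notin> K j" using not_less_Least[of j "\<lambda>i. b \<in> K i"] j by (auto simp: i_def)
    have "f b \<in> K j" using i j by (simp add: K_def funpow_swap1)
    then have fb: "f b \<in> lie_vs.span (B \<inter> K j)" using B(3)[of j] j \<open>i \<le> n\<close> by auto
    have "lie_vs.representation B (f b) = lie_vs.representation (B \<inter> K j) (f b)"
      by (rule lie_vs.representation_extend[OF B(1) fb]) simp
    then show ?thesis
      using lie_vs.representation_ne_zero[of "B \<inter> K j" "f b" b] \<open>b \<notin> K j\<close> by auto
  qed
  then show ?thesis by (simp add: endo_trace_basis[OF B(1) span f])
qed

lemma endo_lie_lie: "endo (\<lambda>z. lie x (lie y z))"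
  by (intro endo_compose[OF endo_lie endo_lie])

lemma killing_add_left: "killing (x + y) z = killing x z + killing y z" for x :: 'g
  unfolding killing_def by (simp add: lie_add_left endo_trace_add endo_lie_lie)

lemma killing_scale_left: "killing (c *\<^sub>C x) z = c * killing x z" for x :: 'g
  unfolding killing_def by (simp add: lie_scaleC_left endo_trace_scale endo_lie_lie)

lemma killing_commute: "killing x y = killing y x" for x :: 'g
  unfolding killing_def by (rule endo_trace_commute[OF endo_lie endo_lie])

lemma killing_add_right: "killing z (x + y) = killing z x + killing z y" for x :: 'g
  by (metis killing_add_left killing_commute)

lemma killing_scale_right: "killing z (c *\<^sub>C x) = c * killing z x" for x :: 'g
  by (metis killing_scale_left killing_commute)

lemma killing_zero_left: "killing 0 x = 0" for x :: 'g
  using killing_scale_left[of 0 0 x] by simp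

lemma killing_zero_right: "killing x 0 = 0" for x :: 'g
  using killing_zero_left killing_commute by metis

lemma killing_uminus_left: "killing (- x) y = - killing x y" for x :: 'g
  using killing_scale_left[of "-1" x y] by simp

lemma killing_diff_left: "killing (x - y) z = killing x z - killing y z" for x :: 'g
  using killing_add_left[of x "- y" z] by (simp add: killing_uminus_left)

lemma killing_sum_right: "killing x (sum g A) = (\<Sum>i\<in>A. killing x (g i))" for x :: 'g
  by (induction A rule: infinite_finite_induct) (auto simp: killing_zero_right killing_add_right)

lemma killing_lie: "killing (lie x y) z = killing x (lie y z)" for x :: 'g
proof -
  have "killing (lie x y) z
      = endo_trace (\<lambda>v. lie x (lie y (lie z v)) - lie y (lie x (lie z v)))"
    unfolding killing_def by (simp add: lie_lie_left)
  also have "\<dots> = endo_trace (\<lambda>v. lie x (lie y (lie z v))) - endo_trace (\<lambda>v. lie y (lie x (lie z v)))"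
    by (intro endo_trace_diff endo_compose[OF endo_lie] endo_lie)
  also have "endo_trace (\<lambda>v. lie y (lie x (lie z v))) = endo_trace (\<lambda>v. lie x (lie z (lie y v)))"
    by (rule endo_trace_commute[OF endo_lie endo_lie_lie])
  also have "endo_trace (\<lambda>v. lie x (lie y (lie z v))) - \<dots>
      = endo_trace (\<lambda>v. lie x (lie y (lie z v)) - lie x (lie z (lie y v)))"
    by (intro endo_trace_diff[symmetric] endo_compose[OF endo_lie] endo_lie)
  also have "\<dots> = killing x (lie y z)"
    unfolding killing_def by (simp add: lie_lie_left lie_simps)
  finally show ?thesis .
qed

text \<open>Sending \<open>s\<close> to the values of \<open>killing s\<close> on a basis of \<open>S\<close> is injective, hence onto by
  dimension.\<close>

lemma killing_represents_functional:
  fixes S :: "'g set"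
  assumes S: "lie_vs.subspace S"
    and nondeg: "\<And>s. s \<in> S \<Longrightarrow> (\<And>x. x \<in> S \<Longrightarrow> killing s x = 0) \<Longrightarrow> s = 0"
    and add: "\<And>x y. x \<in> S \<Longrightarrow> y \<in> S \<Longrightarrow> \<phi> (x + y) = \<phi> x + \<phi> y"
    and scale: "\<And>c x. x \<in> S \<Longrightarrow> \<phi> (c *\<^sub>C x) = c * \<phi> x"
  shows "\<exists>s\<in>S. \<forall>x\<in>S. killing s x = \<phi> x"
proof -
  obtain B where B: "B \<subseteq> S" "lie_vs.independent B" "S \<subseteq> lie_vs.span B"
    using lie_vs.maximal_independent_subset by blast
  have fin: "finite B" using B(2) by (rule fd.finiteI_independent)
  have span: "lie_vs.span B = S" using B S lie_vs.span_minimal by blast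
  define T where "T s = (\<Sum>b\<in>B. killing s b *\<^sub>C b)" for s
  have T: "endo T"
    by (rule endoI) (simp_all add: T_def killing_add_left killing_scale_left
        lie_vs.scale_left_distrib sum.distrib lie_vs.scale_sum_right)
  have ext: "\<forall>x\<in>S. \<psi> x = (0::complex)"
    if "\<And>x y. x \<in> S \<Longrightarrow> y \<in> S \<Longrightarrow> \<psi> (x + y) = \<psi> x + \<psi> y"
      "\<And>c x. x \<in> S \<Longrightarrow> \<psi> (c *\<^sub>C x) = c * \<psi> x" "\<And>b. b \<in> B \<Longrightarrow> \<psi> b = 0" for \<psi>
  proof -
    have "\<psi> 0 = 0" using that(2)[of 0 0] lie_vs.subspace_0[OF S] by simp
    then have "lie_vs.subspace {x \<in> S. \<psi> x = 0}"
      using S that(1,2) by (auto simp: lie_vs.subspace_def)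
    then have "lie_vs.span B \<subseteq> {x \<in> S. \<psi> x = 0}"
      using that(3) B(1) by (intro lie_vs.span_minimal) auto
    then show ?thesis using span by auto
  qed
  have "inj_on T S"
  proof (rule inj_onI)
    fix s t assume st: "s \<in> S" "t \<in> S" "T s = T t"
    then have "(\<Sum>b\<in>B. killing (s - t) b *\<^sub>C b) = 0"
      using endo_diff[OF T, of s t] by (simp add: T_def)
    then have "\<forall>b\<in>B. killing (s - t) b = 0"
      using lie_vs.independentD[OF B(2) fin] by blast
    then have "\<forall>x\<in>S. killing (s - t) x = 0"
      by (intro ext) (auto simp: killing_add_right killing_scale_right)
    then have "s - t = 0" by (intro nondeg lie_vs.subspace_diff[OF S] st) auto
    then show "s = t" by simp
  qed
  interpret pair: finite_dimensional_vector_space_pair_1 scaleC basis0 scaleC ..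
  have "lie_vs.dim (T ` S) = lie_vs.dim S"
    using pair.dim_image_eq[OF T, of S] \<open>inj_on T S\<close> span by (metis lie_vs.span_span)
  moreover have "T ` S \<subseteq> S"
    using B(1) S by (auto simp: T_def intro!: lie_vs.subspace_sum lie_vs.subspace_scale)
  moreover have "lie_vs.subspace (T ` S)" by (rule pair.linear_subspace_image[OF T S])
  ultimately have "T ` S = S" using S fd.subspace_dim_equal by simp
  moreover have "(\<Sum>b\<in>B. \<phi> b *\<^sub>C b) \<in> S"
    using B(1) S by (auto intro!: lie_vs.subspace_sum lie_vs.subspace_scale)
  ultimately obtain s where s: "s \<in> S" "T s = (\<Sum>b\<in>B. \<phi> b *\<^sub>C b)" by (metis imageE)
  then have "(\<Sum>b\<in>B. (killing s b - \<phi> b) *\<^sub>C b) = 0"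
    by (simp add: T_def lie_vs.scale_left_diff_distrib sum_subtractf)
  then have "\<forall>b\<in>B. killing s b - \<phi> b = 0"
    using lie_vs.independentD[OF B(2) fin subset_refl, of "\<lambda>b. killing s b - \<phi> b"] by blast
  then have "\<forall>x\<in>S. killing s x - \<phi> x = 0"
    by (intro ext) (auto simp: killing_add_right killing_scale_right add scale algebra_simps)
  then show ?thesis using s(1) by (intro bexI[of _ s]) auto
qed

end


section \<open>Engel's theorem for weakly closed sets\<close>

lemma (in fd_lie) max_dim_element:
  assumes "P A0"
  obtains A :: "'g set" where "P A" "\<And>A'. P A' \<Longrightarrow> \<not> lie_vs.span A \<subset> lie_vs.span A'"
proof -
  have "\<exists>A. P A \<and> (\<forall>A'. P A' \<longrightarrow> lie_vs.dim A' \<le> lie_vs.dim A)"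
    by (rule ex_has_greatest_nat[of P A0 lie_vs.dim, OF assms, of "Suc (card basis0)"])
      (use fd.dim_subset_UNIV in \<open>auto simp: fd.dimension_def le_imp_less_Suc\<close>)
  then show ?thesis using that fd.dim_psubset by (metis not_less)
qed

text \<open>Jacobson's form of Engel's theorem, with the action on \<open>M / N\<close> written without
  quotients. The set \<open>W\<close> is only closed under the bracket, which admits the set of all weight
  vectors of an ideal. Induct on the dimension of the span of \<open>W\<close>: choose
  a maximal proper bracket-closed \<open>U = W \<inter> span U\<close>, find \<open>w\<close> in \<open>W\<close> outside
  \<open>span U\<close> that normalizes it, and let \<open>w\<close> act on the vectors that \<open>U\<close> kills.\<close>

theorem (in fd_lie) engel_weakly_closed:
  fixes W M N :: "'g set"
  assumes "\<And>x y. x \<in> W \<Longrightarrow> y \<in> W \<Longrightarrow> lie x y \<in> W"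
    and "\<And>w x. w \<in> W \<Longrightarrow> x \<in> lie_vs.span W \<Longrightarrow> \<exists>n. (lie w ^^ n) x = 0"
    and "lie_vs.subspace M" "lie_vs.subspace N" "N \<subset> M"
    and "\<And>w x. w \<in> W \<Longrightarrow> x \<in> M \<Longrightarrow> lie w x \<in> M"
    and "\<And>w x. w \<in> W \<Longrightarrow> x \<in> N \<Longrightarrow> lie w x \<in> N"
    and "\<And>w x. w \<in> W \<Longrightarrow> x \<in> M \<Longrightarrow> \<exists>n. (lie w ^^ n) x \<in> N"
  shows "\<exists>v \<in> M - N. \<forall>w \<in> W. lie w v \<in> N"
  using assms
proof (induction "lie_vs.dim W" arbitrary: W M N rule: less_induct)
  case (less W M N)
  note closed = less.prems(1) and nilW = less.prems(2) and M = less.prems(3) and N = less.prems(4)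
    and MN = less.prems(5) and invM = less.prems(6) and invN = less.prems(7) and nil = less.prems(8)
  show ?case
  proof (cases "W \<subseteq> {0}")
    case True
    then have "lie w v = 0" if "w \<in> W" for w v using that by (auto simp: lie_simps)
    then show ?thesis using MN lie_vs.subspace_0[OF N] by auto
  next
    case False
    define good where "good U \<longleftrightarrow> U \<subseteq> W \<and> (\<forall>x\<in>U. \<forall>y\<in>U. lie x y \<in> U) \<and> W \<inter> lie_vs.span U \<subseteq> U
      \<and> \<not> W \<subseteq> lie_vs.span U" for U
    have "lie_vs.span (W \<inter> {0}) \<subseteq> {0}"
      by (intro lie_vs.span_minimal) (auto simp: lie_vs.subspace_single_0)
    then have "good (W \<inter> {0})"
      using False closed by (auto simp: good_def lie_simps)
    then obtain U where "good U" and max: "\<And>U'. good U' \<Longrightarrow> \<not> lie_vs.span U \<subset> lie_vs.span U'"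
      using max_dim_element[of good] by blast
    then have U: "U \<subseteq> W" "\<And>x y. x \<in> U \<Longrightarrow> y \<in> U \<Longrightarrow> lie x y \<in> U" "W \<inter> lie_vs.span U \<subseteq> U"
      "\<not> W \<subseteq> lie_vs.span U" by (auto simp: good_def)
    have spanUW: "lie_vs.span U \<subseteq> lie_vs.span W" using U(1) by (rule lie_vs.span_mono)
    have "lie_vs.span U \<noteq> lie_vs.span W" using U(4) lie_vs.span_superset by blast
    then have dimU: "lie_vs.dim U < lie_vs.dim W" using spanUW by (intro fd.dim_psubset) blast
    have nilU: "\<exists>n. (lie w ^^ n) x = 0" if "w \<in> U" "x \<in> lie_vs.span W" for w x
      using nilW that U(1) by blast
    have nilUU: "\<exists>n. (lie w ^^ n) x = 0" if "w \<in> U" "x \<in> lie_vs.span U" for w x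
      using nilU that spanUW by blast
    have act: "lie u x \<in> lie_vs.span W" if "u \<in> U" "x \<in> lie_vs.span W" for u x
      by (rule endo_span_subset[OF endo_lie _ _ that(2)])
        (use U(1) that(1) closed in \<open>auto intro: lie_vs.span_base\<close>)

    \<comment> \<open>An element of \<open>W\<close> that normalizes \<open>span U\<close>. The induction hypothesis only yields
      vectors of \<open>span W\<close>, so it is applied to a maximal \<open>U\<close>-invariant subspace that
      meets \<open>W\<close> in nothing new.\<close>
    define small where "small Q \<longleftrightarrow> lie_vs.subspace Q \<and> lie_vs.span U \<subseteq> Q \<and> Q \<subseteq> lie_vs.span W
      \<and> (\<forall>u\<in>U. \<forall>x\<in>Q. lie u x \<in> Q) \<and> W \<inter> Q \<subseteq> lie_vs.span U" for Q
    have "lie u x \<in> lie_vs.span U" if "u \<in> U" "x \<in> lie_vs.span U" for u x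
      by (rule endo_span_subset[OF endo_lie _ _ that(2)])
        (use U(2) that(1) in \<open>auto intro: lie_vs.span_base\<close>)
    then have "small (lie_vs.span U)" using spanUW by (auto simp: small_def)
    then obtain Q where "small Q" and maxQ: "\<And>Q'. small Q' \<Longrightarrow> \<not> lie_vs.span Q \<subset> lie_vs.span Q'"
      using max_dim_element[of small] by blast
    then have Q: "lie_vs.subspace Q" "lie_vs.span U \<subseteq> Q" "Q \<subseteq> lie_vs.span W"
      "\<And>u x. u \<in> U \<Longrightarrow> x \<in> Q \<Longrightarrow> lie u x \<in> Q" "W \<inter> Q \<subseteq> lie_vs.span U"
      by (auto simp: small_def)
    have "Q \<noteq> lie_vs.span W" using Q(5) U(4) lie_vs.span_superset[of W] by blast
    then have "Q \<subset> lie_vs.span W" using Q(3) by blast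
    have "\<exists>v \<in> lie_vs.span W - Q. \<forall>u \<in> U. lie u v \<in> Q"
    proof (rule less.hyps[OF dimU U(2) nilUU _ Q(1) \<open>Q \<subset> _\<close> act Q(4)])
      show "\<exists>n. (lie w ^^ n) x \<in> Q" if "w \<in> U" "x \<in> lie_vs.span W" for w x
        using nilU[OF that] lie_vs.subspace_0[OF Q(1)] by metis
    qed auto
    then obtain v where v: "v \<in> lie_vs.span W" "v \<notin> Q" "\<And>u. u \<in> U \<Longrightarrow> lie u v \<in> Q" by blast
    let ?Q' = "lie_vs.span (insert v Q)"
    have spanQ: "lie_vs.span Q = Q" using Q(1) lie_vs.span_eq_iff by blast
    have Q': "\<exists>c. \<exists>q\<in>Q. x = c *\<^sub>C v + q" if x: "x \<in> ?Q'" for x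
    proof -
      obtain c where "x - c *\<^sub>C v \<in> lie_vs.span Q"
        using x unfolding lie_vs.span_breakdown_eq by blast
      then have "x - c *\<^sub>C v \<in> Q" using spanQ by simp
      moreover have "x = c *\<^sub>C v + (x - c *\<^sub>C v)" by simp
      ultimately show ?thesis by blast
    qed
    have UQ': "lie u x \<in> Q" if u: "u \<in> U" and x: "x \<in> ?Q'" for u x
    proof -
      obtain c q where q: "q \<in> Q" "x = c *\<^sub>C v + q" using Q'[OF x] by blast
      have "c *\<^sub>C lie u v + lie u q \<in> Q"
        by (intro lie_vs.subspace_add[OF Q(1)] lie_vs.subspace_scale[OF Q(1)] v(3)[OF u] Q(4)[OF u q(1)])
      then show ?thesis by (simp add: q(2) lie_simps)
    qed
    have QQ': "Q \<subseteq> ?Q'" using lie_vs.span_superset by blast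
    have UQQ': "\<forall>u\<in>U. \<forall>x\<in>?Q'. lie u x \<in> ?Q'" using UQ' QQ' by blast
    have "\<not> small ?Q'"
    proof
      assume "small ?Q'"
      moreover have "lie_vs.span Q \<subset> lie_vs.span ?Q'"
        unfolding spanQ lie_vs.span_span
        using v(2) QQ' lie_vs.span_base[of v "insert v Q"] by blast
      ultimately show False using maxQ by blast
    qed
    moreover have "?Q' \<subseteq> lie_vs.span W"
      using v(1) Q(3) by (intro lie_vs.span_minimal) auto
    ultimately have "\<not> W \<inter> ?Q' \<subseteq> lie_vs.span U"
      using Q(2) QQ' UQQ' lie_vs.subspace_span by (auto simp: small_def)
    then obtain w where w: "w \<in> W" "w \<in> ?Q'" "w \<notin> lie_vs.span U" by blast
    have Uw: "lie u w \<in> lie_vs.span U" if "u \<in> U" for u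
      using UQ'[OF that w(2)] closed[of u w] U(1) that w(1) Q(5) by blast

    \<comment> \<open>Together with \<open>U\<close>, the element \<open>w\<close> already spans everything.\<close>
    let ?I = "lie_vs.span (insert w U)"
    have UI: "lie_vs.span U \<subseteq> ?I" by (intro lie_vs.span_mono) auto
    have "W \<subseteq> ?I"
    proof (rule ccontr)
      assume "\<not> W \<subseteq> ?I"
      have gen: "lie x y \<in> ?I" if "x \<in> insert w U" "y \<in> insert w U" for x y
      proof -
        have "lie u w \<in> ?I" "lie w u \<in> ?I" if "u \<in> U" for u
          using Uw[OF that] UI lie_skew[of w u] lie_vs.span_neg by auto
        then show ?thesis
          using that U(2) by (auto simp: lie_self lie_vs.span_zero intro: lie_vs.span_base)
      qed
      have sub: "lie_vs.span (W \<inter> ?I) \<subseteq> ?I" by (intro lie_vs.span_minimal) auto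
      have "lie x y \<in> ?I" if "x \<in> ?I" "y \<in> ?I" for x y
        by (rule lie_mem_span[OF gen _ that]) auto
      then have "good (W \<inter> ?I)"
        using sub closed \<open>\<not> W \<subseteq> ?I\<close> by (auto simp: good_def)
      moreover have "insert w U \<subseteq> W \<inter> ?I" using w(1) U(1) by (auto intro: lie_vs.span_base)
      then have "lie_vs.span U \<subset> lie_vs.span (W \<inter> ?I)"
        using w(3) lie_vs.span_mono[of U "W \<inter> ?I"] lie_vs.span_base[of w "W \<inter> ?I"] by auto
      ultimately show False using max by blast
    qed

    define K where "K = {x \<in> M. \<forall>u\<in>U. lie u x \<in> N}"
    have "\<exists>v \<in> M - N. \<forall>u \<in> U. lie u v \<in> N"
      by (rule less.hyps[OF dimU U(2) nilUU M N MN]) (use U(1) invM invN nil in blast)+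
    then obtain v0 where v0: "v0 \<in> K" "v0 \<notin> N" by (auto simp: K_def)
    have "lie w x \<in> K" if "x \<in> K" for x
    proof -
      have x: "x \<in> M" "\<And>u. u \<in> U \<Longrightarrow> lie u x \<in> N" using that by (auto simp: K_def)
      have "lie u (lie w x) \<in> N" if "u \<in> U" for u
      proof -
        have "lie (lie u w) x \<in> N"
          by (rule endo_span_subset[OF endo_lie_left N _ Uw[OF that]]) (fact x(2))
        moreover have "lie w (lie u x) \<in> N" using invN w(1) x(2) that by blast
        ultimately show ?thesis by (simp add: lie_leibniz[of u w x] lie_vs.subspace_add N)
      qed
      then show ?thesis using x invM w(1) by (auto simp: K_def)
    qed
    then have K_pow: "(lie w ^^ n) v0 \<in> K" for n by (induction n) (auto simp: v0)
    define n where "n = (LEAST n. (lie w ^^ n) v0 \<in> N)"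
    have "\<exists>n. (lie w ^^ n) v0 \<in> N" using nil w(1) v0 by (auto simp: K_def)
    then have n: "(lie w ^^ n) v0 \<in> N" unfolding n_def by (rule LeastI_ex)
    then obtain m where m: "n = Suc m" using v0 by (cases n) auto
    let ?v = "(lie w ^^ m) v0"
    have "?v \<notin> N" using not_less_Least[of m "\<lambda>n. (lie w ^^ n) v0 \<in> N"] m by (auto simp: n_def)
    moreover have "lie w ?v \<in> N" using n m by simp
    moreover have "?v \<in> K" by (rule K_pow)
    moreover have "lie x ?v \<in> N" if "x \<in> W" for x
      by (rule endo_span_subset[OF endo_lie_left N, of "insert w U"])
        (use calculation that \<open>W \<subseteq> ?I\<close> in \<open>auto simp: K_def\<close>)
    ultimately show ?thesis by (auto simp: K_def)
  qed
qed

section \<open>Weight spaces of a Cartan subalgebra\<close>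

locale cartan_lie = fd_lie basis0
  for basis0 :: "'g::complex_lie_algebra set" +
  fixes H :: "'g set"
  assumes cartan: "cartan_subalgebra H"
begin

lemma H_subspace: "lie_vs.subspace H"
  using cartan by (simp add: cartan_subalgebra_def lie_subalgebra_def)

lemma H_lie: "x \<in> H \<Longrightarrow> y \<in> H \<Longrightarrow> lie x y \<in> H"
  using cartan by (simp add: cartan_subalgebra_def lie_subalgebra_def)

lemma H_self_normalizing: "(\<And>h. h \<in> H \<Longrightarrow> lie x h \<in> H) \<Longrightarrow> x \<in> H"
proof -
  assume "\<And>h. h \<in> H \<Longrightarrow> lie x h \<in> H"
  then have "x \<in> normalizer H" by (simp add: normalizer_def)
  then show "x \<in> H" using cartan by (simp add: cartan_subalgebra_def)
qed

lemma H_nilpotent: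
  assumes "h \<in> H" "x \<in> H"
  shows "x \<in> gen_eigenspace (lie h) 0"
proof -
  obtain n where n: "lower_central_series H n = {0}"
    using cartan by (auto simp: cartan_subalgebra_def nilpotent_lie_def)
  have "(lie h ^^ i) x \<in> lower_central_series H i" for i
  proof (induction i)
    case (Suc i)
    then show ?case
      using assms(1) by (auto simp: commutator_space_def intro!: lie_vs.span_base)
  qed (simp add: assms)
  then have "(lie h ^^ n) x = 0" using n by blast
  then show ?thesis by (auto simp: gen_eigenspace_def)
qed

text \<open>Weights are functionals on \<open>H\<close>, represented as in \<open>dual H\<close> by functions that vanish outside \<open>H\<close>, so
  that different weights differ at some element of \<open>H\<close>. Linearity comes later, from traces.\<close>

definition hfun :: "('g \<Rightarrow> complex) set" where
  "hfun = {\<mu>. \<forall>x. x \<notin> H \<longrightarrow> \<mu> x = 0}"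

definition weight_space :: "('g \<Rightarrow> complex) \<Rightarrow> 'g set" where
  "weight_space \<mu> = {x. \<forall>h\<in>H. x \<in> gen_eigenspace (lie h) (\<mu> h)}"

lemma hfun_add: "\<mu> \<in> hfun \<Longrightarrow> \<nu> \<in> hfun \<Longrightarrow> \<mu> + \<nu> \<in> hfun"
  and hfun_uminus: "\<mu> \<in> hfun \<Longrightarrow> - \<mu> \<in> hfun"
  and hfun_zero: "0 \<in> hfun"
  and hfun_scale: "\<mu> \<in> hfun \<Longrightarrow> c *\<^sub>F \<mu> \<in> hfun"
  by (auto simp: hfun_def scaleF_def)

lemma hfun_eqI: "\<mu> \<in> hfun \<Longrightarrow> \<nu> \<in> hfun \<Longrightarrow> (\<And>h. h \<in> H \<Longrightarrow> \<mu> h = \<nu> h) \<Longrightarrow> \<mu> = \<nu>"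
  by (rule ext) (metis (mono_tags, lifting) hfun_def mem_Collect_eq)

lemma weight_space_subspace: "lie_vs.subspace (weight_space \<mu>)"
proof -
  have "weight_space \<mu> = (\<Inter>h\<in>H. gen_eigenspace (lie h) (\<mu> h))" by (auto simp: weight_space_def)
  then show ?thesis
    by (simp only:) (intro lie_vs.subspace_Int subspace_gen_eigenspace endo_lie)
qed

lemma gen_eigenspace_ad_invariant:
  assumes "h \<in> H" "k \<in> H" "x \<in> gen_eigenspace (lie h) a"
  shows "lie k x \<in> gen_eigenspace (lie h) a"
  using gen_eigenspace_lie[OF endo_lie lie_leibniz H_nilpotent[OF assms(1,2)] assms(3)] by simp

lemma weight_space_invariant: "h \<in> H \<Longrightarrow> x \<in> weight_space \<mu> \<Longrightarrow> lie h x \<in> weight_space \<mu>"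
  by (simp add: weight_space_def gen_eigenspace_ad_invariant)

lemma weight_space_lie:
  "x \<in> weight_space \<mu> \<Longrightarrow> y \<in> weight_space \<nu> \<Longrightarrow> lie x y \<in> weight_space (\<mu> + \<nu>)"
  by (simp add: weight_space_def gen_eigenspace_lie[OF endo_lie lie_leibniz])

text \<open>If some \<open>h\<close> has two eigenvalues on \<open>U\<close>, its generalized eigenspaces in \<open>U\<close> are proper
  \<open>H\<close>-invariant subspaces; otherwise \<open>U\<close> lies in one weight space.\<close>

lemma weight_decomposition:
  assumes "lie_vs.subspace U" "\<And>h x. h \<in> H \<Longrightarrow> x \<in> U \<Longrightarrow> lie h x \<in> U"
  shows "U \<subseteq> lie_vs.span (\<Union>\<mu>\<in>hfun. U \<inter> weight_space \<mu>)"
  using assms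
proof (induction "lie_vs.dim U" arbitrary: U rule: less_induct)
  case (less U)
  show ?case
  proof (cases "\<forall>h\<in>H. \<exists>a. U \<subseteq> gen_eigenspace (lie h) a")
    case True
    then obtain a where a: "\<And>h. h \<in> H \<Longrightarrow> U \<subseteq> gen_eigenspace (lie h) (a h)" by metis
    define \<mu> where "\<mu> = (\<lambda>h. if h \<in> H then a h else 0)"
    have "\<mu> \<in> hfun" by (simp add: \<mu>_def hfun_def)
    moreover have "U \<subseteq> weight_space \<mu>" using a by (auto simp: \<mu>_def weight_space_def)
    ultimately show ?thesis by (auto intro!: lie_vs.span_base)
  next
    case False
    then obtain h where h: "h \<in> H" "\<And>a. \<not> U \<subseteq> gen_eigenspace (lie h) a" by blast
    let ?U = "\<lambda>a. U \<inter> gen_eigenspace (lie h) a"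
    have "?U a \<subseteq> lie_vs.span (\<Union>\<mu>\<in>hfun. U \<inter> weight_space \<mu>)" for a
    proof -
      have sub: "lie_vs.subspace (?U a)"
        by (intro lie_vs.subspace_inter less.prems(1) subspace_gen_eigenspace endo_lie)
      have "?U a \<subset> U" using h(2)[of a] by blast
      then have "lie_vs.span (?U a) \<subset> lie_vs.span U"
        unfolding lie_vs.span_eq_iff[THEN iffD2, OF sub] lie_vs.span_eq_iff[THEN iffD2, OF less.prems(1)] .
      then have "lie_vs.dim (?U a) < lie_vs.dim U" by (rule fd.dim_psubset)
      then have "?U a \<subseteq> lie_vs.span (\<Union>\<mu>\<in>hfun. ?U a \<inter> weight_space \<mu>)"
        by (rule less.hyps) (use sub less.prems(2) h(1) gen_eigenspace_ad_invariant in auto)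
      also have "\<dots> \<subseteq> lie_vs.span (\<Union>\<mu>\<in>hfun. U \<inter> weight_space \<mu>)"
        by (intro lie_vs.span_mono) auto
      finally show ?thesis .
    qed
    then have "lie_vs.span (\<Union>a. ?U a) \<subseteq> lie_vs.span (\<Union>\<mu>\<in>hfun. U \<inter> weight_space \<mu>)"
      by (intro lie_vs.span_minimal) auto
    moreover have "U \<subseteq> lie_vs.span (\<Union>a. ?U a)"
      using primary_decomposition[OF endo_lie less.prems(1)] less.prems(2) h(1) by blast
    ultimately show ?thesis by blast
  qed
qed

text \<open>Given a linear relation and two of its weights \<open>\<nu> \<noteq> \<mu>\<close>, a power of \<open>lie h - \<nu> h\<close> removes the
  component for \<open>\<nu>\<close> and, if \<open>\<mu> h \<noteq> \<nu> h\<close>, is injective on the one for \<open>\<mu>\<close>.\<close>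

lemma weight_spaces_independent:
  assumes "finite L" "L \<subseteq> hfun" "\<And>\<mu>. \<mu> \<in> L \<Longrightarrow> x \<mu> \<in> weight_space \<mu>" "(\<Sum>\<mu>\<in>L. x \<mu>) = 0"
  shows "\<forall>\<mu>\<in>L. x \<mu> = 0"
  using assms
proof (induction L arbitrary: x rule: finite_induct)
  case (insert \<nu> L)
  have "x \<mu> = 0" if "\<mu> \<in> L" for \<mu>
  proof -
    have "\<mu> \<in> hfun" "\<nu> \<in> hfun" "\<mu> \<noteq> \<nu>"
      using insert.hyps(2) insert.prems(1) that by auto
    then obtain h where h: "h \<in> H" "\<mu> h \<noteq> \<nu> h" using hfun_eqI by blast
    have "x \<nu> \<in> gen_eigenspace (lie h) (\<nu> h)" using insert.prems h by (simp add: weight_space_def)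
    then obtain n where n: "(shift (lie h) (\<nu> h) ^^ n) (x \<nu>) = 0" by (auto simp: gen_eigenspace_def)
    let ?g = "shift (lie h) (\<nu> h) ^^ n"
    have g: "endo ?g" by (intro endo_pow endo_shift endo_lie)
    have "(shift (lie h) (\<nu> h) ^^ m) y \<in> weight_space \<kappa>" if "y \<in> weight_space \<kappa>" for y \<kappa> m
      by (induction m)
        (auto simp: that shift_def h weight_space_invariant weight_space_subspace
          intro!: lie_vs.subspace_diff lie_vs.subspace_scale)
    moreover have "(\<Sum>\<kappa>\<in>L. ?g (x \<kappa>)) = 0"
    proof -
      have "?g (x \<nu> + (\<Sum>\<kappa>\<in>L. x \<kappa>)) = 0"
        using insert.hyps insert.prems(3) by (simp add: endo_zero[OF g])
      then show ?thesis by (simp add: endo_simps[OF g] n)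
    qed
    ultimately have "?g (x \<mu>) = 0"
      using insert.IH[of "\<lambda>\<kappa>. ?g (x \<kappa>)"] insert.prems(1,2) that by simp
    then have "x \<mu> \<in> gen_eigenspace (lie h) (\<nu> h)" unfolding gen_eigenspace_def by blast
    moreover have "x \<mu> \<in> gen_eigenspace (lie h) (\<mu> h)"
      using insert.prems that h by (simp add: weight_space_def)
    ultimately show ?thesis
      using gen_eigenspace_disjoint[OF endo_lie, of "\<nu> h" "\<mu> h" "x \<mu>" h] h by auto
  qed
  then show ?case using insert by simp
qed simp

text \<open>Traces over weight spaces are read off from the diagonal in a basis of weight vectors.\<close>

definition wbasis :: "'g set" where
  "wbasis = (SOME B. B \<subseteq> (\<Union>\<mu>\<in>hfun. weight_space \<mu>) \<and> lie_vs.independent B \<and> lie_vs.span B = UNIV)"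

definition wt :: "'g \<Rightarrow> 'g \<Rightarrow> complex" where
  "wt b = (SOME \<mu>. \<mu> \<in> hfun \<and> b \<in> weight_space \<mu>)"

definition weights :: "('g \<Rightarrow> complex) set" where
  "weights = wt ` wbasis"

lemma
  shows wbasis_weight: "wbasis \<subseteq> (\<Union>\<mu>\<in>hfun. weight_space \<mu>)"
    and wbasis_independent: "lie_vs.independent wbasis"
    and wbasis_span: "lie_vs.span wbasis = UNIV"
proof -
  obtain B where B: "B \<subseteq> (\<Union>\<mu>\<in>hfun. weight_space \<mu>)" "lie_vs.independent B"
    "(\<Union>\<mu>\<in>hfun. weight_space \<mu>) \<subseteq> lie_vs.span B"
    using lie_vs.maximal_independent_subset by blast
  have "(UNIV :: 'g set) \<subseteq> lie_vs.span (\<Union>\<mu>\<in>hfun. UNIV \<inter> weight_space \<mu>)"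
    by (rule weight_decomposition) auto
  also have "\<dots> \<subseteq> lie_vs.span B" using B(3) by (intro lie_vs.span_minimal) auto
  finally have "lie_vs.span B = UNIV" by blast
  then have "\<exists>B. B \<subseteq> (\<Union>\<mu>\<in>hfun. weight_space \<mu>) \<and> lie_vs.independent B \<and> lie_vs.span B = UNIV"
    using B by blast
  from someI_ex[OF this] show "wbasis \<subseteq> (\<Union>\<mu>\<in>hfun. weight_space \<mu>)"
    "lie_vs.independent wbasis" "lie_vs.span wbasis = UNIV" unfolding wbasis_def by blast+
qed

lemma finite_wbasis: "finite wbasis"
  using wbasis_independent by (rule fd.finiteI_independent)

lemma
  assumes "b \<in> wbasis"
  shows wt_hfun: "wt b \<in> hfun" and wt_weight_space: "b \<in> weight_space (wt b)"
proof -
  have "\<exists>\<mu>. \<mu> \<in> hfun \<and> b \<in> weight_space \<mu>" using assms wbasis_weight by blast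
  from someI_ex[OF this] show "wt b \<in> hfun" "b \<in> weight_space (wt b)" by (auto simp: wt_def)
qed

lemma finite_weights: "finite weights"
  by (simp add: weights_def finite_wbasis)

lemma weights_hfun: "\<mu> \<in> weights \<Longrightarrow> \<mu> \<in> hfun"
  by (auto simp: weights_def wt_hfun)

abbreviation coord :: "'g \<Rightarrow> 'g \<Rightarrow> complex" where
  "coord \<equiv> lie_vs.representation wbasis"

lemmas coord_simps = rep_add[OF wbasis_independent wbasis_span]
  rep_scale[OF wbasis_independent wbasis_span] sum_rep[OF wbasis_independent wbasis_span]

lemma coord_weight_vector:
  assumes "\<mu> \<in> hfun" "x \<in> weight_space \<mu>" "b \<in> wbasis" "wt b \<noteq> \<mu>"
  shows "coord x b = 0"
proof -
  define y where "y \<nu> = (\<Sum>b\<in>{b\<in>wbasis. wt b = \<nu>}. coord x b *\<^sub>C b)" for \<nu>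
  let ?L = "insert \<mu> weights"
  have y: "y \<nu> \<in> weight_space \<nu>" for \<nu>
    unfolding y_def using wt_weight_space
    by (auto intro!: lie_vs.subspace_sum lie_vs.subspace_scale weight_space_subspace)
  have "(\<Sum>\<nu>\<in>?L. y \<nu>) = (\<Sum>b\<in>wbasis. coord x b *\<^sub>C b)"
    unfolding y_def by (rule sum.group) (auto simp: finite_wbasis finite_weights weights_def)
  then have "(\<Sum>\<nu>\<in>?L. y \<nu> - (if \<nu> = \<mu> then x else 0)) = 0"
    by (simp add: sum_subtractf coord_simps finite_weights sum.delta)
  moreover have "y \<nu> - (if \<nu> = \<mu> then x else 0) \<in> weight_space \<nu>" for \<nu>
    using y[of \<nu>] assms(2) lie_vs.subspace_diff[OF weight_space_subspace] by auto
  moreover have "finite ?L" "?L \<subseteq> hfun" using finite_weights weights_hfun assms(1) by auto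
  ultimately have "\<forall>\<nu>\<in>?L. y \<nu> - (if \<nu> = \<mu> then x else 0) = 0"
    using weight_spaces_independent[of ?L "\<lambda>\<nu>. y \<nu> - (if \<nu> = \<mu> then x else 0)"] by blast
  moreover have "wt b \<in> ?L" using assms(3) by (simp add: weights_def)
  ultimately have "y (wt b) - (if wt b = \<mu> then x else 0) = 0" by (rule bspec)
  then have "(\<Sum>b'\<in>{b'\<in>wbasis. wt b' = wt b}. coord x b' *\<^sub>C b') = 0"
    using assms(4) by (simp add: y_def)
  then show ?thesis
    by (rule lie_vs.independentD[OF wbasis_independent, rotated 2])
      (use finite_wbasis assms(3) in auto)
qed

definition weight_proj :: "('g \<Rightarrow> complex) set \<Rightarrow> 'g \<Rightarrow> 'g" where
  "weight_proj S x = (\<Sum>b\<in>{b\<in>wbasis. wt b \<in> S}. coord x b *\<^sub>C b)"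

definition weight_mult :: "('g \<Rightarrow> complex) \<Rightarrow> nat" where
  "weight_mult \<mu> = card {b\<in>wbasis. wt b = \<mu>}"

lemma endo_weight_proj: "endo (weight_proj S)"
  by (rule endoI) (simp_all add: weight_proj_def coord_simps lie_vs.scale_left_distrib sum.distrib
      lie_vs.scale_sum_right)

lemma weight_proj_eq:
  assumes "\<mu> \<in> hfun" "x \<in> weight_space \<mu>"
  shows "weight_proj S x = (if \<mu> \<in> S then x else 0)"
proof -
  have "weight_proj S x = (\<Sum>b\<in>wbasis. if wt b \<in> S then coord x b *\<^sub>C b else 0)"
    unfolding weight_proj_def by (simp add: sum.inter_filter finite_wbasis)
  also have "\<dots> = (\<Sum>b\<in>wbasis. if \<mu> \<in> S then coord x b *\<^sub>C b else 0)"
    by (intro sum.cong refl) (use coord_weight_vector[OF assms] in auto)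
  also have "\<dots> = (if \<mu> \<in> S then x else 0)" by (simp add: coord_simps)
  finally show ?thesis .
qed

lemma weight_proj_in: "weight_proj {\<mu>} x \<in> weight_space \<mu>"
  unfolding weight_proj_def using wt_weight_space
  by (auto intro!: lie_vs.subspace_sum lie_vs.subspace_scale weight_space_subspace)

lemma sum_weight_proj: "weight_proj S x = (\<Sum>\<mu>\<in>weights \<inter> S. weight_proj {\<mu>} x)"
proof -
  have "(\<Sum>\<mu>\<in>weights \<inter> S. weight_proj {\<mu>} x)
    = (\<Sum>\<mu>\<in>weights \<inter> S. (\<Sum>b\<in>{b \<in> {b\<in>wbasis. wt b \<in> S}. wt b = \<mu>}. coord x b *\<^sub>C b))"
    unfolding weight_proj_def by (intro sum.cong refl) auto
  also have "\<dots> = weight_proj S x"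
    unfolding weight_proj_def
    by (rule sum.group) (auto simp: finite_wbasis finite_weights weights_def)
  finally show ?thesis by simp
qed

lemma weight_proj_UNIV: "weight_proj UNIV x = x"
  by (simp add: weight_proj_def coord_simps)

lemma sum_weights: "(\<Sum>\<mu>\<in>weights. weight_proj {\<mu>} x) = x"
  using sum_weight_proj[of UNIV x] by (simp add: weight_proj_UNIV)

lemma endo_eq_on_weight_vectors:
  assumes "endo f" "endo g" "\<And>\<mu> x. \<mu> \<in> weights \<Longrightarrow> x \<in> weight_space \<mu> \<Longrightarrow> f x = g x"
  shows "f x = g x"
  by (rule endo_eq_on_span[OF assms(1,2), of wbasis])
    (use assms(3) wt_weight_space in \<open>auto simp: wbasis_span weights_def\<close>)

lemma weight_proj_commute:
  assumes f: "endo f" "\<And>\<mu> x. \<mu> \<in> hfun \<Longrightarrow> x \<in> weight_space \<mu> \<Longrightarrow> f x \<in> weight_space (\<mu> + \<alpha>)"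
    and "\<alpha> \<in> hfun" "\<And>\<mu>. \<mu> + \<alpha> \<in> S \<longleftrightarrow> \<mu> \<in> S"
  shows "weight_proj S (f x) = f (weight_proj S x)"
proof (rule endo_eq_on_weight_vectors[of "\<lambda>x. weight_proj S (f x)" "\<lambda>x. f (weight_proj S x)"])
  fix \<mu> x
  assume "\<mu> \<in> weights" and x: "x \<in> weight_space \<mu>"
  then have \<mu>: "\<mu> \<in> hfun" by (simp add: weights_hfun)
  have "weight_proj S (f x) = (if \<mu> + \<alpha> \<in> S then f x else 0)"
    by (rule weight_proj_eq[OF hfun_add[OF \<mu> assms(3)] f(2)[OF \<mu> x]])
  also have "\<dots> = f (if \<mu> \<in> S then x else 0)" by (simp add: assms(4) endo_zero[OF f(1)])
  also have "\<dots> = f (weight_proj S x)" by (simp only: weight_proj_eq[OF \<mu> x])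
  finally show "weight_proj S (f x) = f (weight_proj S x)" .
qed (rule endo_compose[OF endo_weight_proj f(1)], rule endo_compose[OF f(1) endo_weight_proj])

lemma weights_iff:
  assumes "\<mu> \<in> hfun"
  shows "\<mu> \<in> weights \<longleftrightarrow> weight_space \<mu> \<noteq> {0}"
proof
  assume "\<mu> \<in> weights"
  then obtain b where b: "b \<in> wbasis" "wt b = \<mu>" by (auto simp: weights_def)
  then have "b \<noteq> 0" using wbasis_independent lie_vs.dependent_zero by blast
  then show "weight_space \<mu> \<noteq> {0}" using wt_weight_space[OF b(1)] b(2) by blast
next
  assume "weight_space \<mu> \<noteq> {0}"
  then obtain x where x: "x \<in> weight_space \<mu>" "x \<noteq> 0"
    using lie_vs.subspace_0[OF weight_space_subspace] by blast
  show "\<mu> \<in> weights"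
  proof (rule ccontr)
    assume "\<mu> \<notin> weights"
    then have "\<forall>b\<in>wbasis. coord x b = 0"
      using coord_weight_vector[OF assms x(1)] by (auto simp: weights_def)
    then have "(\<Sum>b\<in>wbasis. coord x b *\<^sub>C b) = 0" by simp
    then show False using x(2) by (simp add: coord_simps)
  qed
qed

lemma weight_mult_pos: "\<mu> \<in> weights \<Longrightarrow> weight_mult \<mu> > 0"
  by (auto simp: weight_mult_def weights_def card_gt_0_iff finite_wbasis)

section \<open>Traces on weight spaces\<close>

text \<open>An idempotent that is diagonal in the basis of weight vectors.\<close>

lemma trace_weight_proj: "endo_trace (weight_proj {\<mu>}) = of_nat (weight_mult \<mu>)"
proof -
  have "endo_trace (weight_proj {\<mu>}) = (\<Sum>b\<in>wbasis. if wt b = \<mu> then 1 else 0)"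
    unfolding endo_trace_basis[OF wbasis_independent wbasis_span endo_weight_proj]
    by (intro sum.cong refl)
      (auto simp: weight_proj_eq[OF wt_hfun wt_weight_space] lie_vs.representation_zero
        lie_vs.representation_basis[OF wbasis_independent])
  also have "\<dots> = of_nat (weight_mult \<mu>)"
    by (simp add: weight_mult_def sum.If_cases finite_wbasis Collect_conj_eq Int_commute)
  finally show ?thesis .
qed

text \<open>An operator that moves every weight by \<open>\<alpha> \<noteq> 0\<close> has zero diagonal.\<close>

lemma trace_shifting:
  assumes f: "endo f" "\<And>\<mu> x. \<mu> \<in> hfun \<Longrightarrow> x \<in> weight_space \<mu> \<Longrightarrow> f x \<in> weight_space (\<mu> + \<alpha>)"
    and "\<alpha> \<in> hfun" "\<alpha> \<noteq> 0"
  shows "endo_trace f = 0"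
proof -
  have "coord (f b) b = 0" if "b \<in> wbasis" for b
    using coord_weight_vector[of "wt b + \<alpha>" "f b" b] assms that wt_hfun wt_weight_space
    by (simp add: hfun_add)
  then show ?thesis by (simp add: endo_trace_basis[OF wbasis_independent wbasis_span f(1)])
qed

text \<open>The operator \<open>(f - a) \<circ> weight_proj {\<mu>}\<close> is nilpotent.\<close>

lemma trace_on_weight_space:
  assumes f: "endo f" "\<And>x. x \<in> weight_space \<mu> \<Longrightarrow> f x \<in> weight_space \<mu>" and "\<mu> \<in> hfun"
    and a: "\<And>x. x \<in> weight_space \<mu> \<Longrightarrow> x \<in> gen_eigenspace f a"
  shows "endo_trace (\<lambda>x. f (weight_proj {\<mu>} x)) = of_nat (weight_mult \<mu>) * a"
proof -
  let ?P = "weight_proj {\<mu>}"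
  let ?g = "\<lambda>x. shift f a (?P x)"
  have g: "endo ?g" by (rule endo_compose[OF endo_shift[OF f(1)] endo_weight_proj])
  have inv: "shift f a x \<in> weight_space \<mu>" if "x \<in> weight_space \<mu>" for x
    using that f(2) weight_space_subspace
    by (auto simp: shift_def intro!: lie_vs.subspace_diff lie_vs.subspace_scale)
  have "(?g ^^ n) (?P x) = (shift f a ^^ n) (?P x) \<and> (shift f a ^^ n) (?P x) \<in> weight_space \<mu>" for n x
    by (induction n) (auto simp: weight_proj_in inv weight_proj_eq[OF assms(3)])
  moreover have "(?g ^^ Suc n) x = ?g ((?g ^^ n) (?P x))" for n x
    by (induction n) (auto simp: weight_proj_eq[OF assms(3) weight_proj_in])
  ultimately have "(?g ^^ Suc n) x = (shift f a ^^ Suc n) (?P x)" for n x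
    by (simp add: weight_proj_eq[OF assms(3)])
  moreover have "\<exists>n. (shift f a ^^ Suc n) (?P x) = 0" for x
  proof -
    obtain n where "(shift f a ^^ n) (?P x) = 0"
      using a[OF weight_proj_in] by (auto simp: gen_eigenspace_def)
    then show ?thesis using endo_zero[OF endo_shift[OF f(1)]] by (intro exI[of _ n]) simp
  qed
  ultimately have "endo_trace ?g = 0" by (intro endo_trace_nilpotent g) metis
  moreover have "endo_trace ?g = endo_trace (\<lambda>x. f (?P x)) - a * endo_trace ?P"
    unfolding shift_def
    using endo_trace_diff[OF endo_compose[OF f(1) endo_weight_proj] endo_scaled[OF endo_weight_proj]]
    by (simp add: endo_trace_scale[OF endo_weight_proj])
  ultimately show ?thesis by (simp add: trace_weight_proj mult.commute)
qed

lemma trace_ad_on_weight_space: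
  assumes "\<mu> \<in> hfun" "h \<in> H"
  shows "endo_trace (\<lambda>x. lie h (weight_proj {\<mu>} x)) = of_nat (weight_mult \<mu>) * \<mu> h"
  by (rule trace_on_weight_space[OF endo_lie])
    (use assms in \<open>auto simp: weight_space_invariant weight_space_def gen_eigenspace_ad_invariant\<close>)

text \<open>The value \<open>\<mu> h\<close> is the normalized trace of \<open>lie h\<close> on the weight space, and traces are linear.\<close>

lemma weight_dual:
  assumes "\<mu> \<in> weights"
  shows "\<mu> \<in> dual H"
proof -
  note \<mu> = weights_hfun[OF assms]
  have m: "of_nat (weight_mult \<mu>) \<noteq> (0::complex)" using weight_mult_pos[OF assms] by simp
  have lin: "endo (\<lambda>x. lie h (weight_proj {\<mu>} x))" for h
    by (rule endo_compose[OF endo_lie endo_weight_proj])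
  have "of_nat (weight_mult \<mu>) * \<mu> (h + k) = of_nat (weight_mult \<mu>) * (\<mu> h + \<mu> k)" if "h \<in> H" "k \<in> H" for h k
    using trace_ad_on_weight_space[OF \<mu>, of "h + k"] that H_subspace
    by (simp add: lie_add_left endo_trace_add lin trace_ad_on_weight_space[OF \<mu>] lie_vs.subspace_add
        distrib_left)
  moreover have "of_nat (weight_mult \<mu>) * \<mu> (c *\<^sub>C h) = of_nat (weight_mult \<mu>) * (c * \<mu> h)" if "h \<in> H" for h c
    using trace_ad_on_weight_space[OF \<mu>, of "c *\<^sub>C h"] that H_subspace
    by (auto simp: lie_scaleC_left endo_trace_scale lin trace_ad_on_weight_space[OF \<mu>]
        lie_vs.subspace_scale)
  ultimately show ?thesis using m \<mu> by (auto simp: dual_def hfun_def)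
qed

lemma
  assumes "\<beta> \<in> weights"
  shows weight_add: "x \<in> H \<Longrightarrow> y \<in> H \<Longrightarrow> \<beta> (x + y) = \<beta> x + \<beta> y"
    and weight_scale: "x \<in> H \<Longrightarrow> \<beta> (c *\<^sub>C x) = c * \<beta> x"
  using weight_dual[OF assms] by (auto simp: dual_def)

lemma endo_trace_sum:
  "finite A \<Longrightarrow> (\<And>i. i \<in> A \<Longrightarrow> endo (f i)) \<Longrightarrow>
    endo_trace (\<lambda>x::'g. \<Sum>i\<in>A. f i x) = (\<Sum>i\<in>A. endo_trace (f i)) \<and> endo (\<lambda>x. \<Sum>i\<in>A. f i x)"
proof (induction A rule: finite_induct)
  case empty
  show ?case by (auto simp: endo_trace_zero intro: endoI)
next
  case (insert a A)
  then show ?case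
    using endo_trace_add[of "f a" "\<lambda>x. \<Sum>i\<in>A. f i x"] endo_plus[of "f a" "\<lambda>x. \<Sum>i\<in>A. f i x"] by simp
qed

lemma trace_weight_sum:
  assumes f: "endo f"
  shows "endo_trace (\<lambda>x. f (weight_proj S x)) = (\<Sum>\<mu>\<in>weights \<inter> S. endo_trace (\<lambda>x. f (weight_proj {\<mu>} x)))"
  using endo_trace_sum[of "weights \<inter> S" "\<lambda>\<mu> x. f (weight_proj {\<mu>} x)"] finite_weights
  by (simp add: endo_compose[OF f endo_weight_proj] sum_weight_proj[of S] endo_sum[OF f])

lemma killing_square:
  assumes "h \<in> H"
  shows "killing h h = (\<Sum>\<mu>\<in>weights. of_nat (weight_mult \<mu>) * \<mu> h * \<mu> h)"
proof -
  have sq: "x \<in> gen_eigenspace (\<lambda>z. lie h (lie h z)) (a * a)" if "x \<in> gen_eigenspace (lie h) a" for x a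
    using that endo_lie
  proof (induction rule: gen_eigenspace_induct)
    case zero
    show ?case by (simp add: lie_vs.subspace_0 subspace_gen_eigenspace endo_lie_lie)
  next
    case (step x)
    let ?G = "gen_eigenspace (\<lambda>z. lie h (lie h z)) (a * a)" and ?y = "shift (lie h) a x"
    have G: "lie_vs.subspace ?G" by (intro subspace_gen_eigenspace endo_lie_lie)
    have "lie h ?y \<in> ?G"
      by (rule gen_eigenspace_commuting[OF endo_lie_lie endo_lie _ step.IH]) simp
    then have "lie h ?y + a *\<^sub>C ?y \<in> ?G"
      using step.IH G by (intro lie_vs.subspace_add lie_vs.subspace_scale)
    moreover have "lie h ?y + a *\<^sub>C ?y = shift (\<lambda>z. lie h (lie h z)) (a * a) x"
      by (simp add: shift_def lie_simps lie_vs.scale_right_diff_distrib)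
    ultimately obtain n where "(shift (\<lambda>z. lie h (lie h z)) (a * a) ^^ Suc n) x = 0"
      by (auto simp: gen_eigenspace_def funpow_swap1)
    then show ?case unfolding gen_eigenspace_def by blast
  qed
  have "killing h h = endo_trace (\<lambda>x. lie h (lie h (weight_proj UNIV x)))"
    by (simp add: killing_def weight_proj_UNIV)
  also have "\<dots> = (\<Sum>\<mu>\<in>weights. endo_trace (\<lambda>x. lie h (lie h (weight_proj {\<mu>} x))))"
    using trace_weight_sum[OF endo_lie_lie, of h h UNIV] by simp
  also have "\<dots> = (\<Sum>\<mu>\<in>weights. of_nat (weight_mult \<mu>) * (\<mu> h * \<mu> h))"
    by (intro sum.cong refl trace_on_weight_space[OF endo_lie_lie])
      (use assms in \<open>auto simp: weight_space_invariant weights_hfun weight_space_def intro!: sq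
        gen_eigenspace_ad_invariant\<close>)
  finally show ?thesis by (simp add: mult.assoc)
qed

text \<open>Polarization of the quadratic case.\<close>

lemma killing_on_H:
  assumes "h \<in> H" "k \<in> H"
  shows "killing h k = (\<Sum>\<mu>\<in>weights. of_nat (weight_mult \<mu>) * \<mu> h * \<mu> k)"
proof -
  have "2 * killing h k = killing (h + k) (h + k) - killing h h - killing k k"
    by (simp add: killing_add_left killing_add_right killing_commute[of k h])
  also have "\<dots> = (\<Sum>\<mu>\<in>weights. of_nat (weight_mult \<mu>) * (2 * (\<mu> h * \<mu> k)))"
    using assms H_subspace
    by (simp add: killing_square lie_vs.subspace_add flip: sum_subtractf)
      (intro sum.cong refl, simp add: weight_add assms algebra_simps)
  also have "\<dots> = 2 * (\<Sum>\<mu>\<in>weights. of_nat (weight_mult \<mu>) * \<mu> h * \<mu> k)"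
    by (simp add: sum_distrib_left algebra_simps)
  finally show ?thesis by simp
qed

text \<open>The composite of \<open>lie x\<close> and \<open>lie y\<close> moves every weight by \<open>\<mu> + \<nu>\<close>.\<close>

lemma killing_orthogonal:
  assumes "x \<in> weight_space \<mu>" "y \<in> weight_space \<nu>" "\<mu> \<in> hfun" "\<nu> \<in> hfun" "\<mu> + \<nu> \<noteq> 0"
  shows "killing x y = 0"
  unfolding killing_def
proof (rule trace_shifting[OF endo_lie_lie])
  show "lie x (lie y z) \<in> weight_space (\<kappa> + (\<mu> + \<nu>))" if "z \<in> weight_space \<kappa>" for \<kappa> z
    using weight_space_lie[OF assms(1) weight_space_lie[OF assms(2) that]] by (simp add: ac_simps)
qed (use assms hfun_add in auto)

text \<open>The elements of \<open>H\<close> act nilpotently on \<open>weight_space 0\<close>. If this space were larger than \<open>H\<close>,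
  Engel's theorem would give a vector outside \<open>H\<close> that \<open>H\<close> maps into \<open>H\<close>, an element of the
  normalizer.\<close>

lemma weight_space_zero: "weight_space 0 = H"
proof
  show "H \<subseteq> weight_space 0" by (auto simp: weight_space_def H_nilpotent)
  show "weight_space 0 \<subseteq> H"
  proof (rule ccontr)
    assume "\<not> weight_space 0 \<subseteq> H"
    then have "H \<subset> weight_space 0" using \<open>H \<subseteq> weight_space 0\<close> by blast
    have span: "lie_vs.span H = H" using H_subspace lie_vs.span_eq_iff by blast
    have nil: "\<exists>n. (lie h ^^ n) x = 0" if "h \<in> H" "x \<in> weight_space 0" for h x
      using that by (auto simp: weight_space_def gen_eigenspace_def)
    have "\<exists>v \<in> weight_space 0 - H. \<forall>h \<in> H. lie h v \<in> H"
    proof (rule engel_weakly_closed[OF H_lie _ weight_space_subspace H_subspace \<open>H \<subset> _\<close>])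
      show "\<exists>n. (lie h ^^ n) x = 0" if "h \<in> H" "x \<in> lie_vs.span H" for h x
        using nil that span \<open>H \<subseteq> _\<close> by blast
      show "\<exists>n. (lie h ^^ n) x \<in> H" if "h \<in> H" "x \<in> weight_space 0" for h x
        using nil[OF that] lie_vs.subspace_0[OF H_subspace] by metis
    qed (auto simp: weight_space_invariant H_lie)
    then obtain v where v: "v \<notin> H" "\<And>h. h \<in> H \<Longrightarrow> lie h v \<in> H" by blast
    have "lie v h \<in> H" if "h \<in> H" for h
      using v(2)[OF that] lie_vs.subspace_neg[OF H_subspace] lie_skew[of v h] by simp
    then show False using H_self_normalizing v(1) by blast
  qed
qed

lemma lie_opposite: "x \<in> weight_space \<alpha> \<Longrightarrow> y \<in> weight_space (- \<alpha>) \<Longrightarrow> lie x y \<in> H"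
  using weight_space_lie[of x \<alpha> y "- \<alpha>"] by (simp add: weight_space_zero)

text \<open>The sum of the weight spaces for the weights \<open>\<beta> + n \<alpha>\<close> is invariant under \<open>x\<close> and \<open>y\<close>,
  so their commutator has trace zero on it.\<close>

lemma weight_ratio_real:
  assumes \<alpha>: "\<alpha> \<in> hfun" and x: "x \<in> weight_space \<alpha>" and y: "y \<in> weight_space (- \<alpha>)"
    and \<beta>: "\<beta> \<in> weights"
  shows "\<exists>q::real. \<beta> (lie x y) = of_real q * \<alpha> (lie x y)"
proof -
  let ?k = "lie x y"
  define S where "S = {\<gamma>. \<exists>n::int. \<gamma> = \<beta> + of_int n *\<^sub>F \<alpha>}"
  let ?P = "weight_proj S"
  have S1: "\<mu> + \<alpha> \<in> S \<longleftrightarrow> \<mu> \<in> S" for \<mu>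
  proof
    assume "\<mu> + \<alpha> \<in> S"
    then obtain n :: int where "\<mu> + \<alpha> = \<beta> + of_int n *\<^sub>F \<alpha>" by (auto simp: S_def)
    then have "\<mu> = \<beta> + of_int (n - 1) *\<^sub>F \<alpha>"
      by (simp add: dual_vs.scale_left_diff_distrib algebra_simps)
    then show "\<mu> \<in> S" unfolding S_def by blast
  next
    assume "\<mu> \<in> S"
    then obtain n :: int where "\<mu> = \<beta> + of_int n *\<^sub>F \<alpha>" by (auto simp: S_def)
    then have "\<mu> + \<alpha> = \<beta> + of_int (n + 1) *\<^sub>F \<alpha>"
      by (simp add: dual_vs.scale_left_distrib algebra_simps)
    then show "\<mu> + \<alpha> \<in> S" unfolding S_def by blast
  qed
  have S2: "\<mu> + (- \<alpha>) \<in> S \<longleftrightarrow> \<mu> \<in> S" for \<mu>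
    using S1[of "\<mu> + (- \<alpha>)"] by simp
  have Px: "?P (lie x z) = lie x (?P z)" for z
    by (rule weight_proj_commute[OF endo_lie _ \<alpha> S1])
      (use weight_space_lie[OF x] in \<open>simp add: add.commute\<close>)
  have Py: "?P (lie y z) = lie y (?P z)" for z
    by (rule weight_proj_commute[OF endo_lie _ hfun_uminus[OF \<alpha>] S2])
      (use weight_space_lie[OF y] in \<open>simp add: add.commute\<close>)
  have "endo_trace (\<lambda>z. lie ?k (?P z))
      = endo_trace (\<lambda>z. lie x (?P (lie y z)) - ?P (lie y (lie x z)))"
    by (simp add: lie_lie_left Px Py)
  also have "\<dots> = endo_trace (\<lambda>z. lie x (?P (lie y z))) - endo_trace (\<lambda>z. ?P (lie y (lie x z)))"
    by (rule endo_trace_diff[OF endo_compose[OF endo_lie endo_compose[OF endo_weight_proj endo_lie]]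
          endo_compose[OF endo_weight_proj endo_lie_lie]])
  also have "endo_trace (\<lambda>z. ?P (lie y (lie x z))) = endo_trace (\<lambda>z. lie x (?P (lie y z)))"
    by (rule endo_trace_commute[OF endo_compose[OF endo_weight_proj endo_lie] endo_lie])
  finally have tr0: "endo_trace (\<lambda>z. lie ?k (?P z)) = 0" by simp
  have k: "?k \<in> H" using lie_opposite[OF x y] .
  \<comment> \<open>The same trace, weight by weight: a weight \<open>\<beta> + n \<alpha>\<close> contributes its multiplicity times
    \<open>\<beta> k + n \<alpha> k\<close>.\<close>
  have "\<forall>\<gamma>\<in>S. \<exists>n::int. \<gamma> = \<beta> + of_int n *\<^sub>F \<alpha>" by (simp add: S_def)
  from bchoice[OF this] obtain n :: "('g \<Rightarrow> complex) \<Rightarrow> int"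
    where n: "\<forall>\<gamma>\<in>S. \<gamma> = \<beta> + of_int (n \<gamma>) *\<^sub>F \<alpha>" by blast
  define M where "M = (\<Sum>\<gamma>\<in>weights \<inter> S. weight_mult \<gamma>)"
  define N where "N = (\<Sum>\<gamma>\<in>weights \<inter> S. int (weight_mult \<gamma>) * n \<gamma>)"
  have "\<beta> = \<beta> + of_int 0 *\<^sub>F \<alpha>" by simp
  then have "\<beta> \<in> weights \<inter> S" using \<beta> unfolding S_def by blast
  then have "weight_mult \<beta> \<le> M" unfolding M_def by (intro member_le_sum) (auto simp: finite_weights)
  then have M: "M > 0" using weight_mult_pos[OF \<beta>] by simp
  have "0 = (\<Sum>\<gamma>\<in>weights \<inter> S. of_nat (weight_mult \<gamma>) * \<gamma> ?k)"
    using tr0 trace_weight_sum[OF endo_lie, of ?k S] k by (simp add: trace_ad_on_weight_space weights_hfun)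
  also have "\<dots> = (\<Sum>\<gamma>\<in>weights \<inter> S. of_nat (weight_mult \<gamma>) * (\<beta> ?k + of_int (n \<gamma>) * \<alpha> ?k))"
  proof (intro sum.cong refl arg_cong2[of _ _ _ _ "(*)"])
    fix \<gamma> assume "\<gamma> \<in> weights \<inter> S"
    then have "\<gamma> ?k = (\<beta> + of_int (n \<gamma>) *\<^sub>F \<alpha>) ?k" using n by (metis IntD2)
    then show "\<gamma> ?k = \<beta> ?k + of_int (n \<gamma>) * \<alpha> ?k" by (simp add: scaleF_def)
  qed
  also have "\<dots> = of_nat M * \<beta> ?k + of_int N * \<alpha> ?k"
    by (simp add: M_def N_def sum_distrib_right sum.distrib distrib_left mult.assoc)
  finally have "of_nat M * \<beta> ?k = - of_int N * \<alpha> ?k" by (simp add: eq_neg_iff_add_eq_0)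
  then have "\<beta> ?k = of_real (- of_int N / of_nat M) * \<alpha> ?k"
    using M by (simp add: field_simps)
  then show ?thesis by blast
qed

end

section \<open>Nondegeneracy of the Killing form\<close>

locale semisimple_cartan = cartan_lie basis0 H
  for basis0 :: "'g::complex_lie_algebra set" and H :: "'g set" +
  assumes semisimple: "semisimple_lie (UNIV :: 'g set)"

context cartan_lie
begin

lemma locally_nilpotent_on_wbasis:
  assumes "endo f" "\<And>b. b \<in> wbasis \<Longrightarrow> \<exists>n. (f ^^ n) b = 0"
  shows "\<exists>n. (f ^^ n) x = 0"
proof -
  have "lie_vs.span wbasis \<subseteq> {x. \<exists>n. (f ^^ n) x = 0}"
    using assms by (intro lie_vs.span_minimal subspace_pow_vanishes) auto
  then show ?thesis using wbasis_span by auto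
qed

lemma weight_space_pow:
  assumes "x \<in> weight_space \<alpha>" "z \<in> weight_space \<mu>"
  shows "(lie x ^^ n) z \<in> weight_space (\<mu> + of_nat n *\<^sub>F \<alpha>)"
proof (induction n)
  case (Suc n)
  have "lie x ((lie x ^^ n) z) \<in> weight_space (\<alpha> + (\<mu> + of_nat n *\<^sub>F \<alpha>))"
    by (rule weight_space_lie[OF assms(1) Suc])
  moreover have "\<alpha> + (\<mu> + of_nat n *\<^sub>F \<alpha>) = \<mu> + of_nat (Suc n) *\<^sub>F \<alpha>"
    by (simp add: scaleF_def fun_eq_iff algebra_simps)
  ultimately show ?case by (simp only: funpow.simps o_apply)
qed (simp add: assms)

text \<open>Repeated application of \<open>lie x\<close> runs through the distinct functionals \<open>\<mu> + n \<alpha>\<close>, of which only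
  finitely many are weights.\<close>

lemma weight_vector_ad_nilpotent:
  assumes x: "x \<in> weight_space \<alpha>" and \<alpha>: "\<alpha> \<in> hfun" "\<alpha> \<noteq> 0"
  shows "\<exists>n. (lie x ^^ n) z = 0"
proof (rule locally_nilpotent_on_wbasis[OF endo_lie])
  fix b assume b: "b \<in> wbasis"
  let ?w = "\<lambda>n::nat. wt b + of_nat n *\<^sub>F \<alpha>"
  obtain y where y: "\<alpha> y \<noteq> 0" using \<alpha>(2) by (auto simp: fun_eq_iff)
  have "inj ?w"
  proof (rule injI)
    fix m n assume "?w m = ?w n"
    then have "?w m y = ?w n y" by (rule arg_cong)
    then show "m = n" using y by (simp add: scaleF_def)
  qed
  then have "\<not> range ?w \<subseteq> weights"
    using finite_weights finite_subset range_inj_infinite by blast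
  then obtain n where n: "?w n \<notin> weights" by blast
  have "?w n \<in> hfun" by (intro hfun_add hfun_scale wt_hfun b \<alpha>)
  then have "weight_space (?w n) = {0}" using n weights_iff by blast
  then show "\<exists>n. (lie x ^^ n) b = 0"
    using weight_space_pow[OF x wt_weight_space[OF b], of n] by blast
qed

lemma null_ad_nilpotent:
  assumes "h \<in> H" "\<And>\<beta>. \<beta> \<in> weights \<Longrightarrow> \<beta> h = 0"
  shows "\<exists>n. (lie h ^^ n) z = 0"
proof (rule locally_nilpotent_on_wbasis[OF endo_lie])
  fix b assume b: "b \<in> wbasis"
  then have "wt b h = 0" using assms(2) by (simp add: weights_def)
  then have "b \<in> gen_eigenspace (lie h) 0"
    using wt_weight_space[OF b] assms(1) unfolding weight_space_def by (metis (mono_tags) mem_Collect_eq)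
  then show "\<exists>n. (lie h ^^ n) b = 0" by (simp add: gen_eigenspace_def)
qed

lemma null_subspace: "lie_vs.subspace {h \<in> H. \<forall>\<beta>\<in>weights. \<beta> h = 0}"
proof (rule lie_vs.subspaceI)
  have "\<beta> 0 = 0" if "\<beta> \<in> weights" for \<beta>
    using weight_scale[OF that lie_vs.subspace_0[OF H_subspace], of 0] by simp
  then show "0 \<in> {h \<in> H. \<forall>\<beta>\<in>weights. \<beta> h = 0}" using lie_vs.subspace_0[OF H_subspace] by auto
  show "x + y \<in> {h \<in> H. \<forall>\<beta>\<in>weights. \<beta> h = 0}"
    if "x \<in> {h \<in> H. \<forall>\<beta>\<in>weights. \<beta> h = 0}" "y \<in> {h \<in> H. \<forall>\<beta>\<in>weights. \<beta> h = 0}" for x y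
    using that lie_vs.subspace_add[OF H_subspace] by (auto simp: weight_add)
  show "c *\<^sub>C x \<in> {h \<in> H. \<forall>\<beta>\<in>weights. \<beta> h = 0}"
    if "x \<in> {h \<in> H. \<forall>\<beta>\<in>weights. \<beta> h = 0}" for c x
    using that lie_vs.subspace_scale[OF H_subspace] by (auto simp: weight_scale)
qed

text \<open>All weights are real multiples of \<open>\<alpha>\<close> at \<open>k = lie x y\<close>, so \<open>killing k k = 0\<close> makes a sum of
  squares vanish.\<close>

lemma isotropic_commutator_null:
  assumes \<alpha>: "\<alpha> \<in> hfun" and x: "x \<in> weight_space \<alpha>" and y: "y \<in> weight_space (- \<alpha>)"
    and iso: "killing (lie x y) (lie x y) = 0" and \<beta>: "\<beta> \<in> weights"
  shows "\<beta> (lie x y) = 0"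
proof (rule ccontr)
  let ?k = "lie x y"
  assume nz: "\<beta> ?k \<noteq> 0"
  have k: "?k \<in> H" by (rule lie_opposite[OF x y])
  have "\<forall>\<gamma>\<in>weights. \<exists>q::real. \<gamma> ?k = of_real q * \<alpha> ?k"
    using weight_ratio_real[OF \<alpha> x y] by blast
  from bchoice[OF this] obtain q :: "('g \<Rightarrow> complex) \<Rightarrow> real"
    where q: "\<forall>\<gamma>\<in>weights. \<gamma> ?k = of_real (q \<gamma>) * \<alpha> ?k" by blast
  have \<alpha>k: "\<alpha> ?k \<noteq> 0" and q\<beta>: "q \<beta> \<noteq> 0" using q \<beta> nz by auto
  define S where "S = (\<Sum>\<gamma>\<in>weights. weight_mult \<gamma> * (q \<gamma>)\<^sup>2)"
  have "0 = (\<Sum>\<gamma>\<in>weights. of_nat (weight_mult \<gamma>) * \<gamma> ?k * \<gamma> ?k)"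
    using iso killing_square[OF k] by simp
  also have "\<dots> = (\<Sum>\<gamma>\<in>weights. of_real (weight_mult \<gamma> * (q \<gamma>)\<^sup>2) * (\<alpha> ?k)\<^sup>2)"
  proof (intro sum.cong refl)
    fix \<gamma> assume "\<gamma> \<in> weights"
    then have "\<gamma> ?k = of_real (q \<gamma>) * \<alpha> ?k" using q by blast
    then show "of_nat (weight_mult \<gamma>) * \<gamma> ?k * \<gamma> ?k
        = of_real (weight_mult \<gamma> * (q \<gamma>)\<^sup>2) * (\<alpha> ?k)\<^sup>2"
      by (simp add: power2_eq_square)
  qed
  also have "\<dots> = of_real S * (\<alpha> ?k)\<^sup>2"
    by (simp add: S_def sum_distrib_right)
  finally have "S = 0" using \<alpha>k by simp
  then have "weight_mult \<beta> * (q \<beta>)\<^sup>2 = 0"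
    using \<beta> unfolding S_def by (subst (asm) sum_nonneg_eq_0_iff) (auto simp: finite_weights)
  then show False using q\<beta> weight_mult_pos[OF \<beta>] by simp
qed

lemma ideal_span_weight_vectors:
  assumes "lie_ideal J UNIV"
  shows "J \<subseteq> lie_vs.span (\<Union>\<mu>\<in>hfun. J \<inter> weight_space \<mu>)"
  using assms by (intro weight_decomposition) (auto simp: lie_ideal_def)

end

context semisimple_cartan
begin

lemma abelian_ideal_zero:
  assumes J: "lie_ideal J (UNIV :: 'g set)" and ab: "\<And>x y. x \<in> J \<Longrightarrow> y \<in> J \<Longrightarrow> lie x y = 0"
  shows "J = {0}"
proof -
  have "{lie x y | x y. x \<in> J \<and> y \<in> J} \<subseteq> {0}" using ab by auto
  then have "lie_vs.span {lie x y | x y. x \<in> J \<and> y \<in> J} \<subseteq> {0}"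
    by (rule lie_vs.span_minimal) (simp add: lie_vs.subspace_single_0)
  moreover have "0 \<in> lie_vs.span {lie x y | x y. x \<in> J \<and> y \<in> J}" by (rule lie_vs.span_zero)
  ultimately have "derived_series J 1 = {0}" by (auto simp: commutator_space_def)
  then show ?thesis
    using semisimple J unfolding semisimple_lie_def solvable_lie_def by blast
qed

text \<open>Let \<open>R\<close> be the radical of the form and \<open>D = [R, R]\<close>. All weights vanish on \<open>D \<inter> H\<close>, so every
  weight vector in \<open>D\<close> acts nilpotently and Engel's theorem gives \<open>D\<close> a nonzero center unless
  \<open>D = 0\<close>. That center is an abelian ideal, hence \<open>D = 0\<close>, and then \<open>R\<close> itself is one.\<close>

theorem killing_nondegenerate:
  fixes x :: 'g
  assumes "\<And>y. killing x y = 0"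
  shows "x = 0"
proof -
  define R where "R = {x::'g. \<forall>y. killing x y = 0}"
  define D where "D = commutator_space R R"
  have R_sub: "lie_vs.subspace R"
    by (rule lie_vs.subspaceI)
      (auto simp: R_def killing_add_left killing_scale_left killing_zero_left)
  have R_ideal: "lie z r \<in> R" "lie r z \<in> R" if "r \<in> R" for r z
  proof -
    show "lie r z \<in> R" using that by (simp add: R_def killing_lie)
    then show "lie z r \<in> R" using lie_vs.subspace_neg[OF R_sub] lie_skew[of z r] by simp
  qed
  have D_sub: "lie_vs.subspace D" by (simp add: D_def commutator_space_def lie_vs.subspace_span)
  have DR: "D \<subseteq> R"
    unfolding D_def commutator_space_def using R_ideal R_sub by (intro lie_vs.span_minimal) auto
  have RR: "lie r s \<in> D" if "r \<in> R" "s \<in> R" for r s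
    unfolding D_def commutator_space_def using that by (intro lie_vs.span_base) auto
  have D_ideal: "lie z d \<in> D" if "d \<in> D" for z d
  proof (rule endo_span_subset[OF endo_lie D_sub])
    show "d \<in> lie_vs.span {lie x y | x y. x \<in> R \<and> y \<in> R}"
      using that by (simp add: D_def commutator_space_def)
    fix u assume "u \<in> {lie x y | x y. x \<in> R \<and> y \<in> R}"
    then obtain r s where rs: "r \<in> R" "s \<in> R" "u = lie r s" by blast
    have "lie (lie z r) s + lie r (lie z s) \<in> D"
      using rs by (intro lie_vs.subspace_add[OF D_sub] RR R_ideal)
    then show "lie z u \<in> D" by (simp add: rs lie_leibniz[of z])
  qed
  have RI: "lie_ideal R UNIV" using R_sub R_ideal by (simp add: lie_ideal_def)
  have DI: "lie_ideal D UNIV" using D_sub D_ideal by (simp add: lie_ideal_def)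

  \<comment> \<open>The zero weight component of an element of \<open>D\<close> is a sum of brackets of weight vectors of \<open>R\<close>
    with opposite weights.\<close>
  let ?N = "{h \<in> H. \<forall>\<beta>\<in>weights. \<beta> h = 0}"
  let ?P = "weight_proj {0}"
  have hom: "?P (lie r s) \<in> ?N"
    if "r \<in> R \<inter> weight_space \<mu>" "s \<in> R \<inter> weight_space \<nu>" "\<mu> \<in> hfun" "\<nu> \<in> hfun" for r s \<mu> \<nu>
  proof (cases "\<mu> + \<nu> = 0")
    case True
    then have \<nu>: "\<nu> = - \<mu>" by (simp add: eq_neg_iff_add_eq_0 add.commute)
    have k: "lie r s \<in> H" using lie_opposite[of r \<mu> s] that \<nu> by auto
    have "?P (lie r s) = lie r s"
      using weight_proj_eq[OF hfun_zero, of "lie r s" "{0}"] k weight_space_zero by simp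
    moreover have "killing (lie r s) (lie r s) = 0" using that R_ideal by (auto simp: R_def)
    then have "\<beta> (lie r s) = 0" if "\<beta> \<in> weights" for \<beta>
      using isotropic_commutator_null[of \<mu> r s] that \<nu> \<open>r \<in> _\<close> \<open>s \<in> _\<close> \<open>\<mu> \<in> hfun\<close> by auto
    ultimately show ?thesis using k by simp
  next
    case False
    have "lie r s \<in> weight_space (\<mu> + \<nu>)" using that weight_space_lie by auto
    then have "?P (lie r s) = 0"
      using weight_proj_eq[OF hfun_add[OF that(3,4)], of "lie r s" "{0}"] False by simp
    then show ?thesis using lie_vs.subspace_0[OF null_subspace] by simp
  qed
  have PRR: "?P (lie r s) \<in> ?N" if "r \<in> R" "s \<in> R" for r s
  proof (rule endo_span_subset[OF endo_compose[OF endo_weight_proj endo_lie_left] null_subspace])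
    show "r \<in> lie_vs.span (\<Union>\<mu>\<in>hfun. R \<inter> weight_space \<mu>)"
      using ideal_span_weight_vectors[OF RI] that(1) by blast
    fix r' assume "r' \<in> (\<Union>\<mu>\<in>hfun. R \<inter> weight_space \<mu>)"
    then obtain \<mu> where r': "r' \<in> R \<inter> weight_space \<mu>" "\<mu> \<in> hfun" by blast
    show "?P (lie r' s) \<in> ?N"
    proof (rule endo_span_subset[OF endo_compose[OF endo_weight_proj endo_lie] null_subspace])
      show "s \<in> lie_vs.span (\<Union>\<mu>\<in>hfun. R \<inter> weight_space \<mu>)"
        using ideal_span_weight_vectors[OF RI] that(2) by blast
      fix s' assume "s' \<in> (\<Union>\<mu>\<in>hfun. R \<inter> weight_space \<mu>)"
      then obtain \<nu> where "s' \<in> R \<inter> weight_space \<nu>" "\<nu> \<in> hfun" by blast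
      then show "?P (lie r' s') \<in> ?N" using hom r' by blast
    qed
  qed
  have null: "\<beta> h = 0" if "h \<in> D" "h \<in> H" "\<beta> \<in> weights" for h \<beta>
  proof -
    have "?P h \<in> ?N"
      by (rule endo_span_subset[OF endo_weight_proj null_subspace, of "{lie x y | x y. x \<in> R \<and> y \<in> R}"])
        (use PRR that(1) in \<open>auto simp: D_def commutator_space_def\<close>)
    moreover have "?P h = h"
      using weight_proj_eq[OF hfun_zero, of h "{0}"] that weight_space_zero by simp
    ultimately show ?thesis using that(3) by simp
  qed

  define W where "W = (\<Union>\<mu>\<in>hfun. D \<inter> weight_space \<mu>)"
  have nilW: "\<exists>n. (lie w ^^ n) z = 0" if "w \<in> W" for w z
  proof -
    obtain \<mu> where w: "\<mu> \<in> hfun" "w \<in> D" "w \<in> weight_space \<mu>" using \<open>w \<in> W\<close> unfolding W_def by blast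
    show ?thesis
    proof (cases "\<mu> = 0")
      case True
      then show ?thesis using null_ad_nilpotent null w weight_space_zero by auto
    next
      case False
      then show ?thesis using weight_vector_ad_nilpotent w by auto
    qed
  qed
  have "D = {0}"
  proof (rule ccontr)
    assume "D \<noteq> {0}"
    then have D0: "{0} \<subset> D" using lie_vs.subspace_0[OF D_sub] by blast
    have W_lie: "lie u w \<in> W" if "u \<in> W" "w \<in> W" for u w
    proof -
      obtain \<mu> \<nu> where "\<mu> \<in> hfun" "u \<in> D \<inter> weight_space \<mu>" "\<nu> \<in> hfun" "w \<in> D \<inter> weight_space \<nu>"
        using \<open>u \<in> W\<close> \<open>w \<in> W\<close> unfolding W_def by blast
      then have "lie u w \<in> D \<inter> weight_space (\<mu> + \<nu>)" "\<mu> + \<nu> \<in> hfun"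
        using D_ideal weight_space_lie hfun_add by auto
      then show ?thesis unfolding W_def by blast
    qed
    have "\<exists>v \<in> D - {0}. \<forall>w \<in> W. lie w v \<in> {0}"
      by (rule engel_weakly_closed[OF W_lie nilW D_sub _ D0])
        (auto simp: D_ideal lie_simps nilW lie_vs.subspace_single_0)
    then obtain v where v: "v \<in> D" "v \<noteq> 0" "\<And>w. w \<in> W \<Longrightarrow> lie w v = 0" by auto
    have vD: "lie d v = 0" if "d \<in> D" for d
      using endo_span_subset[OF endo_lie_left lie_vs.subspace_single_0, of W v d] v(3)
        ideal_span_weight_vectors[OF DI] that unfolding W_def by auto
    define Z where "Z = {z \<in> D. \<forall>d\<in>D. lie d z = 0}"
    have "lie_vs.subspace Z"
      using D_sub by (auto simp: Z_def lie_vs.subspace_def lie_simps)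
    moreover have "lie g z \<in> Z" if "z \<in> Z" for g z
    proof -
      have "lie d (lie g z) = 0" if "d \<in> D" for d
      proof -
        have "lie d g \<in> D"
          using D_ideal[OF that, of g] lie_vs.subspace_neg[OF D_sub] lie_skew[of d g] by simp
        then show ?thesis
          using \<open>z \<in> Z\<close> that by (simp add: lie_leibniz[of d g z] Z_def lie_simps)
      qed
      then show ?thesis using that D_ideal by (auto simp: Z_def)
    qed
    ultimately have "lie_ideal Z UNIV" by (simp add: lie_ideal_def)
    then have "Z = {0}" by (rule abelian_ideal_zero) (simp add: Z_def)
    moreover have "v \<in> Z" using v(1) vD by (simp add: Z_def)
    ultimately show False using v(2) by blast
  qed
  then have "R = {0}" using RR by (intro abelian_ideal_zero[OF RI]) auto
  moreover have "x \<in> R" using assms by (simp add: R_def)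
  ultimately show ?thesis by blast
qed

text \<open>Weight spaces are orthogonal unless their weights are opposite, so a vector orthogonal to the
  opposite weight space is orthogonal to everything.\<close>

lemma exists_killing_partner:
  assumes "x \<in> weight_space \<alpha>" "\<alpha> \<in> hfun" "x \<noteq> 0"
  shows "\<exists>y \<in> weight_space (- \<alpha>). killing x y \<noteq> 0"
proof (rule ccontr)
  assume no: "\<not> ?thesis"
  have "killing x y = 0" for y
  proof -
    have "killing x (weight_proj {\<mu>} y) = 0" if "\<mu> \<in> weights" for \<mu>
    proof (cases "\<alpha> + \<mu> = 0")
      case True
      then have "\<mu> = - \<alpha>" by (simp add: eq_neg_iff_add_eq_0 add.commute)
      then show ?thesis using no weight_proj_in by blast
    next
      case False
      then show ?thesis
        using killing_orthogonal[OF assms(1) weight_proj_in assms(2) weights_hfun[OF that]] by simp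
    qed
    then have "(\<Sum>\<mu>\<in>weights. killing x (weight_proj {\<mu>} y)) = 0" by simp
    then show ?thesis by (simp add: sum_weights flip: killing_sum_right)
  qed
  then show False using killing_nondegenerate assms(3) by blast
qed

lemma killing_nondegenerate_on_H:
  assumes "t \<in> H" "\<And>h. h \<in> H \<Longrightarrow> killing t h = 0"
  shows "t = 0"
  using exists_killing_partner[of t 0] assms weight_space_zero hfun_zero by auto

lemma weights_separate:
  assumes "h \<in> H" "\<And>\<beta>. \<beta> \<in> weights \<Longrightarrow> \<beta> h = 0"
  shows "h = 0"
  by (rule killing_nondegenerate_on_H[OF assms(1)]) (simp add: killing_on_H assms)

section \<open>The form on the dual and the root decomposition\<close>

lemma killing_vector:
  assumes "\<nu> \<in> dual H"
  shows "killing_vector H \<nu> \<in> H" "\<And>x. x \<in> H \<Longrightarrow> killing (killing_vector H \<nu>) x = \<nu> x"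
proof -
  have "\<exists>s\<in>H. \<forall>x\<in>H. killing s x = \<nu> x"
    by (rule killing_represents_functional[OF H_subspace])
      (use killing_nondegenerate_on_H assms in \<open>auto simp: dual_def\<close>)
  then obtain s where s: "s \<in> H" "\<And>x. x \<in> H \<Longrightarrow> killing s x = \<nu> x" by blast
  have "\<exists>!t. t \<in> H \<and> (\<forall>x\<in>H. killing t x = \<nu> x)"
  proof (rule ex1I[of _ s])
    fix t assume t: "t \<in> H \<and> (\<forall>x\<in>H. killing t x = \<nu> x)"
    then have "t - s = 0"
      using s by (intro killing_nondegenerate_on_H)
        (auto simp: killing_diff_left lie_vs.subspace_diff[OF H_subspace])
    then show "t = s" by simp
  qed (use s in blast)
  from theI'[OF this] show "killing_vector H \<nu> \<in> H"
    "\<And>x. x \<in> H \<Longrightarrow> killing (killing_vector H \<nu>) x = \<nu> x"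
    by (auto simp: killing_vector_def)
qed

lemma dual_form_eval: "\<mu> \<in> dual H \<Longrightarrow> \<nu> \<in> dual H \<Longrightarrow> dual_form H \<mu> \<nu> = \<mu> (killing_vector H \<nu>)"
  by (simp add: dual_form_def killing_vector)

lemma dual_form_commute: "dual_form H \<mu> \<nu> = dual_form H \<nu> \<mu>"
  by (simp add: dual_form_def killing_commute)

lemma dual_add: "\<mu> \<in> dual H \<Longrightarrow> \<nu> \<in> dual H \<Longrightarrow> \<mu> + \<nu> \<in> dual H"
  and dual_scale: "\<mu> \<in> dual H \<Longrightarrow> c *\<^sub>F \<mu> \<in> dual H"
  by (auto simp: dual_def scaleF_def algebra_simps)

lemma dual_form_add: "\<mu> \<in> dual H \<Longrightarrow> \<nu> \<in> dual H \<Longrightarrow> \<kappa> \<in> dual H \<Longrightarrow>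
    dual_form H (\<mu> + \<nu>) \<kappa> = dual_form H \<mu> \<kappa> + dual_form H \<nu> \<kappa>"
  by (simp add: dual_form_eval dual_add)

lemma dual_form_scale: "\<mu> \<in> dual H \<Longrightarrow> \<kappa> \<in> dual H \<Longrightarrow>
    dual_form H (c *\<^sub>F \<mu>) \<kappa> = c * dual_form H \<mu> \<kappa>"
  by (simp add: dual_form_eval dual_scale) (simp add: scaleF_def)

text \<open>The semisimple part of \<open>lie h\<close> multiplies each weight space by its weight. It is a derivation,
  and since the Killing form is nondegenerate it is inner, given by some \<open>s\<close>. This \<open>s\<close> commutes
  with \<open>H\<close> and agrees with \<open>h\<close> under all weights, so \<open>s = h\<close>.\<close>

lemma weight_space_eigen:
  assumes h: "h \<in> H" and \<mu>: "\<mu> \<in> hfun" and x: "x \<in> weight_space \<mu>"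
  shows "lie h x = \<mu> h *\<^sub>C x"
proof -
  define D where "D x = (\<Sum>\<mu>\<in>weights. \<mu> h *\<^sub>C weight_proj {\<mu>} x)" for x
  have D: "endo D"
    by (rule endoI) (simp_all add: D_def endo_simps[OF endo_weight_proj] lie_vs.scale_right_distrib
        sum.distrib lie_vs.scale_sum_right mult.commute)
  have D_eq: "D x = \<mu> h *\<^sub>C x" if "\<mu> \<in> hfun" "x \<in> weight_space \<mu>" for \<mu> x
  proof (cases "\<mu> \<in> weights")
    case True
    have "D x = (\<Sum>\<nu>\<in>weights. if \<nu> = \<mu> then \<mu> h *\<^sub>C x else 0)"
      unfolding D_def by (intro sum.cong refl) (auto simp: weight_proj_eq[OF that])
    then show ?thesis using True by (simp add: finite_weights)
  next
    case False
    then have "x = 0" using that weights_iff by blast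
    then show ?thesis by (simp add: endo_zero[OF D])
  qed
  have der: "D (lie x y) = lie (D x) y + lie x (D y)" for x y
  proof (rule endo_eq_on_weight_vectors[of "\<lambda>x. D (lie x y)" "\<lambda>x. lie (D x) y + lie x (D y)" x])
    show "endo (\<lambda>x. D (lie x y))" by (rule endo_compose[OF D endo_lie_left])
    show "endo (\<lambda>x. lie (D x) y + lie x (D y))"
      by (rule endo_plus[OF endo_compose[OF endo_lie_left D] endo_lie_left])
    fix \<mu> x assume x: "\<mu> \<in> weights" "x \<in> weight_space \<mu>"
    show "D (lie x y) = lie (D x) y + lie x (D y)"
    proof (rule endo_eq_on_weight_vectors[of "\<lambda>y. D (lie x y)" "\<lambda>y. lie (D x) y + lie x (D y)" y])
      show "endo (\<lambda>y. D (lie x y))" by (rule endo_compose[OF D endo_lie])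
      show "endo (\<lambda>y. lie (D x) y + lie x (D y))"
        by (rule endo_plus[OF endo_lie endo_compose[OF endo_lie D]])
      fix \<nu> y assume y: "\<nu> \<in> weights" "y \<in> weight_space \<nu>"
      have "D (lie x y) = (\<mu> + \<nu>) h *\<^sub>C lie x y"
        by (rule D_eq[OF hfun_add[OF weights_hfun[OF x(1)] weights_hfun[OF y(1)]]
              weight_space_lie[OF x(2) y(2)]])
      then show "D (lie x y) = lie (D x) y + lie x (D y)"
        by (simp add: D_eq[OF weights_hfun[OF x(1)] x(2)] D_eq[OF weights_hfun[OF y(1)] y(2)]
            lie_simps lie_vs.scale_left_distrib)
    qed
  qed
  have "\<exists>s\<in>UNIV. \<forall>z\<in>UNIV. killing s z = endo_trace (\<lambda>x. D (lie z x))"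
  proof (rule killing_represents_functional)
    have lin: "endo (\<lambda>x. D (lie z x))" for z by (rule endo_compose[OF D endo_lie])
    show "endo_trace (\<lambda>z. D (lie (x + y) z)) = endo_trace (\<lambda>z. D (lie x z)) + endo_trace (\<lambda>z. D (lie y z))"
      for x y
      using endo_trace_add[OF lin lin] by (simp add: lie_add_left endo_add[OF D])
    show "endo_trace (\<lambda>z. D (lie (c *\<^sub>C x) z)) = c * endo_trace (\<lambda>z. D (lie x z))" for c x
      using endo_trace_scale[OF lin] by (simp add: lie_scaleC_left endo_scale[OF D])
  qed (auto intro: killing_nondegenerate simp: lie_vs.subspace_UNIV)
  then obtain s where s: "\<And>z. killing s z = endo_trace (\<lambda>x. D (lie z x))" by blast
  \<comment> \<open>\<open>E\<close> is again a derivation, and trace-orthogonal to all \<open>lie z\<close>; invariance of the trace then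
    makes \<open>E a\<close> orthogonal to everything.\<close>
  define E where "E x = D x - lie s x" for x
  have E: "endo E" unfolding E_def by (rule endo_minus[OF D endo_lie])
  have trE: "endo_trace (\<lambda>x. E (lie z x)) = 0" for z
    using endo_trace_diff[OF endo_compose[OF D endo_lie] endo_lie_lie, of z s z] s[of z]
    by (simp add: E_def killing_def)
  have derE: "lie (E a) x = E (lie a x) - lie a (E x)" for a x
    by (simp add: E_def der lie_leibniz[of s a x] lie_simps)
  have "killing (E a) b = 0" for a b
  proof -
    have "killing (E a) b = endo_trace (\<lambda>x. E (lie a (lie b x)) - lie a (E (lie b x)))"
      unfolding killing_def derE by simp
    also have "\<dots> = endo_trace (\<lambda>x. E (lie a (lie b x))) - endo_trace (\<lambda>x. lie a (E (lie b x)))"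
      by (rule endo_trace_diff[OF endo_compose[OF E endo_lie_lie]
            endo_compose[OF endo_lie endo_compose[OF E endo_lie]]])
    also have "endo_trace (\<lambda>x. lie a (E (lie b x))) = endo_trace (\<lambda>x. E (lie b (lie a x)))"
      by (rule endo_trace_commute[OF endo_lie endo_compose[OF E endo_lie]])
    also have "endo_trace (\<lambda>x. E (lie a (lie b x))) - \<dots> = endo_trace (\<lambda>x. E (lie a (lie b x)) - E (lie b (lie a x)))"
      by (rule endo_trace_diff[symmetric, OF endo_compose[OF E endo_lie_lie] endo_compose[OF E endo_lie_lie]])
    also have "\<dots> = endo_trace (\<lambda>x. E (lie (lie a b) x))"
      by (simp add: lie_lie_left endo_diff[OF E])
    finally show ?thesis by (simp add: trE)
  qed
  then have "E a = 0" for a using killing_nondegenerate by blast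
  then have Ds: "D a = lie s a" for a by (simp add: E_def)
  have "s \<in> H"
  proof (rule H_self_normalizing)
    fix k assume "k \<in> H"
    then have "D k = 0" using D_eq[OF hfun_zero, of k] by (simp add: weight_space_zero)
    then have "lie s k = 0" by (simp add: Ds)
    then show "lie s k \<in> H" using lie_vs.subspace_0[OF H_subspace] by simp
  qed
  have "\<beta> (s - h) = 0" if \<beta>: "\<beta> \<in> weights" for \<beta>
  proof -
    note \<beta>' = weights_hfun[OF \<beta>]
    obtain b where b: "b \<in> weight_space \<beta>" "b \<noteq> 0"
      using weights_iff[OF \<beta>'] \<beta> lie_vs.subspace_0[OF weight_space_subspace] by blast
    have "shift (lie s) (\<beta> h) b = 0" using D_eq[OF \<beta>' b(1)] by (simp add: shift_def Ds)
    then have "(shift (lie s) (\<beta> h) ^^ 1) b = 0" by simp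
    then have "b \<in> gen_eigenspace (lie s) (\<beta> h)" unfolding gen_eigenspace_def by blast
    moreover have "b \<in> gen_eigenspace (lie s) (\<beta> s)" using b(1) \<open>s \<in> H\<close> by (simp add: weight_space_def)
    ultimately have eq: "\<beta> s = \<beta> h" using gen_eigenspace_disjoint[OF endo_lie] b(2) by blast
    have "\<beta> (s - h + h) = \<beta> (s - h) + \<beta> h"
      using weight_dual[OF \<beta>] \<open>s \<in> H\<close> h lie_vs.subspace_diff[OF H_subspace] unfolding dual_def by blast
    then show ?thesis using eq by simp
  qed
  then have "s - h = 0" using weights_separate lie_vs.subspace_diff[OF H_subspace \<open>s \<in> H\<close> h] by blast
  then show ?thesis using D_eq[OF \<mu> x] Ds by simp
qed

lemma root_space_eq:
  assumes \<mu>: "\<mu> \<in> hfun"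
  shows "root_space H \<mu> = weight_space \<mu>"
proof
  show "root_space H \<mu> \<subseteq> weight_space \<mu>"
  proof
    fix x assume x: "x \<in> root_space H \<mu>"
    have "(shift (lie h) (\<mu> h) ^^ 1) x = 0" if "h \<in> H" for h
      using x that by (simp add: root_space_def shift_def)
    then show "x \<in> weight_space \<mu>" unfolding weight_space_def gen_eigenspace_def by blast
  qed
  show "weight_space \<mu> \<subseteq> root_space H \<mu>"
    unfolding root_space_def using weight_space_eigen[OF _ \<mu>] by blast
qed

lemma roots_eq: "roots H = weights - {0}"
proof -
  have "\<alpha> \<in> dual H \<Longrightarrow> \<alpha> \<in> hfun" for \<alpha> by (auto simp: dual_def hfun_def)
  then show ?thesis
    unfolding roots_def using weight_dual weights_iff root_space_eq weights_hfun by blast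
qed

lemma root_hfun: "\<alpha> \<in> roots H \<Longrightarrow> \<alpha> \<in> hfun"
  by (auto simp: roots_eq weights_hfun)

lemma root_dual: "\<alpha> \<in> roots H \<Longrightarrow> \<alpha> \<in> dual H"
  by (auto simp: roots_eq weight_dual)

section \<open>Root strings\<close>

lemma root_vector_commutator:
  assumes \<alpha>: "\<alpha> \<in> roots H" and e: "e \<in> weight_space \<alpha>" and f: "f \<in> weight_space (- \<alpha>)"
  shows "lie e f = killing e f *\<^sub>C killing_vector H \<alpha>"
proof -
  note t = killing_vector[OF root_dual[OF \<alpha>]]
  have "lie e f - killing e f *\<^sub>C killing_vector H \<alpha> = 0"
  proof (rule killing_nondegenerate_on_H)
    show "lie e f - killing e f *\<^sub>C killing_vector H \<alpha> \<in> H"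
      by (intro lie_vs.subspace_diff[OF H_subspace] lie_vs.subspace_scale[OF H_subspace] t
          lie_opposite[OF e f])
    fix k assume k: "k \<in> H"
    have "lie f k = - lie k f" by (rule lie_skew)
    also have "\<dots> = \<alpha> k *\<^sub>C f"
      using weight_space_eigen[OF k hfun_uminus[OF root_hfun[OF \<alpha>]] f] by simp
    finally show "killing (lie e f - killing e f *\<^sub>C killing_vector H \<alpha>) k = 0"
      by (simp add: killing_diff_left killing_lie killing_scale_right killing_scale_left t k)
  qed
  then show ?thesis by simp
qed

text \<open>If \<open>\<alpha>\<close> were isotropic, all weights would vanish on its Killing vector, since they are multiples
  of \<open>\<alpha>\<close> there.\<close>

lemma root_form_nonzero:
  assumes \<alpha>: "\<alpha> \<in> roots H"
  shows "dual_form H \<alpha> \<alpha> \<noteq> 0"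
proof
  assume iso: "dual_form H \<alpha> \<alpha> = 0"
  let ?t = "killing_vector H \<alpha>"
  note t = killing_vector[OF root_dual[OF \<alpha>]]
  obtain e where e: "e \<in> weight_space \<alpha>" "e \<noteq> 0"
    using \<alpha> weights_iff[OF root_hfun[OF \<alpha>]] lie_vs.subspace_0[OF weight_space_subspace]
    by (auto simp: roots_eq)
  obtain f where f: "f \<in> weight_space (- \<alpha>)" "killing e f \<noteq> 0"
    using exists_killing_partner[OF e(1) root_hfun[OF \<alpha>] e(2)] by blast
  have k: "lie e f = killing e f *\<^sub>C ?t" by (rule root_vector_commutator[OF \<alpha> e(1) f(1)])
  have "\<alpha> ?t = 0" using iso root_dual[OF \<alpha>] by (simp add: dual_form_eval)
  have "\<beta> ?t = 0" if \<beta>: "\<beta> \<in> weights" for \<beta>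
  proof -
    have ev: "\<gamma> (lie e f) = killing e f * \<gamma> ?t" if "\<gamma> \<in> dual H" for \<gamma>
      using that t(1) by (simp add: k dual_def)
    obtain q :: real where "\<beta> (lie e f) = of_real q * \<alpha> (lie e f)"
      using weight_ratio_real[OF root_hfun[OF \<alpha>] e(1) f(1) \<beta>] by blast
    then have "killing e f * \<beta> ?t = 0"
      using ev[OF weight_dual[OF \<beta>]] ev[OF root_dual[OF \<alpha>]] \<open>\<alpha> ?t = 0\<close> by simp
    then show ?thesis using f(2) by simp
  qed
  then have "?t = 0" using weights_separate t(1) by blast
  have "\<alpha> x = 0" for x
  proof (cases "x \<in> H")
    case True
    then show ?thesis using t(2)[OF True] \<open>?t = 0\<close> by (simp add: killing_zero_left)
  qed (use root_dual[OF \<alpha>] in \<open>simp add: dual_def\<close>)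
  then show False using \<alpha> by (auto simp: roots_eq fun_eq_iff)
qed

end

text \<open>Climb from \<open>v\<close> with \<open>e\<close> to a highest weight vector \<open>w\<close>. If \<open>m\<close> is the last exponent with
  \<open>f\<^sup>m w \<noteq> 0\<close>, then \<open>0 = e f\<^sup>m\<^sup>+\<^sup>1 w\<close> forces the weight of \<open>w\<close> to be \<open>m\<close>.\<close>

lemma sl2_string:
  fixes e f h v :: "'g::complex_lie_algebra"
  assumes ef: "lie e f = h" and he: "lie h e = 2 *\<^sub>C e" and hf: "lie h f = (-2) *\<^sub>C f"
    and nil_e: "\<exists>n. (lie e ^^ n) v = 0" and nil_f: "\<And>z. \<exists>n. (lie f ^^ n) z = 0"
    and v: "v \<noteq> 0" "lie h v = c *\<^sub>C v"
  shows "\<exists>k m. c = of_nat m - 2 * of_nat k \<and> (\<forall>j\<le>m. (lie f ^^ j) ((lie e ^^ k) v) \<noteq> 0)"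
proof -
  have last: "\<exists>k. (g ^^ k) z \<noteq> 0 \<and> (g ^^ Suc k) z = 0"
    if ex: "\<exists>n. (g ^^ n) z = 0" and nz: "z \<noteq> 0" for g :: "'g \<Rightarrow> 'g" and z
  proof -
    define n where "n = (LEAST n. (g ^^ n) z = 0)"
    have n: "(g ^^ n) z = 0" unfolding n_def by (rule LeastI_ex[OF ex])
    then obtain k where k: "n = Suc k" using nz by (cases n) auto
    have "(g ^^ k) z \<noteq> 0" using not_less_Least[of k "\<lambda>n. (g ^^ n) z = 0"] k by (auto simp: n_def)
    then show ?thesis using n k by blast
  qed
  obtain k where k: "(lie e ^^ k) v \<noteq> 0" "(lie e ^^ Suc k) v = 0" using last[OF nil_e v(1)] by blast
  define w where "w = (lie e ^^ k) v"
  have "lie h ((lie e ^^ j) v) = (c + 2 * of_nat j) *\<^sub>C (lie e ^^ j) v" for j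
    by (induction j)
      (simp_all add: v(2) lie_leibniz[of h e] he lie_simps algebra_simps flip: lie_vs.scale_left_distrib)
  then have hw: "lie h w = (c + 2 * of_nat k) *\<^sub>C w" by (simp add: w_def)
  have w: "w \<noteq> 0" "lie e w = 0" using k by (simp_all add: w_def)
  obtain m where m: "(lie f ^^ m) w \<noteq> 0" "(lie f ^^ Suc m) w = 0" using last[OF nil_f w(1)] by blast
  let ?\<mu> = "c + 2 * of_nat k"
  have hfw: "lie h ((lie f ^^ j) w) = (?\<mu> - 2 * of_nat j) *\<^sub>C (lie f ^^ j) w" for j
  proof (induction j)
    case (Suc j)
    have "lie h ((lie f ^^ Suc j) w)
        = (-2) *\<^sub>C (lie f ^^ Suc j) w + lie f (lie h ((lie f ^^ j) w))"
      by (simp only: funpow.simps o_apply lie_leibniz[of h f] hf lie_scaleC_left)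
    also have "\<dots> = (-2) *\<^sub>C (lie f ^^ Suc j) w + (?\<mu> - 2 * of_nat j) *\<^sub>C (lie f ^^ Suc j) w"
      by (simp only: Suc lie_scaleC_right funpow.simps o_apply)
    also have "\<dots> = (?\<mu> - 2 * of_nat (Suc j)) *\<^sub>C (lie f ^^ Suc j) w"
      unfolding lie_vs.scale_left_distrib[symmetric] by (simp add: algebra_simps)
    finally show ?case .
  qed (simp add: hw)
  have efw: "lie e ((lie f ^^ Suc j) w) = (of_nat (Suc j) * (?\<mu> - of_nat j)) *\<^sub>C (lie f ^^ j) w" for j
  proof (induction j)
    case 0
    show ?case by (simp add: lie_leibniz[of e f] ef w(2) lie_simps hw)
  next
    case (Suc j)
    have "lie e ((lie f ^^ Suc (Suc j)) w)
        = lie h ((lie f ^^ Suc j) w) + lie f (lie e ((lie f ^^ Suc j) w))"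
      by (simp add: lie_leibniz[of e f] ef)
    also have "\<dots> = (?\<mu> - 2 * of_nat (Suc j)) *\<^sub>C (lie f ^^ Suc j) w
        + (of_nat (Suc j) * (?\<mu> - of_nat j)) *\<^sub>C (lie f ^^ Suc j) w"
      unfolding hfw Suc by (simp add: lie_simps)
    also have "\<dots> = (of_nat (Suc (Suc j)) * (?\<mu> - of_nat (Suc j))) *\<^sub>C (lie f ^^ Suc j) w"
      unfolding lie_vs.scale_left_distrib[symmetric] by (simp add: algebra_simps)
    finally show ?case .
  qed
  have "(of_nat (Suc m) * (?\<mu> - of_nat m)) *\<^sub>C (lie f ^^ m) w = 0"
    unfolding efw[symmetric] m(2) by (simp add: lie_simps)
  then have "?\<mu> = of_nat m" using m(1) by (simp del: of_nat_Suc)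
  then have "c = of_nat m - 2 * of_nat k" by (simp add: algebra_simps)
  moreover have "(lie f ^^ j) w \<noteq> 0" if "j \<le> m" for j
    using pow_vanishes_mono[OF endo_lie _ that] m(1) by blast
  ultimately show ?thesis unfolding w_def by blast
qed

context semisimple_cartan
begin

lemma coroot_eval:
  assumes "\<alpha> \<in> roots H" "\<beta> \<in> dual H"
  shows "dual_form H \<beta> (coroot H \<alpha>) = \<beta> ((2 / dual_form H \<alpha> \<alpha>) *\<^sub>C killing_vector H \<alpha>)"
proof -
  have "dual_form H \<beta> (coroot H \<alpha>) = 2 / dual_form H \<alpha> \<alpha> * dual_form H \<beta> \<alpha>"
    unfolding coroot_def using assms root_dual
    by (metis dual_form_commute dual_form_scale)
  also have "\<dots> = \<beta> ((2 / dual_form H \<alpha> \<alpha>) *\<^sub>C killing_vector H \<alpha>)"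
    using assms(2) killing_vector(1)[OF root_dual[OF assms(1)]]
    by (simp add: dual_form_eval[OF assms(2) root_dual[OF assms(1)]] dual_def)
  finally show ?thesis .
qed

text \<open>Complete \<open>\<alpha>\<close> to an sl2 triple and take \<open>v\<close> of weight \<open>\<beta>\<close>, so that \<open>lie h v = c v\<close>. If
  \<open>c = m - 2 k \<ge> - k\<close>, climbing \<open>k\<close> steps and descending \<open>m - k\<close> steps ends in a nonzero vector of
  weight \<open>\<beta> - c \<alpha>\<close>. Otherwise the triple \<open>(f, e, - h)\<close> does the same with \<open>- c\<close> for \<open>c\<close>.\<close>

theorem reflection_weight:
  assumes \<alpha>: "\<alpha> \<in> roots H" and \<beta>: "\<beta> \<in> weights"
  shows "\<exists>n::int. dual_form H \<beta> (coroot H \<alpha>) = of_int n"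
    and "\<beta> - dual_form H \<beta> (coroot H \<alpha>) *\<^sub>F \<alpha> \<in> weights"
proof -
  let ?t = "killing_vector H \<alpha>" and ?A = "dual_form H \<alpha> \<alpha>"
  note t = killing_vector[OF root_dual[OF \<alpha>]] and \<alpha>' = root_hfun[OF \<alpha>]
  have A: "?A \<noteq> 0" by (rule root_form_nonzero[OF \<alpha>])
  define h where "h = (2 / ?A) *\<^sub>C ?t"
  have h: "h \<in> H" unfolding h_def by (intro lie_vs.subspace_scale[OF H_subspace] t)
  have "\<alpha> h = 2 / ?A * \<alpha> ?t" using root_dual[OF \<alpha>] t(1) by (simp add: h_def dual_def)
  then have \<alpha>h: "\<alpha> h = 2" using A by (simp add: dual_form_eval[OF root_dual[OF \<alpha>] root_dual[OF \<alpha>]])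
  define c where "c = \<beta> h"
  have c: "dual_form H \<beta> (coroot H \<alpha>) = c"
    unfolding c_def h_def by (rule coroot_eval[OF \<alpha> weight_dual[OF \<beta>]])
  obtain e where e: "e \<in> weight_space \<alpha>" "e \<noteq> 0"
    using \<alpha> weights_iff[OF \<alpha>'] lie_vs.subspace_0[OF weight_space_subspace] by (auto simp: roots_eq)
  obtain f0 where f0: "f0 \<in> weight_space (- \<alpha>)" "killing e f0 \<noteq> 0"
    using exists_killing_partner[OF e(1) \<alpha>' e(2)] by blast
  define f where "f = (2 / (?A * killing e f0)) *\<^sub>C f0"
  have f: "f \<in> weight_space (- \<alpha>)"
    unfolding f_def by (intro lie_vs.subspace_scale weight_space_subspace f0)
  have "killing e f = 2 / ?A" using f0(2) by (simp add: f_def killing_scale_right)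
  then have ef: "lie e f = h" by (simp add: root_vector_commutator[OF \<alpha> e(1) f] h_def)
  have he: "lie h e = 2 *\<^sub>C e" using weight_space_eigen[OF h \<alpha>' e(1)] \<alpha>h by simp
  have hf: "lie h f = (- 2) *\<^sub>C f" using weight_space_eigen[OF h hfun_uminus[OF \<alpha>'] f] \<alpha>h by simp
  have "\<alpha> \<noteq> 0" using \<alpha> by (simp add: roots_eq)
  have nil_e: "\<exists>n. (lie e ^^ n) z = 0" for z by (rule weight_vector_ad_nilpotent[OF e(1) \<alpha>' \<open>\<alpha> \<noteq> 0\<close>])
  have nil_f: "\<exists>n. (lie f ^^ n) z = 0" for z
    by (rule weight_vector_ad_nilpotent[OF f hfun_uminus[OF \<alpha>']]) (use \<open>\<alpha> \<noteq> 0\<close> in simp)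
  obtain v where v: "v \<in> weight_space \<beta>" "v \<noteq> 0"
    using \<beta> weights_iff[OF weights_hfun[OF \<beta>]] lie_vs.subspace_0[OF weight_space_subspace] by blast
  have hv: "lie h v = c *\<^sub>C v" unfolding c_def by (rule weight_space_eigen[OF h weights_hfun[OF \<beta>] v(1)])
  have goal: "\<beta> - c *\<^sub>F \<alpha> \<in> weights"
    if "z \<noteq> 0" "z \<in> weight_space \<gamma>" "\<gamma> = \<beta> - c *\<^sub>F \<alpha>" for z \<gamma>
  proof -
    have "\<beta> - c *\<^sub>F \<alpha> = \<beta> + (- c) *\<^sub>F \<alpha>" by (simp add: scaleF_def fun_eq_iff)
    then have "\<beta> - c *\<^sub>F \<alpha> \<in> hfun" by (simp only: hfun_add hfun_scale weights_hfun[OF \<beta>] \<alpha>')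
    then show ?thesis using weights_iff that by blast
  qed
  obtain k m :: nat where km: "c = of_nat m - 2 * of_nat k"
    "\<And>j. j \<le> m \<Longrightarrow> (lie f ^^ j) ((lie e ^^ k) v) \<noteq> 0"
    using sl2_string[OF ef he hf nil_e nil_f v(2) hv] by blast
  have "c = of_int (int m - 2 * int k)" using km(1) by simp
  then show "\<exists>n::int. dual_form H \<beta> (coroot H \<alpha>) = of_int n" using c by blast
  have "\<beta> - c *\<^sub>F \<alpha> \<in> weights"
  proof (cases "k \<le> m")
    case True
    show ?thesis
    proof (rule goal)
      show "(lie f ^^ (m - k)) ((lie e ^^ k) v) \<noteq> 0" by (rule km(2)) simp
      show "(lie f ^^ (m - k)) ((lie e ^^ k) v)
          \<in> weight_space (\<beta> + of_nat k *\<^sub>F \<alpha> + of_nat (m - k) *\<^sub>F (- \<alpha>))"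
        by (rule weight_space_pow[OF f weight_space_pow[OF e(1) v(1)]])
      show "\<beta> + of_nat k *\<^sub>F \<alpha> + of_nat (m - k) *\<^sub>F (- \<alpha>) = \<beta> - c *\<^sub>F \<alpha>"
        using True by (simp add: km(1) scaleF_def fun_eq_iff of_nat_diff algebra_simps)
    qed
  next
    case False
    have "lie f e = - h" using ef lie_skew[of f e] by simp
    moreover have "lie (- h) f = 2 *\<^sub>C f" "lie (- h) e = (- 2) *\<^sub>C e" "lie (- h) v = (- c) *\<^sub>C v"
      using he hf hv by (simp_all add: lie_uminus_left)
    ultimately obtain k' m' :: nat where km': "- c = of_nat m' - 2 * of_nat k'"
      "\<And>j. j \<le> m' \<Longrightarrow> (lie e ^^ j) ((lie f ^^ k') v) \<noteq> 0"
      using sl2_string[of f e "- h" v "- c"] nil_e nil_f v(2) by blast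
    have "of_int (int m' - 2 * int k') = (of_int (2 * int k - int m) :: complex)"
      using km(1) km'(1) by simp
    then have "int m' - 2 * int k' = 2 * int k - int m" by (simp only: of_int_eq_iff)
    then have "k' \<le> m'" using False by simp
    show ?thesis
    proof (rule goal)
      show "(lie e ^^ (m' - k')) ((lie f ^^ k') v) \<noteq> 0" by (rule km'(2)) simp
      show "(lie e ^^ (m' - k')) ((lie f ^^ k') v)
          \<in> weight_space (\<beta> + of_nat k' *\<^sub>F (- \<alpha>) + of_nat (m' - k') *\<^sub>F \<alpha>)"
        by (rule weight_space_pow[OF e(1) weight_space_pow[OF f v(1)]])
      have "c = 2 * of_nat k' - of_nat m'" using km'(1) by (simp add: algebra_simps)
      then have "\<beta> x + of_nat k' * - \<alpha> x + of_nat (m' - k') * \<alpha> x = \<beta> x - c * \<alpha> x" for x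
        using \<open>k' \<le> m'\<close> by (simp only: of_nat_diff) (simp add: algebra_simps)
      then show "\<beta> + of_nat k' *\<^sub>F (- \<alpha>) + of_nat (m' - k') *\<^sub>F \<alpha> = \<beta> - c *\<^sub>F \<alpha>"
        by (simp add: scaleF_def fun_eq_iff)
    qed
  qed
  then show "\<beta> - dual_form H \<beta> (coroot H \<alpha>) *\<^sub>F \<alpha> \<in> weights" by (simp add: c)
qed

lemma coroot_self: "\<alpha> \<in> roots H \<Longrightarrow> dual_form H \<alpha> (coroot H \<alpha>) = 2"
  using coroot_eval[of \<alpha> \<alpha>] root_form_nonzero[of \<alpha>] killing_vector(1)[of \<alpha>] root_dual[of \<alpha>]
    dual_form_eval[of \<alpha> \<alpha>] by (simp add: dual_def)

lemma coroot_dual: "\<alpha> \<in> roots H \<Longrightarrow> coroot H \<alpha> \<in> dual H"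
  by (simp add: coroot_def dual_scale root_dual)

theorem reflection_root:
  assumes \<alpha>: "\<alpha> \<in> roots H" and \<beta>: "\<beta> \<in> roots H"
  shows "\<beta> - dual_form H \<beta> (coroot H \<alpha>) *\<^sub>F \<alpha> \<in> roots H"
proof -
  let ?c = "dual_form H \<beta> (coroot H \<alpha>)"
  have "\<beta> - ?c *\<^sub>F \<alpha> \<noteq> 0"
  proof
    assume "\<beta> - ?c *\<^sub>F \<alpha> = 0"
    then have \<beta>c: "\<beta> = ?c *\<^sub>F \<alpha>" by simp
    have "?c = dual_form H (?c *\<^sub>F \<alpha>) (coroot H \<alpha>)" using \<beta>c by simp
    also have "\<dots> = ?c * 2"
      using dual_form_scale[OF root_dual[OF \<alpha>] coroot_dual[OF \<alpha>]] by (simp add: coroot_self[OF \<alpha>])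
    finally have "?c = 0" by simp
    then show False using \<beta>c \<beta> by (simp add: roots_eq)
  qed
  then show ?thesis using reflection_weight(2)[OF \<alpha>] \<beta> by (simp add: roots_eq)
qed

text \<open>Let \<open>t\<close> be the Killing vector of \<open>\<alpha>\<close>. With \<open>\<lambda> t = n(\<lambda>) (\<alpha>, \<alpha>) / 2\<close> for integers \<open>n(\<lambda>)\<close>, the Killing form gives
  \<open>(\<alpha>, \<alpha>) = (\<alpha>, \<alpha>)\<^sup>2 S / 4\<close> where \<open>S\<close> is the sum of the squares
  \<open>n(\<lambda>)\<^sup>2\<close> with multiplicities.\<close>

theorem root_form_positive:
  assumes \<alpha>: "\<alpha> \<in> roots H"
  shows "\<exists>r>0. dual_form H \<alpha> \<alpha> = of_real r"
proof -
  let ?t = "killing_vector H \<alpha>" and ?A = "dual_form H \<alpha> \<alpha>"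
  note A = root_form_nonzero[OF \<alpha>] and t = killing_vector[OF root_dual[OF \<alpha>]]
  have "\<forall>\<mu>\<in>weights. \<exists>n::int. \<mu> ?t = ?A / 2 * of_int n"
  proof
    fix \<mu> assume \<mu>: "\<mu> \<in> weights"
    obtain n :: int where n: "dual_form H \<mu> (coroot H \<alpha>) = of_int n"
      using reflection_weight(1)[OF \<alpha> \<mu>] by blast
    then have "2 / ?A * \<mu> ?t = of_int n"
      using coroot_eval[OF \<alpha> weight_dual[OF \<mu>]] weight_dual[OF \<mu>] t(1) by (simp add: dual_def)
    then have "\<mu> ?t = ?A / 2 * of_int n" using A by (simp add: field_simps)
    then show "\<exists>n::int. \<mu> ?t = ?A / 2 * of_int n" by blast
  qed
  from bchoice[OF this] obtain n :: "('g \<Rightarrow> complex) \<Rightarrow> int"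
    where n: "\<forall>\<mu>\<in>weights. \<mu> ?t = ?A / 2 * of_int (n \<mu>)" by blast
  define S where "S = (\<Sum>\<mu>\<in>weights. real (weight_mult \<mu>) * (of_int (n \<mu>))\<^sup>2)"
  have "?A = (\<Sum>\<mu>\<in>weights. of_nat (weight_mult \<mu>) * \<mu> ?t * \<mu> ?t)"
    unfolding dual_form_def by (rule killing_square[OF t(1)])
  also have "\<dots> = (\<Sum>\<mu>\<in>weights. ?A\<^sup>2 / 4 * of_real (real (weight_mult \<mu>) * (of_int (n \<mu>))\<^sup>2))"
  proof (intro sum.cong refl)
    fix \<mu> assume "\<mu> \<in> weights"
    then have "\<mu> ?t = ?A / 2 * of_int (n \<mu>)" using n by blast
    then show "of_nat (weight_mult \<mu>) * \<mu> ?t * \<mu> ?t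
        = ?A\<^sup>2 / 4 * of_real (real (weight_mult \<mu>) * (of_int (n \<mu>))\<^sup>2)"
      by (simp only:) (simp add: power2_eq_square)
  qed
  also have "\<dots> = ?A\<^sup>2 / 4 * of_real S" by (simp add: S_def sum_distrib_left)
  finally have "?A * 4 = ?A * (?A * of_real S)" by (simp add: power2_eq_square field_simps)
  then have AS: "?A * of_real S = 4" using A by (simp only: mult_cancel_left) simp
  have "S \<ge> 0" unfolding S_def by (intro sum_nonneg) auto
  moreover have "S \<noteq> 0" using AS by auto
  ultimately have "4 / S > 0" by simp
  moreover have "?A = of_real (4 / S)" using AS \<open>S \<noteq> 0\<close> by (simp add: field_simps)
  ultimately show ?thesis by blast
qed

end

section \<open>Pairings, reflections and coordinates\<close>

locale parabolic_setting = semisimple_cartan basis0 H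
  for basis0 :: "'g::complex_lie_algebra set" and H :: "'g set" +
  fixes \<Delta> I :: "('g \<Rightarrow> complex) set"
  assumes simple: "simple_system H \<Delta>" and I_subset: "I \<subseteq> \<Delta>"
begin

abbreviation pairing :: "('g \<Rightarrow> complex) \<Rightarrow> ('g \<Rightarrow> complex) \<Rightarrow> complex" where
  "pairing \<nu> \<alpha> \<equiv> dual_form H \<nu> (coroot H \<alpha>)"

definition refl :: "('g \<Rightarrow> complex) \<Rightarrow> ('g \<Rightarrow> complex) \<Rightarrow> 'g \<Rightarrow> complex" where
  "refl \<alpha> \<nu> = \<nu> - pairing \<nu> \<alpha> *\<^sub>F \<alpha>"

abbreviation Pos :: "('g \<Rightarrow> complex) set" where
  "Pos \<equiv> positive_roots H \<Delta>"

lemma \<Delta>_roots: "\<Delta> \<subseteq> roots H" and \<Delta>_finite: "finite \<Delta>"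
  and \<Delta>_independent: "dual_vs.independent \<Delta>" and \<Delta>_span: "dual_vs.span \<Delta> = dual H"
  and \<Delta>_sign: "\<alpha> \<in> roots H \<Longrightarrow> nat_combination \<Delta> \<alpha> \<or> nat_combination \<Delta> (- \<alpha>)"
  using simple by (auto simp: simple_system_def)

lemma I_roots: "I \<subseteq> roots H"
  using I_subset \<Delta>_roots by blast

lemma finite_roots: "finite (roots H)"
  by (simp add: roots_eq finite_weights)

lemma dual_subspace: "dual_vs.subspace (dual H)"
  using dual_vs.subspace_span[of \<Delta>] by (simp only: \<Delta>_span)

lemma dual_diff: "\<mu> \<in> dual H \<Longrightarrow> \<nu> \<in> dual H \<Longrightarrow> \<mu> - \<nu> \<in> dual H"
  by (rule dual_vs.subspace_diff[OF dual_subspace])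

lemma dual_uminus: "\<mu> \<in> dual H \<Longrightarrow> - \<mu> \<in> dual H"
  by (rule dual_vs.subspace_neg[OF dual_subspace])

lemma dual_sum: "(\<And>i. i \<in> A \<Longrightarrow> f i \<in> dual H) \<Longrightarrow> sum f A \<in> dual H"
  by (rule dual_vs.subspace_sum[OF dual_subspace])

lemma dual_form_uminus: "\<mu> \<in> dual H \<Longrightarrow> \<kappa> \<in> dual H \<Longrightarrow> dual_form H (- \<mu>) \<kappa> = - dual_form H \<mu> \<kappa>"
  using dual_form_scale[of \<mu> \<kappa> "-1"] by simp

lemma dual_form_diff: "\<mu> \<in> dual H \<Longrightarrow> \<nu> \<in> dual H \<Longrightarrow> \<kappa> \<in> dual H \<Longrightarrow>
    dual_form H (\<mu> - \<nu>) \<kappa> = dual_form H \<mu> \<kappa> - dual_form H \<nu> \<kappa>"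
  using dual_form_add[of \<mu> "- \<nu>" \<kappa>] by (simp add: dual_form_uminus dual_uminus)

lemma dual_form_zero: "\<kappa> \<in> dual H \<Longrightarrow> dual_form H 0 \<kappa> = 0"
  using dual_form_scale[of \<kappa> \<kappa> 0] by simp

lemma dual_form_sum:
  assumes "\<And>i. i \<in> A \<Longrightarrow> f i \<in> dual H" "\<kappa> \<in> dual H"
  shows "dual_form H (sum f A) \<kappa> = (\<Sum>i\<in>A. dual_form H (f i) \<kappa>)"
  using assms
  by (induction A rule: infinite_finite_induct)
    (auto simp: dual_form_zero dual_form_add dual_sum)

lemma pairing_eq:
  assumes "\<alpha> \<in> dual H" "\<nu> \<in> dual H"
  shows "pairing \<nu> \<alpha> = 2 / dual_form H \<alpha> \<alpha> * dual_form H \<nu> \<alpha>"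
  unfolding coroot_def using assms dual_form_scale dual_form_commute by metis

lemma pairing_uminus_root:
  assumes "\<alpha> \<in> dual H" "\<nu> \<in> dual H"
  shows "pairing \<nu> (- \<alpha>) = - pairing \<nu> \<alpha>"
proof -
  have "dual_form H \<nu> (- \<alpha>) = - dual_form H \<nu> \<alpha>" if "\<nu> \<in> dual H" for \<nu>
    using dual_form_uminus[OF assms(1) that] by (simp add: dual_form_commute)
  then show ?thesis
    using assms by (simp add: pairing_eq dual_uminus dual_form_uminus)
qed

lemma refl_dual: "\<alpha> \<in> roots H \<Longrightarrow> \<nu> \<in> dual H \<Longrightarrow> refl \<alpha> \<nu> \<in> dual H"
  by (simp add: refl_def dual_diff dual_scale root_dual)

lemma pairing_refl_self: "\<alpha> \<in> roots H \<Longrightarrow> \<nu> \<in> dual H \<Longrightarrow> pairing (refl \<alpha> \<nu>) \<alpha> = - pairing \<nu> \<alpha>"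
  by (simp add: refl_def dual_form_diff dual_scale root_dual coroot_dual dual_form_scale coroot_self)

lemma refl_refl: "\<alpha> \<in> roots H \<Longrightarrow> \<nu> \<in> dual H \<Longrightarrow> refl \<alpha> (refl \<alpha> \<nu>) = \<nu>"
  unfolding refl_def[of \<alpha> "refl \<alpha> \<nu>"] by (simp add: pairing_refl_self) (simp add: refl_def)

lemma refl_self: "\<alpha> \<in> roots H \<Longrightarrow> refl \<alpha> \<alpha> = - \<alpha>"
  by (simp add: refl_def coroot_self) (simp add: scaleF_def fun_eq_iff)

lemma refl_add: "\<alpha> \<in> roots H \<Longrightarrow> \<mu> \<in> dual H \<Longrightarrow> \<nu> \<in> dual H \<Longrightarrow> refl \<alpha> (\<mu> + \<nu>) = refl \<alpha> \<mu> + refl \<alpha> \<nu>"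
  by (simp add: refl_def dual_form_add coroot_dual) (simp add: scaleF_def fun_eq_iff algebra_simps)

lemma refl_scale: "\<alpha> \<in> roots H \<Longrightarrow> \<nu> \<in> dual H \<Longrightarrow> refl \<alpha> (c *\<^sub>F \<nu>) = c *\<^sub>F refl \<alpha> \<nu>"
  by (simp add: refl_def dual_form_scale coroot_dual) (simp add: scaleF_def fun_eq_iff algebra_simps)

lemma refl_root: "\<alpha> \<in> roots H \<Longrightarrow> \<beta> \<in> roots H \<Longrightarrow> refl \<alpha> \<beta> \<in> roots H"
  unfolding refl_def by (rule reflection_root)

lemma uminus_root: "\<alpha> \<in> roots H \<Longrightarrow> - \<alpha> \<in> roots H"
  using refl_root[of \<alpha> \<alpha>] by (simp add: refl_self)

lemma dual_form_refl:
  assumes \<alpha>: "\<alpha> \<in> roots H" and \<mu>: "\<mu> \<in> dual H" and \<nu>: "\<nu> \<in> dual H"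
  shows "dual_form H (refl \<alpha> \<mu>) (refl \<alpha> \<nu>) = dual_form H \<mu> \<nu>"
proof -
  note d = root_dual[OF \<alpha>]
  have half: "dual_form H \<kappa> \<alpha> = dual_form H \<alpha> \<alpha> / 2 * pairing \<kappa> \<alpha>" if "\<kappa> \<in> dual H" for \<kappa>
    using root_form_nonzero[OF \<alpha>] by (simp add: pairing_eq[OF d that])
  have left: "dual_form H (refl \<alpha> \<mu>) \<kappa> = dual_form H \<mu> \<kappa> - pairing \<mu> \<alpha> * dual_form H \<kappa> \<alpha>"
    if "\<kappa> \<in> dual H" for \<kappa>
    unfolding refl_def using that \<mu> d
    by (simp add: dual_form_diff dual_scale dual_form_scale dual_form_commute[of \<alpha>])
  have "dual_form H \<mu> (refl \<alpha> \<nu>) = dual_form H \<mu> \<nu> - pairing \<nu> \<alpha> * dual_form H \<mu> \<alpha>"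
    unfolding refl_def dual_form_commute[of \<mu>] using \<mu> \<nu> d
    by (simp add: dual_form_diff dual_scale dual_form_scale)
  then show ?thesis
    by (simp add: left refl_dual[OF \<alpha> \<nu>] half \<mu> \<nu> pairing_refl_self[OF \<alpha> \<nu>])
qed

abbreviation co :: "('g \<Rightarrow> complex) \<Rightarrow> ('g \<Rightarrow> complex) \<Rightarrow> complex" where
  "co \<delta> \<nu> \<equiv> dual_vs.representation \<Delta> \<nu> \<delta>"

lemma in_span: "\<nu> \<in> dual H \<longleftrightarrow> \<nu> \<in> dual_vs.span \<Delta>"
  by (simp only: \<Delta>_span)

lemma co_diff: "\<mu> \<in> dual H \<Longrightarrow> \<nu> \<in> dual H \<Longrightarrow> co \<delta> (\<mu> - \<nu>) = co \<delta> \<mu> - co \<delta> \<nu>"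
  unfolding in_span by (simp only: dual_vs.representation_diff[OF \<Delta>_independent])

lemma co_uminus: "\<mu> \<in> dual H \<Longrightarrow> co \<delta> (- \<mu>) = - co \<delta> \<mu>"
  unfolding in_span by (simp only: dual_vs.representation_neg[OF \<Delta>_independent])

lemma co_scale: "\<mu> \<in> dual H \<Longrightarrow> co \<delta> (c *\<^sub>F \<mu>) = c * co \<delta> \<mu>"
  unfolding in_span by (simp only: dual_vs.representation_scale[OF \<Delta>_independent])

lemma co_sum: "(\<And>i. i \<in> A \<Longrightarrow> f i \<in> dual H) \<Longrightarrow> co \<delta> (sum f A) = (\<Sum>i\<in>A. co \<delta> (f i))"
  unfolding in_span by (simp only: dual_vs.representation_sum[OF \<Delta>_independent])

lemma co_simple: "\<alpha> \<in> \<Delta> \<Longrightarrow> co \<delta> \<alpha> = (if \<delta> = \<alpha> then 1 else 0)"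
  by (simp only: dual_vs.representation_basis[OF \<Delta>_independent])

lemma sum_co: "\<nu> \<in> dual H \<Longrightarrow> (\<Sum>\<delta>\<in>\<Delta>. co \<delta> \<nu> *\<^sub>F \<delta>) = \<nu>"
  unfolding in_span
  by (rule dual_vs.sum_representation_eq[OF \<Delta>_independent _ \<Delta>_finite subset_refl])

lemma co_combination:
  assumes "J \<subseteq> \<Delta>" "\<delta> \<in> \<Delta>"
  shows "co \<delta> (\<Sum>\<epsilon>\<in>J. c \<epsilon> *\<^sub>F \<epsilon>) = (if \<delta> \<in> J then c \<delta> else 0)"
proof -
  have J: "\<epsilon> \<in> dual H" "\<epsilon> \<in> \<Delta>" if "\<epsilon> \<in> J" for \<epsilon> using that assms \<Delta>_roots root_dual by blast+
  have "co \<delta> (\<Sum>\<epsilon>\<in>J. c \<epsilon> *\<^sub>F \<epsilon>) = (\<Sum>\<epsilon>\<in>J. c \<epsilon> * (if \<delta> = \<epsilon> then 1 else 0))"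
    using J by (simp add: co_sum dual_scale co_scale co_simple)
  also have "\<dots> = (\<Sum>\<epsilon>\<in>J. if \<delta> = \<epsilon> then c \<epsilon> else 0)" by (intro sum.cong) auto
  also have "\<dots> = (if \<delta> \<in> J then c \<delta> else 0)"
    using finite_subset[OF assms(1) \<Delta>_finite] by simp
  finally show ?thesis .
qed

lemma nat_combination_iff:
  assumes "\<nu> \<in> dual H"
  shows "nat_combination \<Delta> \<nu> \<longleftrightarrow> (\<forall>\<delta>\<in>\<Delta>. co \<delta> \<nu> \<in> \<nat>)"
proof
  assume "nat_combination \<Delta> \<nu>"
  then show "\<forall>\<delta>\<in>\<Delta>. co \<delta> \<nu> \<in> \<nat>" by (auto simp: nat_combination_def co_combination)
next
  assume "\<forall>\<delta>\<in>\<Delta>. co \<delta> \<nu> \<in> \<nat>"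
  then have "\<forall>\<delta>\<in>\<Delta>. \<exists>n. co \<delta> \<nu> = of_nat n" by (auto simp: Nats_def)
  from bchoice[OF this] obtain c where c: "\<forall>\<delta>\<in>\<Delta>. co \<delta> \<nu> = of_nat (c \<delta>)" by blast
  have "\<nu> = (\<Sum>\<delta>\<in>\<Delta>. co \<delta> \<nu> *\<^sub>F \<delta>)" by (simp add: sum_co[OF assms])
  also have "\<dots> = (\<Sum>\<delta>\<in>\<Delta>. of_nat (c \<delta>) *\<^sub>F \<delta>)" using c by (intro sum.cong) auto
  finally show "nat_combination \<Delta> \<nu>" unfolding nat_combination_def by blast
qed

lemma Pos_iff: "\<gamma> \<in> Pos \<longleftrightarrow> \<gamma> \<in> roots H \<and> (\<forall>\<delta>\<in>\<Delta>. co \<delta> \<gamma> \<in> \<nat>)"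
  using nat_combination_iff[OF root_dual] by (auto simp: positive_roots_def)

lemma Pos_or_uminus: "\<gamma> \<in> roots H \<Longrightarrow> \<gamma> \<in> Pos \<or> - \<gamma> \<in> Pos"
  using \<Delta>_sign uminus_root by (auto simp: positive_roots_def)

lemma simple_Pos: "\<alpha> \<in> \<Delta> \<Longrightarrow> \<alpha> \<in> Pos"
  using \<Delta>_roots by (auto simp: Pos_iff co_simple)

lemma Nats_uminus_zero:
  assumes "z \<in> \<nat>" "- z \<in> \<nat>"
  shows "z = (0::complex)"
proof -
  obtain m n :: nat where mn: "z = of_nat m" "- z = of_nat n" using assms by (auto simp: Nats_def)
  then have "of_nat (m + n) = (0::complex)" by (metis add.right_inverse of_nat_add)
  then show ?thesis using mn(1) by (simp only: of_nat_eq_0_iff)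
qed

text \<open>The coordinates of a root all have the same sign.\<close>

lemma Pos_if_coordinate_pos:
  assumes \<gamma>: "\<gamma> \<in> roots H" and \<delta>: "\<delta> \<in> \<Delta>" "co \<delta> \<gamma> \<in> \<nat>" "co \<delta> \<gamma> \<noteq> 0"
  shows "\<gamma> \<in> Pos"
proof (rule ccontr)
  assume "\<gamma> \<notin> Pos"
  then have "- \<gamma> \<in> Pos" using Pos_or_uminus[OF \<gamma>] by blast
  then have "- co \<delta> \<gamma> \<in> \<nat>" using \<delta>(1) root_dual[OF \<gamma>] by (auto simp: Pos_iff co_uminus)
  then show False using Nats_uminus_zero \<delta>(2,3) by blast
qed

lemma not_Pos_uminus: "\<gamma> \<in> Pos \<Longrightarrow> - \<gamma> \<notin> Pos"
proof
  assume \<gamma>: "\<gamma> \<in> Pos" "- \<gamma> \<in> Pos"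
  then have d: "\<gamma> \<in> roots H" "\<gamma> \<in> dual H" by (auto simp: Pos_iff root_dual)
  have "co \<delta> \<gamma> = 0" if "\<delta> \<in> \<Delta>" for \<delta>
  proof -
    have "co \<delta> \<gamma> \<in> \<nat>" "- co \<delta> \<gamma> \<in> \<nat>"
      using \<gamma> that d by (auto simp: Pos_iff simp flip: co_uminus)
    then show ?thesis by (rule Nats_uminus_zero)
  qed
  then have "\<gamma> = 0" using sum_co[OF d(2)] by simp
  then show False using d(1) by (simp add: roots_eq)
qed

lemma int_combination_iff:
  assumes "\<gamma> \<in> roots H"
  shows "int_combination I \<gamma> \<longleftrightarrow> (\<forall>\<delta>\<in>\<Delta> - I. co \<delta> \<gamma> = 0)"
proof
  assume "int_combination I \<gamma>"
  then show "\<forall>\<delta>\<in>\<Delta> - I. co \<delta> \<gamma> = 0"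
    by (auto simp: int_combination_def co_combination[OF I_subset])
next
  assume off: "\<forall>\<delta>\<in>\<Delta> - I. co \<delta> \<gamma> = 0"
  have "co \<delta> \<gamma> \<in> \<nat> \<or> - co \<delta> \<gamma> \<in> \<nat>" if "\<delta> \<in> I" for \<delta>
    using Pos_or_uminus[OF assms] that I_subset root_dual[OF assms]
    by (auto simp: Pos_iff co_uminus)
  then have "\<forall>\<delta>\<in>I. \<exists>n::int. co \<delta> \<gamma> = of_int n"
    by (metis Ints_cases Ints_minus Nats_subset_Ints minus_minus subsetD)
  from bchoice[OF this] obtain c :: "_ \<Rightarrow> int" where c: "\<forall>\<delta>\<in>I. co \<delta> \<gamma> = of_int (c \<delta>)" by blast
  have "\<gamma> = (\<Sum>\<delta>\<in>\<Delta>. co \<delta> \<gamma> *\<^sub>F \<delta>)" by (simp add: sum_co[OF root_dual[OF assms]])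
  also have "\<dots> = (\<Sum>\<delta>\<in>I. co \<delta> \<gamma> *\<^sub>F \<delta>)"
    by (rule sum.mono_neutral_right[OF \<Delta>_finite I_subset]) (use off in simp)
  also have "\<dots> = (\<Sum>\<delta>\<in>I. of_int (c \<delta>) *\<^sub>F \<delta>)" using c by (intro sum.cong) auto
  finally show "int_combination I \<gamma>" unfolding int_combination_def by blast
qed

lemma co_refl:
  assumes "\<alpha> \<in> \<Delta>" "\<delta> \<noteq> \<alpha>" "\<nu> \<in> dual H"
  shows "co \<delta> (refl \<alpha> \<nu>) = co \<delta> \<nu>"
proof -
  have "\<alpha> \<in> dual H" using assms(1) \<Delta>_roots root_dual by blast
  then show ?thesis using assms by (simp add: refl_def co_diff dual_scale co_scale co_simple)
qed

text \<open>A simple reflection changes only one coordinate, so it can change the sign of a positive root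
  only if all the other coordinates are zero.\<close>

lemma simple_refl_Pos:
  assumes \<alpha>: "\<alpha> \<in> \<Delta>" and \<beta>: "\<beta> \<in> Pos" and "refl \<alpha> \<beta> \<notin> Pos"
  shows "\<beta> = co \<alpha> \<beta> *\<^sub>F \<alpha>"
proof -
  have \<beta>': "\<beta> \<in> roots H" "\<beta> \<in> dual H" "\<And>\<delta>. \<delta> \<in> \<Delta> \<Longrightarrow> co \<delta> \<beta> \<in> \<nat>"
    using \<beta> by (auto simp: Pos_iff root_dual)
  have r: "refl \<alpha> \<beta> \<in> roots H" using \<alpha> \<Delta>_roots \<beta>'(1) by (intro refl_root) auto
  have "co \<delta> \<beta> = 0" if "\<delta> \<in> \<Delta> - {\<alpha>}" for \<delta>
    using Pos_if_coordinate_pos[OF r, of \<delta>] assms(3) that \<beta>' co_refl[OF \<alpha>, of \<delta> \<beta>] by auto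
  then have "(\<Sum>\<delta>\<in>\<Delta>. co \<delta> \<beta> *\<^sub>F \<delta>) = (\<Sum>\<delta>\<in>{\<alpha>}. co \<delta> \<beta> *\<^sub>F \<delta>)"
    by (intro sum.mono_neutral_right) (use \<alpha> \<Delta>_finite in auto)
  then show ?thesis using sum_co[OF \<beta>'(2)] by simp
qed

section \<open>Words in simple reflections and the exchange property\<close>

definition act :: "('g \<Rightarrow> complex) list \<Rightarrow> ('g \<Rightarrow> complex) \<Rightarrow> 'g \<Rightarrow> complex" where
  "act as = foldr refl as"

lemma act_simps [simp]: "act [] \<nu> = \<nu>" "act (a # as) \<nu> = refl a (act as \<nu>)"
    "act (as @ bs) \<nu> = act as (act bs \<nu>)"
  by (simp_all add: act_def)

lemma
  assumes "set as \<subseteq> roots H"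
  shows act_dual: "\<nu> \<in> dual H \<Longrightarrow> act as \<nu> \<in> dual H"
    and act_root: "\<beta> \<in> roots H \<Longrightarrow> act as \<beta> \<in> roots H"
  using assms by (induction as) (auto simp: refl_dual refl_root)

lemma
  assumes "set as \<subseteq> roots H"
  shows act_add: "\<mu> \<in> dual H \<Longrightarrow> \<nu> \<in> dual H \<Longrightarrow> act as (\<mu> + \<nu>) = act as \<mu> + act as \<nu>"
    and act_scale: "\<nu> \<in> dual H \<Longrightarrow> act as (c *\<^sub>F \<nu>) = c *\<^sub>F act as \<nu>"
  using assms by (induction as) (simp_all add: refl_add refl_scale act_dual)

lemma act_uminus: "set as \<subseteq> roots H \<Longrightarrow> \<nu> \<in> dual H \<Longrightarrow> act as (- \<nu>) = - act as \<nu>"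
  using act_scale[of as \<nu> "-1"] by simp

lemma dual_form_act:
  assumes "set as \<subseteq> roots H" "\<mu> \<in> dual H" "\<nu> \<in> dual H"
  shows "dual_form H (act as \<mu>) (act as \<nu>) = dual_form H \<mu> \<nu>"
  using assms(1) by (induction as) (simp_all add: dual_form_refl act_dual assms)

lemma pairing_act:
  assumes "set as \<subseteq> roots H" "\<nu> \<in> dual H" "\<beta> \<in> dual H"
  shows "pairing (act as \<nu>) (act as \<beta>) = pairing \<nu> \<beta>"
  by (simp add: pairing_eq act_dual dual_form_act assms)

lemma act_rev:
  assumes "set as \<subseteq> roots H" "\<nu> \<in> dual H"
  shows "act (rev as) (act as \<nu>) = \<nu>" "act as (act (rev as) \<nu>) = \<nu>"
proof -
  have *: "act (rev as) (act as \<nu>) = \<nu>" if "set as \<subseteq> roots H" for as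
    using that by (induction as) (auto simp: refl_refl act_dual assms(2))
  show "act (rev as) (act as \<nu>) = \<nu>" "act as (act (rev as) \<nu>) = \<nu>"
    using *[of as] *[of "rev as"] assms(1) by auto
qed

lemma co_act:
  assumes "set as \<subseteq> I" "\<delta> \<in> \<Delta> - I" "\<nu> \<in> dual H"
  shows "co \<delta> (act as \<nu>) = co \<delta> \<nu>"
  using assms(1)
proof (induction as)
  case (Cons a as)
  then have "a \<in> \<Delta>" "a \<noteq> \<delta>" "act as \<nu> \<in> dual H"
    using assms I_subset I_roots by (auto intro!: act_dual)
  then show ?case using Cons co_refl[of a \<delta> "act as \<nu>"] by auto
qed simp

lemma act_combination:
  assumes "set as \<subseteq> roots H" "\<nu> \<in> dual H"
  shows "act as \<nu> = (\<Sum>\<delta>\<in>\<Delta>. co \<delta> \<nu> *\<^sub>F act as \<delta>)"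
proof -
  have "act as (\<Sum>\<delta>\<in>A. co \<delta> \<nu> *\<^sub>F \<delta>) = (\<Sum>\<delta>\<in>A. co \<delta> \<nu> *\<^sub>F act as \<delta>)" if "A \<subseteq> \<Delta>" for A
    using finite_subset[OF that \<Delta>_finite] that
  proof (induction A rule: finite_induct)
    case empty
    have "act as (0 *\<^sub>F \<nu>) = 0 *\<^sub>F act as \<nu>" by (rule act_scale[OF assms])
    then show ?case by (simp only: sum.empty dual_vs.scale_zero_left)
  next
    case (insert \<epsilon> A)
    have "\<delta> \<in> dual H" if "\<delta> \<in> insert \<epsilon> A" for \<delta>
      using insert.prems that \<Delta>_roots root_dual by blast
    then have d: "\<epsilon> \<in> dual H" "(\<Sum>\<delta>\<in>A. co \<delta> \<nu> *\<^sub>F \<delta>) \<in> dual H"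
      by (auto intro!: dual_sum dual_scale)
    have IH: "act as (\<Sum>\<delta>\<in>A. co \<delta> \<nu> *\<^sub>F \<delta>) = (\<Sum>\<delta>\<in>A. co \<delta> \<nu> *\<^sub>F act as \<delta>)"
      using insert by blast
    show ?case
      by (simp only: sum.insert[OF insert.hyps] act_add[OF assms(1) dual_scale[OF d(1)] d(2)]
          act_scale[OF assms(1) d(1)] IH)
  qed
  from this[OF subset_refl] show ?thesis by (simp add: sum_co[OF assms(2)])
qed

text \<open>Follow \<open>\<alpha>\<close> through the word from the right. At the letter \<open>a\<close> where the sign changes, the image
  of \<open>\<alpha>\<close> is a multiple of \<open>a\<close>; the reflection in it is the reflection in \<open>a\<close>, so this letter
  can be deleted.\<close>

lemma exchange:
  assumes "set as \<subseteq> I" "\<alpha> \<in> I" "act as \<alpha> \<notin> Pos"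
  shows "\<exists>bs. set bs \<subseteq> I \<and> length as = Suc (length bs) \<and> (\<forall>\<nu>\<in>dual H. act bs \<nu> = act as (refl \<alpha> \<nu>))"
  using assms
proof (induction as)
  case Nil
  then show ?case using simple_Pos I_subset by auto
next
  case (Cons a as)
  have as: "set as \<subseteq> I" "set as \<subseteq> roots H" and a: "a \<in> I" "a \<in> \<Delta>" "a \<in> roots H"
    and \<alpha>: "\<alpha> \<in> roots H" "\<alpha> \<in> dual H"
    using Cons.prems I_subset I_roots root_dual by auto
  show ?case
  proof (cases "act as \<alpha> \<in> Pos")
    case True
    let ?\<gamma> = "act as \<alpha>"
    define c where "c = co a ?\<gamma>"
    have \<gamma>: "?\<gamma> = c *\<^sub>F a"
      unfolding c_def by (rule simple_refl_Pos[OF a(2) True]) (use Cons.prems in simp)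
    have \<gamma>': "?\<gamma> \<in> roots H" "?\<gamma> \<in> dual H" using act_root[OF as(2) \<alpha>(1)] root_dual by auto
    have "c \<noteq> 0" using \<gamma> \<gamma>'(1) by (auto simp: roots_eq)
    have "act as \<nu> = act (a # as) (refl \<alpha> \<nu>)" if \<nu>: "\<nu> \<in> dual H" for \<nu>
    proof -
      let ?x = "act as \<nu>"
      have x: "?x \<in> dual H" by (rule act_dual[OF as(2) \<nu>])
      have "refl \<alpha> \<nu> = \<nu> + (- pairing \<nu> \<alpha>) *\<^sub>F \<alpha>" by (simp add: refl_def)
      then have "act as (refl \<alpha> \<nu>) = ?x + (- pairing \<nu> \<alpha>) *\<^sub>F ?\<gamma>"
        by (simp only: act_add[OF as(2) \<nu> dual_scale[OF \<alpha>(2)]] act_scale[OF as(2) \<alpha>(2)])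
      also have "pairing \<nu> \<alpha> = pairing ?x ?\<gamma>" by (simp add: pairing_act[OF as(2) \<nu> \<alpha>(2)])
      also have "pairing ?x ?\<gamma> *\<^sub>F ?\<gamma> = pairing ?x a *\<^sub>F a"
      proof -
        have d: "a \<in> dual H" by (rule root_dual[OF a(3)])
        have "dual_form H ?\<gamma> ?\<gamma> = c * c * dual_form H a a"
          unfolding \<gamma> using d by (metis dual_form_commute dual_form_scale dual_scale mult.assoc)
        moreover have "dual_form H ?x ?\<gamma> = c * dual_form H ?x a"
          unfolding \<gamma> using d x by (metis dual_form_commute dual_form_scale)
        ultimately have "c * pairing ?x ?\<gamma> = pairing ?x a"
          using \<open>c \<noteq> 0\<close> root_form_nonzero[OF a(3)] by (simp add: pairing_eq \<gamma>'(2) x d)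
        then show ?thesis unfolding \<gamma> by (simp add: mult.commute)
      qed
      then have "?x + (- pairing ?x ?\<gamma>) *\<^sub>F ?\<gamma> = refl a ?x" by (simp add: refl_def)
      finally have "act as (refl \<alpha> \<nu>) = refl a ?x" .
      then show ?thesis using refl_refl[OF a(3) x] by simp
    qed
    then show ?thesis using as(1) by (intro exI[of _ as]) auto
  next
    case False
    then obtain bs where "set bs \<subseteq> I" "length as = Suc (length bs)"
      "\<forall>\<nu>\<in>dual H. act bs \<nu> = act as (refl \<alpha> \<nu>)" using Cons as by blast
    then show ?thesis using a(1) by (intro exI[of _ "a # bs"]) auto
  qed
qed

section \<open>The longest element\<close>

text \<open>The elements of \<open>BijGroup (dual H)\<close> are extensional, hence the restriction.\<close>

definition word :: "('g \<Rightarrow> complex) list \<Rightarrow> ('g \<Rightarrow> complex) \<Rightarrow> 'g \<Rightarrow> complex" where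
  "word as = restrict (act as) (dual H)"

lemma word_eq_iff: "word as = word bs \<longleftrightarrow> (\<forall>\<nu>\<in>dual H. act as \<nu> = act bs \<nu>)"
  unfolding word_def by (metis restrict_apply' restrict_ext)

lemma reflection_eq: "reflection H \<alpha> = restrict (refl \<alpha>) (dual H)"
  unfolding reflection_def refl_def ..

lemma word_Bij:
  assumes "set as \<subseteq> roots H"
  shows "word as \<in> Bij (dual H)"
proof -
  have "bij_betw (act as) (dual H) (dual H)"
    by (rule bij_betw_byWitness[of _ "act (rev as)"])
      (use assms act_rev act_dual[of "rev as"] in \<open>auto simp: act_dual\<close>)
  then show ?thesis by (simp add: word_def Bij_def bij_betw_restrict_eq)
qed

lemma word_append:
  assumes "set as \<subseteq> roots H" "set bs \<subseteq> roots H"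
  shows "monoid.mult (BijGroup (dual H)) (word as) (word bs) = word (as @ bs)"
  using word_Bij[OF assms(1)] word_Bij[OF assms(2)] act_dual[OF assms(2)]
  by (auto simp: BijGroup_def word_def compose_def restrict_def fun_eq_iff)

lemma reflection_word: "reflection H \<alpha> = word [\<alpha>]"
  by (simp add: reflection_eq word_def restrict_def fun_eq_iff)

lemma one_word: "monoid.one (BijGroup (dual H)) = word []"
  by (simp add: BijGroup_def word_def restrict_def fun_eq_iff)

lemma product_word:
  "set as \<subseteq> roots H \<Longrightarrow>
    foldr (monoid.mult (BijGroup (dual H))) (map (reflection H) as) (monoid.one (BijGroup (dual H))) = word as"
proof (induction as)
  case (Cons a as)
  then show ?case using word_append[of "[a]" as] by (simp add: reflection_word)
qed (simp add: one_word)

lemma reflection_group_words: "reflection_group H I = word ` {as. set as \<subseteq> I}"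
proof
  show "reflection_group H I \<subseteq> word ` {as. set as \<subseteq> I}"
  proof
    fix w assume "w \<in> reflection_group H I"
    then show "w \<in> word ` {as. set as \<subseteq> I}"
      unfolding reflection_group_def
    proof (induction rule: generate.induct)
      case one
      show ?case unfolding one_word by (rule imageI) simp
    next
      case (incl h)
      then show ?case by (auto simp: reflection_word intro!: imageI)
    next
      case (inv h)
      then obtain \<alpha> where \<alpha>: "\<alpha> \<in> I" "h = word [\<alpha>]" by (auto simp: reflection_word)
      have r: "\<alpha> \<in> roots H" using \<alpha>(1) I_roots by blast
      have "monoid.mult (BijGroup (dual H)) h h = word ([\<alpha>] @ [\<alpha>])"
        unfolding \<alpha>(2) by (rule word_append) (use r in auto)
      also have "\<dots> = monoid.one (BijGroup (dual H))"
        unfolding one_word word_eq_iff by (simp add: refl_refl[OF r])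
      finally have sq: "monoid.mult (BijGroup (dual H)) h h = monoid.one (BijGroup (dual H))" .
      have "h \<in> carrier (BijGroup (dual H))"
        unfolding \<alpha>(2) BijGroup_def using word_Bij[of "[\<alpha>]"] r by simp
      then have "m_inv (BijGroup (dual H)) h = h"
        by (rule group.inv_equality[OF group_BijGroup sq, rotated]) fact
      then show ?case using \<alpha> by (auto intro!: imageI)
    next
      case (eng h1 h2)
      then obtain as bs where w: "h1 = word as" "set as \<subseteq> I" "h2 = word bs" "set bs \<subseteq> I" by blast
      then have "monoid.mult (BijGroup (dual H)) h1 h2 = word (as @ bs)"
        using word_append[of as bs] I_roots by (simp add: subset_trans)
      then show ?case using w(2,4) by (auto intro!: imageI)
    qed
  qed
  show "word ` {as. set as \<subseteq> I} \<subseteq> reflection_group H I"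
  proof clarify
    fix as assume "set as \<subseteq> I"
    then show "word as \<in> reflection_group H I"
      unfolding reflection_group_def
    proof (induction as)
      case Nil
      show ?case unfolding one_word[symmetric] by (rule generate.one)
    next
      case (Cons a as)
      then have "monoid.mult (BijGroup (dual H)) (word [a]) (word as) = word (a # as)"
        using word_append[of "[a]" as] I_roots by auto
      moreover have "word [a] \<in> generate (BijGroup (dual H)) (reflection H ` I)"
        using Cons.prems unfolding reflection_word[symmetric] by (intro generate.incl) auto
      ultimately show ?case using Cons generate.eng by (metis set_subset_Cons subset_trans)
    qed
  qed
qed

text \<open>An element is determined by the images of the simple roots, which are roots.\<close>

lemma finite_reflection_group: "finite (reflection_group H I)"
proof (rule finite_imageD)
  have "(\<lambda>w. restrict w \<Delta>) ` reflection_group H I \<subseteq> \<Delta> \<rightarrow>\<^sub>E roots H"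
  proof clarify
    fix w assume "w \<in> reflection_group H I"
    then obtain as where as: "w = word as" "set as \<subseteq> I" by (auto simp: reflection_group_words)
    have "w \<delta> \<in> roots H" if "\<delta> \<in> \<Delta>" for \<delta>
    proof -
      have "\<delta> \<in> roots H" "\<delta> \<in> dual H" using that \<Delta>_roots root_dual by blast+
      then show ?thesis using act_root[of as \<delta>] as I_roots by (auto simp: word_def)
    qed
    then show "restrict w \<Delta> \<in> \<Delta> \<rightarrow>\<^sub>E roots H" by simp
  qed
  then show "finite ((\<lambda>w. restrict w \<Delta>) ` reflection_group H I)"
    by (rule finite_subset) (simp add: finite_PiE \<Delta>_finite finite_roots)
  show "inj_on (\<lambda>w. restrict w \<Delta>) (reflection_group H I)"
  proof (rule inj_onI)
    fix v w
    assume "v \<in> reflection_group H I" "w \<in> reflection_group H I" and eq: "restrict v \<Delta> = restrict w \<Delta>"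
    then obtain as bs where w: "v = word as" "w = word bs" "set as \<subseteq> roots H" "set bs \<subseteq> roots H"
      using I_roots by (auto simp: reflection_group_words)
    have "act as \<delta> = act bs \<delta>" if "\<delta> \<in> \<Delta>" for \<delta>
    proof -
      have "v \<delta> = w \<delta>" using eq that by (metis restrict_apply')
      moreover have "\<delta> \<in> dual H" using that \<Delta>_roots root_dual by blast
      ultimately show ?thesis by (simp add: w word_def)
    qed
    then show "v = w"
      unfolding w word_eq_iff by (simp add: act_combination w)
  qed
qed

abbreviation len :: "(('g \<Rightarrow> complex) \<Rightarrow> 'g \<Rightarrow> complex) \<Rightarrow> nat" where
  "len \<equiv> reflection_length H I"

lemma len_eq: "len w = (LEAST n. \<exists>as. set as \<subseteq> I \<and> length as = n \<and> w = word as)"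
proof -
  have "(set as \<subseteq> I \<and> length as = n \<and>
      w = foldr (monoid.mult (BijGroup (dual H))) (map (reflection H) as) (monoid.one (BijGroup (dual H))))
    = (set as \<subseteq> I \<and> length as = n \<and> w = word as)" for as n
    using product_word[of as] I_roots by (auto simp: subset_trans)
  then show ?thesis unfolding reflection_length_def by presburger
qed

lemma len_le: "set as \<subseteq> I \<Longrightarrow> len (word as) \<le> length as"
  unfolding len_eq by (rule Least_le) blast

lemma reduced_word:
  assumes "set as \<subseteq> I"
  obtains bs where "set bs \<subseteq> I" "length bs = len (word as)" "word bs = word as"
proof -
  have "\<exists>n. \<exists>bs. set bs \<subseteq> I \<and> length bs = n \<and> word as = word bs" using assms by blast
  from LeastI_ex[OF this] show ?thesis using that unfolding len_eq by auto
qed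

text \<open>If \<open>w \<alpha>\<close> were positive, \<open>w s\<^sub>\<alpha>\<close> would make \<open>\<alpha>\<close> negative, and by the exchange property \<open>w\<close> would
  be shorter than \<open>w s\<^sub>\<alpha>\<close>.\<close>

lemma longest_makes_negative:
  assumes as: "set as \<subseteq> I" and max: "\<And>v. v \<in> reflection_group H I \<Longrightarrow> len v \<le> len (word as)"
    and \<alpha>: "\<alpha> \<in> I"
  shows "act as \<alpha> \<notin> Pos"
proof
  assume pos: "act as \<alpha> \<in> Pos"
  have r: "\<alpha> \<in> roots H" "\<alpha> \<in> dual H" "set as \<subseteq> roots H" using \<alpha> as I_roots root_dual by auto
  let ?v = "word (as @ [\<alpha>])"
  obtain cs where cs: "set cs \<subseteq> I" "length cs = len ?v" "word cs = ?v"
    using reduced_word[of "as @ [\<alpha>]"] as \<alpha> by auto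
  have ac: "act cs \<nu> = act as (refl \<alpha> \<nu>)" if "\<nu> \<in> dual H" for \<nu>
    using cs(3) that unfolding word_eq_iff by simp
  have "act cs \<alpha> = - act as \<alpha>" by (simp add: ac r refl_self act_uminus)
  then have "act cs \<alpha> \<notin> Pos" using not_Pos_uminus[OF pos] by simp
  then obtain bs where bs: "set bs \<subseteq> I" "length cs = Suc (length bs)"
    "\<forall>\<nu>\<in>dual H. act bs \<nu> = act cs (refl \<alpha> \<nu>)" using exchange[OF cs(1) \<alpha>] by blast
  have "word bs = word as"
    unfolding word_eq_iff using bs(3) by (simp add: ac r refl_dual refl_refl)
  then have "len (word as) < len ?v" using len_le[OF bs(1)] bs(2) cs(2) by simp
  moreover have "?v \<in> reflection_group H I" using as \<alpha> by (auto simp: reflection_group_words)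
  ultimately show False using max by (simp add: leD)
qed

text \<open>Otherwise a reduced word for the element would end in some \<open>\<alpha>\<close> whose deletion shortens it.\<close>

lemma word_trivial_if_positive:
  assumes as: "set as \<subseteq> I" and pos: "\<And>\<alpha>. \<alpha> \<in> I \<Longrightarrow> act as \<alpha> \<in> Pos"
  shows "word as = word []"
proof -
  obtain cs where cs: "set cs \<subseteq> I" "length cs = len (word as)" "word cs = word as"
    using reduced_word[OF as] by blast
  show ?thesis
  proof (cases cs rule: rev_cases)
    case Nil
    then show ?thesis using cs(3) by simp
  next
    case (snoc ds \<alpha>)
    have ds: "set ds \<subseteq> I" "\<alpha> \<in> I" "set ds \<subseteq> roots H" "\<alpha> \<in> roots H" "\<alpha> \<in> dual H"
      using cs(1) snoc I_roots root_dual by auto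
    have ac: "act as \<nu> = act ds (refl \<alpha> \<nu>)" if "\<nu> \<in> dual H" for \<nu>
      using cs(3) that unfolding word_eq_iff snoc by simp
    have "act as \<alpha> = - act ds \<alpha>" by (simp add: ac ds refl_self act_uminus)
    then have "act ds \<alpha> \<notin> Pos" using not_Pos_uminus pos[OF ds(2)] by fastforce
    then obtain bs where bs: "set bs \<subseteq> I" "length ds = Suc (length bs)"
      "\<forall>\<nu>\<in>dual H. act bs \<nu> = act ds (refl \<alpha> \<nu>)" using exchange[OF ds(1,2)] by blast
    then have "word bs = word as" unfolding word_eq_iff by (simp add: ac)
    then have "len (word as) \<le> length bs" using len_le[OF bs(1)] by simp
    then show ?thesis using cs(2) snoc bs(2) by simp
  qed
qed

lemma sum_in_Nats: "(\<And>i. i \<in> A \<Longrightarrow> f i \<in> \<nat>) \<Longrightarrow> sum f A \<in> \<nat>"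
  by (induction A rule: infinite_finite_induct) auto

text \<open>A positive root without coordinates outside \<open>I\<close> is a nonnegative combination of \<open>I\<close>.\<close>

lemma negative_on_parabolic:
  assumes as: "set as \<subseteq> I" and neg: "\<And>\<alpha>. \<alpha> \<in> I \<Longrightarrow> act as \<alpha> \<notin> Pos"
    and \<eta>: "\<eta> \<in> Pos" "\<And>\<delta>. \<delta> \<in> \<Delta> - I \<Longrightarrow> co \<delta> \<eta> = 0"
  shows "- act as \<eta> \<in> Pos"
proof -
  have r: "set as \<subseteq> roots H" using as I_roots by blast
  have \<eta>': "\<eta> \<in> roots H" "\<eta> \<in> dual H" using \<eta>(1) by (auto simp: Pos_iff root_dual)
  have a\<eta>: "act as \<eta> \<in> roots H" "act as \<eta> \<in> dual H" using act_root[OF r \<eta>'(1)] root_dual by auto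
  have "co \<epsilon> (- act as \<eta>) \<in> \<nat>" if \<epsilon>: "\<epsilon> \<in> \<Delta>" for \<epsilon>
  proof -
    have d: "act as \<delta> \<in> roots H" "act as \<delta> \<in> dual H" if "\<delta> \<in> \<Delta>" for \<delta>
      using that \<Delta>_roots act_root[OF r] root_dual by blast+
    have "co \<epsilon> (act as \<eta>) = (\<Sum>\<delta>\<in>\<Delta>. co \<delta> \<eta> * co \<epsilon> (act as \<delta>))"
      unfolding act_combination[OF r \<eta>'(2)] using d by (simp add: co_sum co_scale dual_scale)
    then have "co \<epsilon> (- act as \<eta>) = (\<Sum>\<delta>\<in>\<Delta>. co \<delta> \<eta> * (- co \<epsilon> (act as \<delta>)))"
      by (simp add: co_uminus a\<eta> sum_negf)
    also have "\<dots> = (\<Sum>\<delta>\<in>I. co \<delta> \<eta> * (- co \<epsilon> (act as \<delta>)))"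
      by (rule sum.mono_neutral_right[OF \<Delta>_finite I_subset]) (use \<eta>(2) in simp)
    also have "\<dots> \<in> \<nat>"
    proof (intro sum_in_Nats Nats_mult)
      fix \<delta> assume \<delta>: "\<delta> \<in> I"
      then have \<delta>': "\<delta> \<in> \<Delta>" using I_subset by blast
      show "co \<delta> \<eta> \<in> \<nat>" using \<eta>(1) \<delta>' by (simp add: Pos_iff)
      have "- act as \<delta> \<in> Pos" using Pos_or_uminus[OF d(1)[OF \<delta>']] neg[OF \<delta>] by blast
      then show "- co \<epsilon> (act as \<delta>) \<in> \<nat>" using \<epsilon> d(2)[OF \<delta>'] by (auto simp: Pos_iff co_uminus)
    qed
    finally show ?thesis .
  qed
  then show ?thesis using uminus_root[OF a\<eta>(1)] by (simp add: Pos_iff)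
qed

text \<open>If \<open>v\<close> and \<open>w\<close> both make all roots in \<open>I\<close> negative, then \<open>v\<^sup>-\<^sup>1 w\<close> keeps them positive.\<close>

lemma negative_word_unique:
  assumes as: "set as \<subseteq> I" "\<And>\<alpha>. \<alpha> \<in> I \<Longrightarrow> act as \<alpha> \<notin> Pos"
    and cs: "set cs \<subseteq> I" "\<And>\<alpha>. \<alpha> \<in> I \<Longrightarrow> act cs \<alpha> \<notin> Pos"
  shows "word as = word cs"
proof -
  have r: "set as \<subseteq> roots H" "set (rev as) \<subseteq> roots H" "set cs \<subseteq> roots H" using as cs I_roots by auto
  have "word (rev as @ cs) = word []"
  proof (rule word_trivial_if_positive)
    show "set (rev as @ cs) \<subseteq> I" using as(1) cs(1) by simp
    fix \<alpha> assume \<alpha>: "\<alpha> \<in> I"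
    then have \<alpha>': "\<alpha> \<in> roots H" "\<alpha> \<in> dual H" "\<alpha> \<in> \<Delta>" using I_roots root_dual I_subset by auto
    let ?\<gamma> = "act cs \<alpha>" and ?\<zeta> = "act (rev as) (act cs \<alpha>)"
    have \<gamma>: "?\<gamma> \<in> roots H" "?\<gamma> \<in> dual H" using act_root[OF r(3) \<alpha>'(1)] root_dual by auto
    have \<zeta>: "?\<zeta> \<in> roots H" "?\<zeta> \<in> dual H" using act_root[OF r(2) \<gamma>(1)] root_dual by auto
    have off: "co \<delta> (- ?\<zeta>) = 0" if "\<delta> \<in> \<Delta> - I" for \<delta>
    proof -
      have "\<delta> \<noteq> \<alpha>" using that \<alpha> by blast
      then show ?thesis
        using co_act[of "rev as" \<delta> ?\<gamma>] co_act[of cs \<delta> \<alpha>] as(1) cs(1) that \<gamma> \<alpha>'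
        by (simp add: co_uminus \<zeta> co_simple)
    qed
    have "?\<zeta> \<in> Pos"
    proof (rule ccontr)
      assume "?\<zeta> \<notin> Pos"
      then have "- ?\<zeta> \<in> Pos" using Pos_or_uminus[OF \<zeta>(1)] by blast
      then have "- act as (- ?\<zeta>) \<in> Pos" using negative_on_parabolic[OF as] off by blast
      moreover have "- act as (- ?\<zeta>) = ?\<gamma>"
        by (simp add: act_uminus[OF r(1) \<zeta>(2)] act_rev(2)[OF r(1) \<gamma>(2)])
      ultimately show False using cs(2)[OF \<alpha>] by simp
    qed
    then show "act (rev as @ cs) \<alpha> \<in> Pos" by simp
  qed
  then have "act (rev as) (act cs \<nu>) = \<nu>" if "\<nu> \<in> dual H" for \<nu>
    using that unfolding word_eq_iff by simp
  then have "act cs \<nu> = act as \<nu>" if "\<nu> \<in> dual H" for \<nu>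
    using act_rev(2)[OF r(1) act_dual[OF r(3) that]] that by simp
  then show ?thesis unfolding word_eq_iff by simp
qed

text \<open>All elements of maximal length make \<open>I\<close> negative, so there is only one of them, as the definite
  description in \<open>longest_element\<close> requires.\<close>

lemma longest_element_word:
  obtains as where "set as \<subseteq> I" "longest_element H I = word as"
    "\<And>\<alpha>. \<alpha> \<in> I \<Longrightarrow> act as \<alpha> \<notin> Pos"
proof -
  let ?G = "reflection_group H I"
  let ?P = "\<lambda>w. w \<in> ?G \<and> (\<forall>v\<in>?G. len v \<le> len w)"
  have "word [] \<in> ?G" by (auto simp: reflection_group_words)
  then have ne: "len ` ?G \<noteq> {}" by blast
  have fin: "finite (len ` ?G)" using finite_reflection_group by simp
  obtain w where w: "w \<in> ?G" "len w = Max (len ` ?G)" using Max_in[OF fin ne] by auto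
  then have "?P w" using Max_ge[OF fin] by simp
  moreover have neg: "\<exists>as. set as \<subseteq> I \<and> w = word as \<and> (\<forall>\<alpha>\<in>I. act as \<alpha> \<notin> Pos)" if "?P w" for w
  proof -
    obtain as where as: "set as \<subseteq> I" "w = word as"
      using \<open>?P w\<close> unfolding reflection_group_words by blast
    then show ?thesis using longest_makes_negative[OF as(1)] \<open>?P w\<close> by blast
  qed
  moreover have "v = w" if "?P v" "?P w" for v w
    using neg[OF that(1)] neg[OF that(2)] negative_word_unique by blast
  ultimately have "\<exists>!w. ?P w" by blast
  then have "?P (longest_element H I)" unfolding longest_element_def by (rule theI')
  then show ?thesis using neg that by blast
qed

section \<open>The half sum of positive roots\<close>

lemma finite_Pos: "finite Pos"
  by (rule finite_subset[OF _ finite_roots]) (auto simp: positive_roots_def)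

lemma Pos_dual: "\<beta> \<in> Pos \<Longrightarrow> \<beta> \<in> dual H"
  by (auto simp: Pos_iff root_dual)

lemma rho_dual: "rho H \<Delta> \<in> dual H"
  unfolding rho_def by (intro dual_scale dual_sum) (auto simp: Pos_dual)

definition nonneg_real :: "complex \<Rightarrow> bool" where
  "nonneg_real z \<longleftrightarrow> Im z = 0 \<and> 0 \<le> Re z"

lemma nonneg_real_sum: "(\<And>i. i \<in> A \<Longrightarrow> nonneg_real (f i)) \<Longrightarrow> nonneg_real (sum f A)"
  by (simp add: nonneg_real_def sum_nonneg)

lemma nonneg_real_mult: "nonneg_real y \<Longrightarrow> nonneg_real z \<Longrightarrow> nonneg_real (y * z)"
  by (simp add: nonneg_real_def)

lemma nonneg_real_Nats: "z \<in> \<nat> \<Longrightarrow> nonneg_real z"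
  by (auto simp: nonneg_real_def Nats_def)

lemma nonneg_real_of_real: "r \<ge> 0 \<Longrightarrow> nonneg_real (of_real r)"
  by (simp add: nonneg_real_def)

text \<open>The reflection in \<open>\<delta>\<close> permutes the positive roots that are not multiples of \<open>\<delta>\<close>, so only the
  multiples contribute to the pairing.\<close>

lemma pairing_rho_simple:
  assumes \<delta>: "\<delta> \<in> \<Delta>"
  shows "nonneg_real (pairing (rho H \<Delta>) \<delta>)"
proof -
  have r: "\<delta> \<in> roots H" "\<delta> \<in> dual H" using \<delta> \<Delta>_roots root_dual by auto
  let ?Q = "{\<beta> \<in> Pos. \<beta> = co \<delta> \<beta> *\<^sub>F \<delta>}"
  have inv: "refl \<delta> \<beta> \<in> Pos - ?Q" if "\<beta> \<in> Pos - ?Q" for \<beta>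
  proof -
    have \<beta>: "\<beta> \<in> Pos" "\<beta> \<noteq> co \<delta> \<beta> *\<^sub>F \<delta>" "\<beta> \<in> dual H" using that Pos_dual by auto
    have "refl \<delta> \<beta> \<in> Pos" using simple_refl_Pos[OF \<delta> \<beta>(1)] \<beta>(2) by blast
    moreover have "refl \<delta> \<beta> \<noteq> c *\<^sub>F \<delta>" for c
    proof
      assume "refl \<delta> \<beta> = c *\<^sub>F \<delta>"
      then have "\<beta> = refl \<delta> (c *\<^sub>F \<delta>)" using refl_refl[OF r(1) \<beta>(3)] by simp
      then have "\<beta> = c *\<^sub>F (- \<delta>)" by (simp only: refl_scale[OF r] refl_self[OF r(1)])
      then have eq: "\<beta> = (- c) *\<^sub>F \<delta>" by simp
      then have "co \<delta> \<beta> = - c" using co_scale[OF r(2), of "- c" \<delta>] \<delta> by (simp add: co_simple)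
      then show False using eq \<beta>(2) by simp
    qed
    ultimately show ?thesis by blast
  qed
  have "(\<Sum>\<beta>\<in>Pos - ?Q. pairing \<beta> \<delta>) = (\<Sum>\<beta>\<in>Pos - ?Q. pairing (refl \<delta> \<beta>) \<delta>)"
    by (rule sum.reindex_bij_witness[of _ "refl \<delta>" "refl \<delta>"])
      (use inv in \<open>auto simp: refl_refl[OF r(1)] Pos_dual\<close>)
  also have "\<dots> = - (\<Sum>\<beta>\<in>Pos - ?Q. pairing \<beta> \<delta>)"
    unfolding sum_negf[symmetric]
    by (intro sum.cong refl) (simp add: pairing_refl_self[OF r(1)] Pos_dual)
  finally have zero: "(\<Sum>\<beta>\<in>Pos - ?Q. pairing \<beta> \<delta>) = 0" by simp
  have "pairing (rho H \<Delta>) \<delta> = of_real (1 / 2) * (\<Sum>\<beta>\<in>Pos. pairing \<beta> \<delta>)"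
    unfolding rho_def
    by (simp add: dual_form_scale dual_form_sum dual_sum Pos_dual coroot_dual[OF r(1)])
  also have "(\<Sum>\<beta>\<in>Pos. pairing \<beta> \<delta>) = (\<Sum>\<beta>\<in>Pos - ?Q. pairing \<beta> \<delta>) + (\<Sum>\<beta>\<in>?Q. pairing \<beta> \<delta>)"
    by (rule sum.subset_diff) (auto simp: finite_Pos)
  also have "\<dots> = (\<Sum>\<beta>\<in>?Q. pairing \<beta> \<delta>)" by (simp add: zero)
  finally have "pairing (rho H \<Delta>) \<delta> = of_real (1 / 2) * (\<Sum>\<beta>\<in>?Q. pairing \<beta> \<delta>)" .
  moreover have "nonneg_real (pairing \<beta> \<delta>)" if "\<beta> \<in> ?Q" for \<beta>
  proof -
    have "pairing \<beta> \<delta> = pairing (co \<delta> \<beta> *\<^sub>F \<delta>) \<delta>" using that by simp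
    also have "\<dots> = co \<delta> \<beta> * of_real 2"
      by (simp add: dual_form_scale[OF r(2) coroot_dual[OF r(1)]] coroot_self[OF r(1)])
    finally show ?thesis
      using that \<delta> nonneg_real_mult[OF nonneg_real_Nats nonneg_real_of_real[of 2]] by (simp add: Pos_iff)
  qed
  ultimately show ?thesis
    by (metis (no_types, lifting) nonneg_real_mult nonneg_real_sum nonneg_real_of_real
        divide_nonneg_nonneg zero_le_one zero_le_numeral)
qed

text \<open>Expand \<open>\<gamma>\<close> in the simple roots; the lengths of roots are positive, so passing between a root and
  its coroot does not change signs.\<close>

lemma pairing_rho_Pos:
  assumes \<gamma>: "\<gamma> \<in> Pos"
  shows "nonneg_real (pairing (rho H \<Delta>) \<gamma>)"
proof -
  have \<gamma>': "\<gamma> \<in> roots H" "\<gamma> \<in> dual H" using \<gamma> Pos_dual by (auto simp: Pos_iff)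
  have d: "\<delta> \<in> roots H" "\<delta> \<in> dual H" if "\<delta> \<in> \<Delta>" for \<delta> using that \<Delta>_roots root_dual by auto
  have "dual_form H \<gamma> (rho H \<Delta>) = dual_form H (\<Sum>\<delta>\<in>\<Delta>. co \<delta> \<gamma> *\<^sub>F \<delta>) (rho H \<Delta>)"
    by (simp add: sum_co[OF \<gamma>'(2)])
  also have "\<dots> = (\<Sum>\<delta>\<in>\<Delta>. co \<delta> \<gamma> * dual_form H \<delta> (rho H \<Delta>))"
    by (simp add: dual_form_sum dual_form_scale d dual_scale rho_dual)
  finally have sum: "dual_form H (rho H \<Delta>) \<gamma> = (\<Sum>\<delta>\<in>\<Delta>. co \<delta> \<gamma> * dual_form H (rho H \<Delta>) \<delta>)"
    by (simp only: dual_form_commute[of "rho H \<Delta>"])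
  have "nonneg_real (dual_form H (rho H \<Delta>) \<delta>)" if \<delta>: "\<delta> \<in> \<Delta>" for \<delta>
  proof -
    obtain s where s: "s > 0" "dual_form H \<delta> \<delta> = of_real s" using root_form_positive[OF d(1)[OF \<delta>]] by blast
    have "dual_form H (rho H \<Delta>) \<delta> = of_real (s / 2) * pairing (rho H \<Delta>) \<delta>"
      using s by (simp add: pairing_eq[OF d(2)[OF \<delta>] rho_dual])
    moreover have "nonneg_real (of_real (s / 2) * pairing (rho H \<Delta>) \<delta>)"
      using s(1) by (intro nonneg_real_mult nonneg_real_of_real pairing_rho_simple[OF \<delta>]) simp
    ultimately show ?thesis by (simp only:)
  qed
  then have "nonneg_real (dual_form H (rho H \<Delta>) \<gamma>)"
    unfolding sum using \<gamma> by (intro nonneg_real_sum nonneg_real_mult[OF nonneg_real_Nats]) (auto simp: Pos_iff)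
  moreover obtain r where r: "r > 0" "dual_form H \<gamma> \<gamma> = of_real r" using root_form_positive[OF \<gamma>'(1)] by blast
  have "pairing (rho H \<Delta>) \<gamma> = of_real (2 / r) * dual_form H (rho H \<Delta>) \<gamma>"
    using r by (simp add: pairing_eq[OF \<gamma>'(2) rho_dual])
  moreover have "nonneg_real (of_real (2 / r))" using r(1) by (intro nonneg_real_of_real) simp
  ultimately show ?thesis using nonneg_real_mult by (simp only:)
qed

section \<open>Antidominant weights in the orbit\<close>

text \<open>The group \<open>W\<^sub>I\<close> does not change the coordinates outside \<open>I\<close>, and one nonzero coordinate decides
  the sign of a root.\<close>

lemma Psi_pos_act:
  assumes as: "set as \<subseteq> I" and \<beta>: "\<beta> \<in> Psi_pos H \<Delta> I"
  shows "act as \<beta> \<in> Psi_pos H \<Delta> I"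
proof -
  have r: "set as \<subseteq> roots H" using as I_roots by blast
  have \<beta>': "\<beta> \<in> roots H" "\<beta> \<in> dual H" "\<beta> \<in> Pos" "\<not> int_combination I \<beta>"
    using \<beta> root_dual by (auto simp: Psi_pos_def Psi_def parabolic_roots_def)
  then obtain \<delta> where \<delta>: "\<delta> \<in> \<Delta> - I" "co \<delta> \<beta> \<noteq> 0" by (auto simp: int_combination_iff)
  have a: "act as \<beta> \<in> roots H" by (rule act_root[OF r \<beta>'(1)])
  have co: "co \<delta> (act as \<beta>) = co \<delta> \<beta>" by (rule co_act[OF as \<delta>(1) \<beta>'(2)])
  have "co \<delta> \<beta> \<in> \<nat>" using \<beta>'(3) \<delta>(1) by (simp add: Pos_iff)
  then have "act as \<beta> \<in> Pos" using Pos_if_coordinate_pos[OF a, of \<delta>] \<delta> co by auto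
  moreover have "\<not> int_combination I (act as \<beta>)" using \<delta> co int_combination_iff[OF a] by metis
  ultimately show ?thesis using a by (auto simp: Psi_pos_def Psi_def parabolic_roots_def)
qed

lemma parabolic_positive_act:
  assumes as: "set as \<subseteq> I" and neg: "\<And>\<alpha>. \<alpha> \<in> I \<Longrightarrow> act as \<alpha> \<notin> Pos"
    and \<beta>: "\<beta> \<in> parabolic_positive_roots H \<Delta> I"
  shows "- act as \<beta> \<in> parabolic_positive_roots H \<Delta> I"
proof -
  have r: "set as \<subseteq> roots H" using as I_roots by blast
  have \<beta>': "\<beta> \<in> roots H" "\<beta> \<in> dual H" "\<beta> \<in> Pos" "\<And>\<delta>. \<delta> \<in> \<Delta> - I \<Longrightarrow> co \<delta> \<beta> = 0"
    using \<beta> root_dual int_combination_iff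
    by (auto simp: parabolic_positive_roots_def parabolic_roots_def)
  have pos: "- act as \<beta> \<in> Pos" by (rule negative_on_parabolic[OF as neg \<beta>'(3,4)])
  then have root: "- act as \<beta> \<in> roots H" by (simp add: Pos_iff)
  have "co \<delta> (- act as \<beta>) = 0" if "\<delta> \<in> \<Delta> - I" for \<delta>
    using co_act[OF as that \<beta>'(2)] \<beta>'(4)[OF that] by (simp add: co_uminus act_dual[OF r \<beta>'(2)])
  then have "int_combination I (- act as \<beta>)" by (simp add: int_combination_iff[OF root])
  then show ?thesis using pos root by (simp add: parabolic_positive_roots_def parabolic_roots_def)
qed

text \<open>With \<open>\<mu> + \<rho> = w (\<nu> + \<rho>)\<close>, the pairing of \<open>\<nu> + \<rho>\<close> with \<open>\<beta>\<close> is the pairing of \<open>\<mu> + \<rho>\<close> with \<open>w \<beta>\<close>.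
  For roots in \<open>\<Phi>\<^sub>I\<^sup>+\<close> it is minus a nonnegative real number.\<close>

theorem Psi_pos_at_empty_iff:
  assumes \<mu>: "\<mu> \<in> dominant_integral_weights H \<Delta> I"
  shows "Psi_pos_at H \<Delta> I \<mu> = {} \<longleftrightarrow>
    (\<exists>\<nu>\<in>antidominant_weights H \<Delta>. \<mu> = dot_action H \<Delta> (longest_element H I) \<nu>)"
proof -
  let ?\<rho> = "rho H \<Delta>"
  obtain as where as: "set as \<subseteq> I" and longest: "longest_element H I = word as"
    and neg: "\<And>\<alpha>. \<alpha> \<in> I \<Longrightarrow> act as \<alpha> \<notin> Pos" using longest_element_word by blast
  have r: "set as \<subseteq> roots H" "set (rev as) \<subseteq> roots H" "set (rev as) \<subseteq> I" using as I_roots by auto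
  have \<mu>d: "\<mu> \<in> dual H" and \<mu>\<rho>: "\<mu> + ?\<rho> \<in> dual H"
    using \<mu> rho_dual by (auto simp: dominant_integral_weights_def intro!: dual_add)
  show ?thesis
  proof
    assume empty: "Psi_pos_at H \<Delta> I \<mu> = {}"
    define x where "x = act (rev as) (\<mu> + ?\<rho>)"
    have x: "x \<in> dual H" "act as x = \<mu> + ?\<rho>"
      unfolding x_def by (rule act_dual[OF r(2) \<mu>\<rho>], rule act_rev(2)[OF r(1) \<mu>\<rho>])
    have "\<mu> = dot_action H \<Delta> (longest_element H I) (x - ?\<rho>)"
      by (simp add: dot_action_def longest word_def x)
    moreover have "x - ?\<rho> \<in> antidominant_weights H \<Delta>"
    proof -
      have "pairing x \<beta> \<notin> \<nat> - {0}" if \<beta>: "\<beta> \<in> Pos" for \<beta>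
      proof -
        have \<beta>d: "\<beta> \<in> dual H" "\<beta> \<in> roots H" using \<beta> Pos_dual by (auto simp: Pos_iff)
        have eq: "pairing x \<beta> = pairing (\<mu> + ?\<rho>) (act as \<beta>)"
          using pairing_act[OF r(1) x(1) \<beta>d(1)] x(2) by simp
        show ?thesis
        proof (cases "\<beta> \<in> parabolic_roots H I")
          case True
          then have \<gamma>: "- act as \<beta> \<in> parabolic_positive_roots H \<Delta> I"
            using parabolic_positive_act[OF as neg] \<beta> by (simp add: parabolic_positive_roots_def)
          let ?\<gamma> = "- act as \<beta>"
          have \<gamma>': "?\<gamma> \<in> Pos" "?\<gamma> \<in> roots H" "?\<gamma> \<in> dual H"
            using \<gamma> Pos_dual by (auto simp: parabolic_positive_roots_def Pos_iff)
          have "pairing \<mu> ?\<gamma> \<in> \<nat>" using \<mu> \<gamma> by (auto simp: dominant_integral_weights_def)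
          then have nn: "nonneg_real (pairing (\<mu> + ?\<rho>) ?\<gamma>)"
            using nonneg_real_Nats[of "pairing \<mu> ?\<gamma>"] pairing_rho_Pos[OF \<gamma>'(1)]
            unfolding dual_form_add[OF \<mu>d rho_dual coroot_dual[OF \<gamma>'(2)]] nonneg_real_def by simp
          have "pairing (\<mu> + ?\<rho>) (act as \<beta>) = - pairing (\<mu> + ?\<rho>) ?\<gamma>"
            using pairing_uminus_root[OF act_dual[OF r(1) \<beta>d(1)] \<mu>\<rho>] by simp
          then have "pairing x \<beta> = - pairing (\<mu> + ?\<rho>) ?\<gamma>" by (simp only: eq)
          then show ?thesis using nn by (auto simp: nonneg_real_def Nats_def complex_eq_iff)
        next
          case False
          then have "\<beta> \<in> Psi_pos H \<Delta> I" using \<beta> \<beta>d by (simp add: Psi_pos_def Psi_def)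
          then have "act as \<beta> \<in> Psi_pos H \<Delta> I" by (rule Psi_pos_act[OF as])
          then show ?thesis using empty eq by (auto simp: Psi_pos_at_def)
        qed
      qed
      then show ?thesis using x(1) rho_dual by (simp add: antidominant_weights_def dual_diff)
    qed
    ultimately show "\<exists>\<nu>\<in>antidominant_weights H \<Delta>. \<mu> = dot_action H \<Delta> (longest_element H I) \<nu>" by blast
  next
    assume "\<exists>\<nu>\<in>antidominant_weights H \<Delta>. \<mu> = dot_action H \<Delta> (longest_element H I) \<nu>"
    then obtain \<nu> where \<nu>: "\<nu> \<in> antidominant_weights H \<Delta>"
      and \<mu>\<nu>: "\<mu> = dot_action H \<Delta> (longest_element H I) \<nu>" by blast
    have \<nu>\<rho>: "\<nu> + ?\<rho> \<in> dual H" using \<nu> rho_dual by (auto simp: antidominant_weights_def intro!: dual_add)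
    have eq: "\<mu> + ?\<rho> = act as (\<nu> + ?\<rho>)"
      using \<nu>\<rho> by (simp add: \<mu>\<nu> dot_action_def longest word_def)
    have "pairing (\<mu> + ?\<rho>) \<beta> \<notin> \<nat> - {0}" if \<beta>: "\<beta> \<in> Psi_pos H \<Delta> I" for \<beta>
    proof -
      have \<beta>d: "\<beta> \<in> dual H" using \<beta> Pos_dual by (auto simp: Psi_pos_def)
      have "act (rev as) \<beta> \<in> Psi_pos H \<Delta> I" by (rule Psi_pos_act[OF r(3) \<beta>])
      then have "act (rev as) \<beta> \<in> Pos" by (simp add: Psi_pos_def)
      moreover have "pairing (\<mu> + ?\<rho>) \<beta> = pairing (\<nu> + ?\<rho>) (act (rev as) \<beta>)"
        unfolding eq using pairing_act[OF r(1) \<nu>\<rho> act_dual[OF r(2) \<beta>d]] act_rev(2)[OF r(1) \<beta>d] by simp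
      ultimately show ?thesis using \<nu> by (auto simp: antidominant_weights_def)
    qed
    then show "Psi_pos_at H \<Delta> I \<mu> = {}" by (auto simp: Psi_pos_at_def)
  qed
qed

end

theorem corollary8:
  fixes H :: "'g::complex_lie_algebra set"
    and \<Delta> I :: "('g \<Rightarrow> complex) set"
    and \<mu> :: "'g \<Rightarrow> complex"
  assumes "finite_dimensional (UNIV :: 'g set)"
    and "semisimple_lie (UNIV :: 'g set)"
    and "cartan_subalgebra H"
    and "simple_system H \<Delta>"
    and "I \<subseteq> \<Delta>"
    and "\<mu> \<in> dominant_integral_weights H \<Delta> I \<inter> regular_weights H \<Delta>"
  shows "Psi_pos_at H \<Delta> I \<mu> = {} \<longleftrightarrow>
    (\<exists>\<nu>\<in>antidominant_weights H \<Delta>. \<mu> = dot_action H \<Delta> (longest_element H I) \<nu>)"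
proof -
  obtain B :: "'g set" where B: "finite B" "lie_vs.span B = UNIV"
    using assms(1) by (auto simp: finite_dimensional_def)
  obtain B' :: "'g set" where B': "lie_vs.independent B'" "UNIV \<subseteq> lie_vs.span B'"
    using lie_vs.maximal_independent_subset by blast
  have "finite B'" using lie_vs.independent_span_bound[OF B(1) B'(1)] B(2) by simp
  then interpret parabolic_setting B' H \<Delta> I
    by unfold_locales (use B' assms in auto)
  show ?thesis using Psi_pos_at_empty_iff assms(6) by blast
qed

end
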